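(* Let $0<\varepsilon\le 1$, $K\ge 1$, and $B>0$ be constants, and let $x\in\{0,1\}^n$ be a random binary vector uniformly chosen from among all binary vectors containing exactly $s$ ones, for some integer $s$ satisfying $|s-n/2|\le(1-\varepsilon)n/2$. If $\mathbf{M}_n$ is a random $n\times n$ matrix whose rows are independent and identically distributed copies of the vector $x$, then, for all sufficiently large $n$ (depending only on $\varepsilon$, $K$, and $B$), the probability that one of the non-trivial eigenvalues of $\mathbf{M}_n$ is an algebraic number of degree at most $K$ is bounded above by $n^{-B}$.
   Context: The degree of an algebraic number is the degree of its minimal polynomial over $\mathbb{Q}$. Since every row of $\mathbf{M}_n$ sums to $s$, the number $s$ is always an eigenvalue of $\mathbf{M}_n$, with the all-ones vector as eigenvector; this is called the trivial eigenvalue. The non-trivial eigenvalues are the complex eigenvalues $z$ of $\mathbf{M}_n$ with $z\ne s$. *)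

theory Defs
  imports
    "HOL-Probability.Product_PMF"
    "HOL-Computational_Algebra.Polynomial"
    "HOL-Computational_Algebra.Polynomial_Factorial"
    "Jordan_Normal_Form.Char_Poly"
begin

definition binary_vecs :: "nat \<Rightarrow> int \<Rightarrow> int vec set" where
  "binary_vecs n s =
     {v \<in> carrier_vec n. (\<forall>i<n. v $ i \<in> {0, 1}) \<and> int (card {i. i < n \<and> v $ i = 1}) = s}"

(* pmf_of_set is the uniform distribution only on nonempty finite sets; binary_vecs n s is
   finite, and nonempty exactly when 0 <= s <= n. *)
definition random_row :: "nat \<Rightarrow> int \<Rightarrow> int vec pmf" where
  "random_row n s = pmf_of_set (binary_vecs n s)"

(* The law of a matrix with independent rows, each distributed as "random_row n s".
   The second argument of Pi_pmf is only the value at indices outside {..<n}. *)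
definition random_matrix :: "nat \<Rightarrow> int \<Rightarrow> int mat pmf" where
  "random_matrix n s =
     map_pmf (mat\<^sub>r n n) (Pi_pmf {..<n} (0\<^sub>v n) (\<lambda>_. random_row n s))"

definition nontrivial_eigenvalue :: "int \<Rightarrow> int mat \<Rightarrow> complex \<Rightarrow> bool" where
  "nontrivial_eigenvalue s M z \<longleftrightarrow> eigenvalue (map_mat complex_of_int M) z \<and> z \<noteq> of_int s"

(* The monic rational polynomial of least degree having z as a root. *)
definition is_min_poly :: "rat poly \<Rightarrow> complex \<Rightarrow> bool" where
  "is_min_poly p z \<longleftrightarrow>
     lead_coeff p = 1 \<and> poly (map_poly of_rat p) z = 0 \<and>
     (\<forall>q. q \<noteq> 0 \<and> poly (map_poly of_rat q) z = 0 \<longrightarrow> degree p \<le> degree q)"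

(* Meaningful only if z is algebraic; see ex1_min_poly. *)
definition min_poly :: "complex \<Rightarrow> rat poly" where
  "min_poly z = (THE p. is_min_poly p z)"

definition algebraic_degree :: "complex \<Rightarrow> nat" where
  "algebraic_degree z = degree (min_poly z)"

lemma ex1_min_poly:
  assumes "algebraic z"
  shows "\<exists>!p. is_min_poly p z"
proof -
  let ?ev = "\<lambda>p :: rat poly. poly (map_poly of_rat p) z"
  let ?root = "\<lambda>p. p \<noteq> 0 \<and> ?ev p = 0"
  have smult: "?ev (Polynomial.smult c p) = of_rat c * ?ev p" for c p
  proof -
    have "map_poly of_rat (Polynomial.smult c p) = Polynomial.smult (of_rat c) (map_poly of_rat p :: complex poly)"
      by (rule poly_eqI) (simp add: coeff_map_poly of_rat_mult)
    then show ?thesis by simp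
  qed
  have diff: "?ev (p - q) = ?ev p - ?ev q" for p q
  proof -
    have "map_poly of_rat (p - q) = map_poly of_rat p - (map_poly of_rat q :: complex poly)"
      by (rule poly_eqI) (simp add: coeff_map_poly of_rat_diff)
    then show ?thesis by simp
  qed
  obtain q0 :: "int poly" where q0: "q0 \<noteq> 0" "poly (map_poly of_int q0) z = 0"
    using assms by (rule algebraicE')
  have "map_poly of_rat (map_poly rat_of_int q0) = (map_poly of_int q0 :: complex poly)"
    by (rule poly_eqI) (simp add: coeff_map_poly)
  moreover have "map_poly rat_of_int q0 \<noteq> 0"
    using q0(1) by (simp add: poly_eq_iff coeff_map_poly)
  ultimately have "?root (map_poly rat_of_int q0)"
    using q0(2) by simp
  from ex_has_least_nat[of ?root, OF this, of degree]
  obtain p where p: "p \<noteq> 0" "?ev p = 0" and min: "\<And>q. ?root q \<Longrightarrow> degree p \<le> degree q"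
    by blast
  let ?m = "Polynomial.smult (inverse (lead_coeff p)) p"
  have "lead_coeff ?m = 1" and "degree ?m = degree p"
    using p(1) by simp_all
  moreover have "?ev ?m = 0"
    unfolding smult p(2) by simp
  ultimately have m: "is_min_poly ?m z"
    using min unfolding is_min_poly_def by metis
  have unique: "q = r" if q: "is_min_poly q z" and r: "is_min_poly r z" for q r
  proof (rule ccontr)
    assume neq: "q \<noteq> r"
    have nz: "q \<noteq> 0" "r \<noteq> 0" using q r unfolding is_min_poly_def by fastforce+
    have deg: "degree r = degree q"
      using q r nz unfolding is_min_poly_def by (blast intro: antisym)
    have "?root (q - r)"
      using q r neq unfolding diff is_min_poly_def by force
    then have "degree q \<le> degree (q - r)"
      using q unfolding is_min_poly_def by blast
    moreover have "degree (q - r) \<le> degree q"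
      using deg by (simp add: degree_diff_le)
    ultimately have "degree (q - r) = degree q" by simp
    moreover have "coeff (q - r) (degree q) = 0"
      using q r deg unfolding is_min_poly_def by simp
    ultimately have "lead_coeff (q - r) = 0" by simp
    then show False using neq by (metis leading_coeff_0_iff right_minus_eq)
  qed
  show ?thesis using m unique by blast
qed

end

theory Submission
  imports Defs "HOL-Real_Asymp.Real_Asymp"
begin

text \<open>
  \<^bold>\<open>Reduction to one eigenvalue.\<close> An eigenvalue of a 0/1 matrix has modulus at most \<open>n\<close>, and an eigenvalue of
  degree at most \<open>K\<close> is a root of an integer polynomial with leading coefficient \<open>\<plusminus>1\<close> and degree at most
  \<open>K\<close> all of whose roots are eigenvalues. The coefficients of such a polynomial are polynomially
  bounded in \<open>n\<close>, so only polynomially many numbers can occur (\<open>eigenvalue_in_candidates\<close>,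
  \<open>card_candidates_le\<close>). It remains to show that a fixed complex number \<open>\<mu> \<noteq> s\<close> is an eigenvalue with
  probability at most \<open>n\<^sup>-\<^sup>E\<close>, for every fixed \<open>E\<close> (\<open>eigen_prob_scale\<close>).

  \<^bold>\<open>Which kernel vectors are dangerous.\<close> Row \<open>i\<close> of \<open>M\<close> is the indicator vector of a random \<open>s\<close>-subset
  \<open>X\<close> of \<open>{..<n}\<close>, so row \<open>i\<close> of \<open>M - \<mu>\<close> annihilates \<open>v\<close> if \<open>v(X) = \<mu> v\<^sub>i\<close>, where \<open>v(X)\<close> is the sum of \<open>v\<close>
  over \<open>X\<close>. If \<open>M - \<mu>\<close> is singular, take a left kernel vector with a nonzero entry at \<open>i\<close>: then every \<open>v\<close> that
  is annihilated by the other rows is annihilated by row \<open>i\<close> as well. Row \<open>i\<close> is independent of the other rows,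
  so this is unlikely once the other rows annihilate some \<open>v\<close> for which all atoms of \<open>v(X)\<close> are small. The proof
  must therefore exclude that \<open>n - 1\<close> rows annihilate a nonzero \<open>v\<close> for which \<open>v(X)\<close> has a large atom.

  \<^bold>\<open>Entropy against small balls.\<close> The structure of \<open>v\<close> is measured by the density of additive relations
  \<open>v\<^sub>i\<^sub>1 + \<dots> + v\<^sub>i\<^sub>k = v\<^sub>j\<^sub>1 + \<dots> + v\<^sub>j\<^sub>k\<close> with indices in a set \<open>S\<close>; let \<open>t\<close> be the least such density over
  all \<open>S\<close> with at least \<open>m\<close> elements, where \<open>m\<close> is a power of \<open>n\<close> with exponent slightly below \<open>1\<close>.
  On the one hand the atoms of \<open>v(X)\<close> are at most about \<open>t \<gamma>\<close>, where \<open>\<gamma>\<close> is a negative power of \<open>n\<close>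
  (\<open>row_bound_relations\<close>). On the other hand, averaging over a random relation shows that one relation can be
  imposed on \<open>v\<close> at the price of a factor \<open>O(1/t)\<close> in the probability, and the relation determines one coordinate
  of \<open>v\<close> from others. After \<open>n - m\<close> such steps \<open>v\<close> lies in a fixed space of dimension \<open>m\<close>
  (\<open>encode_structured\<close>), and the probability that \<open>n - 1\<close> rows annihilate a vector of this kind in that space is at
  most about \<open>n\<^sup>m (t \<gamma>)\<^sup>n\<^sup>-\<^sup>m\<close> (\<open>kernel_prob\<close>). The powers of \<open>t\<close> cancel, and those of \<open>\<gamma>\<close> win. Vectors that are constant
  outside \<open>m\<close> coordinates escape the small ball bound and are counted directly (\<open>almost_constant_prob\<close>); this
  is the place where \<open>\<mu> \<noteq> s\<close> matters.

  \<^bold>\<open>The gain \<open>\<gamma>\<close>.\<close> Reveal all of \<open>X\<close> except for the choice of one element in each of many disjoint random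
  cells. Then \<open>v(X)\<close> is a constant plus a sum of independent variables. The variables belonging to \<open>2k\<close> cells
  have a sum whose atoms are, by Cauchy-Schwarz and on average over the cells, at most about \<open>t\<close>. So many
  independent groups have atoms at most \<open>1/q\<close> with \<open>q \<ge> 2\<close> of order \<open>1/t\<close>, and a sum of \<open>g\<close> independent real variables
  with atoms at most \<open>1/q\<close> has atoms of order \<open>1/(q \<surd>g)\<close>, just as for variables that are uniform on an arithmetic
  progression of length \<open>q\<close> (\<open>spread_add\<close>, \<open>window_bound\<close>). The last fact uses the order of the reals; a generic
  real-linear map from the complex numbers to the reals, which creates no new relations, makes it available.
\<close>

section \<open>Sums of independent variables with small atoms\<close>

text \<open>The expectation of \<open>f (k + W)\<close> for \<open>W\<close> uniform on the symmetric progression \<open>-(q - 1), -(q - 3), \<dots>, q - 1\<close>.\<close>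
definition avg :: "nat \<Rightarrow> (int \<Rightarrow> real) \<Rightarrow> int \<Rightarrow> real" where
  "avg q f k = (\<Sum>i<q. f (k + int q - 1 - 2 * int i)) / real q"

text \<open>With \<open>W\<^sub>1, \<dots>, W\<^sub>g\<close> independent copies of that variable and \<open>W\<close> their sum, this is the expectation of
  \<open>sgn (k + W)\<close>; for \<open>k \<ge> 0\<close> it is the probability of \<open>-k < W \<le> k\<close>. As an odd function of \<open>k\<close> it satisfies its
  recursion without any case distinction at \<open>0\<close>.\<close>
definition window :: "nat \<Rightarrow> nat \<Rightarrow> int \<Rightarrow> real" where
  "window q g = (avg q ^^ g) (\<lambda>k. real_of_int (sgn k))"

lemma window_0: "window q 0 k = real_of_int (sgn k)"
  by (simp add: window_def)

lemma window_Suc: "window q (Suc g) k = (\<Sum>i<q. window q g (k + int q - 1 - 2 * int i)) / real q"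
  by (simp add: window_def avg_def)

lemma window_odd: "window q g (- k) = - window q g k"
proof (induction g arbitrary: k)
  case 0
  then show ?case by (simp add: window_0 sgn_minus)
next
  case (Suc g)
  have "(\<Sum>i<q. window q g (- k + int q - 1 - 2 * int i))
      = (\<Sum>i<q. window q g (- k + int q - 1 - 2 * int (q - Suc i)))"
    by (rule sum.nat_diff_reindex[symmetric])
  also have "\<dots> = (\<Sum>i<q. - window q g (k + int q - 1 - 2 * int i))"
  proof (rule sum.cong[OF refl])
    fix i assume "i \<in> {..<q}"
    then have "- k + int q - 1 - 2 * int (q - Suc i) = - (k + int q - 1 - 2 * int i)"
      by auto
    then show "window q g (- k + int q - 1 - 2 * int (q - Suc i)) = - window q g (k + int q - 1 - 2 * int i)"
      using Suc by metis
  qed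
  finally show ?case by (simp add: window_Suc sum_negf)
qed

lemma odd_sum_zero:
  fixes h :: "int \<Rightarrow> real"
  assumes odd: "\<And>k. h (- k) = - h k"
  shows "(\<Sum>i<q. h (int q - 1 - 2 * int i)) = 0"
proof -
  have "(\<Sum>i<q. h (int q - 1 - 2 * int i)) = (\<Sum>i<q. h (int q - 1 - 2 * int (q - Suc i)))"
    by (rule sum.nat_diff_reindex[symmetric])
  also have "\<dots> = (\<Sum>i<q. - h (int q - 1 - 2 * int i))"
  proof (rule sum.cong[OF refl])
    fix i assume "i \<in> {..<q}"
    then have "int q - 1 - 2 * int (q - Suc i) = - (int q - 1 - 2 * int i)" by auto
    then show "h (int q - 1 - 2 * int (q - Suc i)) = - h (int q - 1 - 2 * int i)"
      using odd by metis
  qed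
  finally show ?thesis by (simp add: sum_negf)
qed

text \<open>The rearrangement step. In the grid of differences \<open>t - a\<close> the row of the least \<open>t\<close> and the column of the least \<open>a\<close> form
  a hook along which the differences are strictly monotone, hence distinct, so \<open>bd\<close> applies to it. What remains is
  the grid with one row and one column less. The hooks have sizes \<open>|T| + |A| - 1, |T| + |A| - 3, \<dots>\<close>; if \<open>T\<close>
  is exhausted first, the remaining terms on the right cancel because \<open>h\<close> is odd.\<close>
lemma hook_bound:
  fixes p :: "'a :: linordered_ab_group_add \<Rightarrow> real" and h :: "int \<Rightarrow> real"
  assumes odd: "\<And>k. h (- k) = - h k"
    and bd: "\<And>T. finite T \<Longrightarrow> sum p T \<le> h (int (card T))"
    and "finite A" "finite T"
  shows "(\<Sum>a\<in>A. \<Sum>t\<in>T. p (t - a)) \<le> (\<Sum>i<card A. h (int (card T) + int (card A) - 1 - 2 * int i))"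
  using assms(3,4)
proof (induction "card A" arbitrary: A T)
  case 0
  then show ?case by simp
next
  case (Suc n)
  show ?case
  proof (cases "T = {}")
    case True
    then show ?thesis using odd_sum_zero[of h "card A", OF odd] by simp
  next
    case False
    have "A \<noteq> {}" using Suc by auto
    define a0 where "a0 = Min A"
    define t0 where "t0 = Min T"
    have a0: "a0 \<in> A" "\<And>a. a \<in> A \<Longrightarrow> a0 \<le> a"
      using Suc.prems \<open>A \<noteq> {}\<close> by (auto simp: a0_def)
    have t0: "t0 \<in> T" "\<And>t. t \<in> T \<Longrightarrow> t0 \<le> t"
      using Suc.prems False by (auto simp: t0_def)
    let ?A = "A - {a0}" and ?T = "T - {t0}"
    have cA: "card A = Suc n" "card ?A = n" using Suc a0 by auto
    have cT: "card T = Suc (card ?T)" using t0 Suc.prems False by (metis card_Suc_Diff1)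
    \<comment> \<open>The grid of differences t - a splits into its first row and column, along which the
       differences increase strictly, and the grid with that row and column removed.\<close>
    define P where "P = (\<lambda>a. t0 - a) ` ?A \<union> (\<lambda>t. t - a0) ` T"
    have disj: "(\<lambda>a. t0 - a) ` ?A \<inter> (\<lambda>t. t - a0) ` T = {}"
    proof -
      have "t0 - a < t - a0" if "a \<in> ?A" "t \<in> T" for a t
      proof -
        have "a0 < a" using that a0(2)[of a] by auto
        then have "t0 - a < t0 - a0" by simp
        also have "\<dots> \<le> t - a0" using t0(2)[of t] that by simp
        finally show ?thesis .
      qed
      then show ?thesis by fastforce
    qed
    have i1: "inj_on (\<lambda>a. t0 - a) ?A" and i2: "inj_on (\<lambda>t. t - a0) T"
      by (auto simp: inj_on_def)
    have fin: "finite ?A" "finite T" using Suc.prems by auto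
    have cP: "card P = n + card T"
      unfolding P_def using disj fin i1 i2 cA by (simp add: card_Un_disjoint card_image)
    have sP: "sum p P = (\<Sum>a\<in>?A. p (t0 - a)) + (\<Sum>t\<in>T. p (t - a0))"
      unfolding P_def using disj fin i1 i2 by (simp add: sum.union_disjoint sum.reindex)
    have "finite P" using fin by (simp add: P_def)
    then have hP: "sum p P \<le> h (int (n + card T))" using bd[of P] cP by simp
    have "(\<Sum>a\<in>A. \<Sum>t\<in>T. p (t - a)) = (\<Sum>t\<in>T. p (t - a0)) + (\<Sum>a\<in>?A. \<Sum>t\<in>T. p (t - a))"
      using a0 Suc.prems by (simp add: sum.remove)
    also have "(\<Sum>a\<in>?A. \<Sum>t\<in>T. p (t - a)) = (\<Sum>a\<in>?A. p (t0 - a) + (\<Sum>t\<in>?T. p (t - a)))"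
      using t0 Suc.prems by (intro sum.cong refl) (simp add: sum.remove)
    also have "\<dots> = (\<Sum>a\<in>?A. p (t0 - a)) + (\<Sum>a\<in>?A. \<Sum>t\<in>?T. p (t - a))"
      by (simp add: sum.distrib)
    finally have "(\<Sum>a\<in>A. \<Sum>t\<in>T. p (t - a)) = sum p P + (\<Sum>a\<in>?A. \<Sum>t\<in>?T. p (t - a))"
      using sP by simp
    also have "\<dots> \<le> h (int (n + card T)) + (\<Sum>i<n. h (int (card ?T) + int n - 1 - 2 * int i))"
      using hP Suc.hyps(1)[of ?A ?T] cA Suc.prems by (simp add: add_mono)
    also have "\<dots> = (\<Sum>i<Suc n. h (int (card T) + int (Suc n) - 1 - 2 * int i))"
      unfolding sum.lessThan_Suc_shift using cT by (simp add: algebra_simps)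
    finally show ?thesis using cA by simp
  qed
qed

lemma finite_argmax:
  fixes f :: "'a \<Rightarrow> real"
  assumes "finite F" "F \<noteq> {}"
  shows "\<exists>A\<in>F. \<forall>B\<in>F. f B \<le> f A"
proof -
  have "Max (f ` F) \<in> f ` F" using assms by (intro Max_in) auto
  then obtain A where "A \<in> F" "f A = Max (f ` F)" by auto
  then show ?thesis using assms by (intro bexI[of _ A]) auto
qed

text \<open>A linear functional of a probability vector with entries at most \<open>1/q\<close> is largest when the mass fills up the \<open>q\<close>
  points with the largest coefficients.\<close>
lemma bathtub:
  fixes p c :: "'a \<Rightarrow> real"
  assumes "finite S" "\<And>x. x \<in> S \<Longrightarrow> 0 \<le> p x" "\<And>x. x \<in> S \<Longrightarrow> p x \<le> 1 / real q"
    "sum p S = 1" "q > 0"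
  shows "\<exists>A\<subseteq>S. card A = q \<and> (\<Sum>x\<in>S. p x * c x) \<le> sum c A / real q"
proof -
  have "1 \<le> (\<Sum>x\<in>S. 1 / real q)" using sum_mono[of S p "\<lambda>_. 1 / real q"] assms by simp
  then have "q \<le> card S" using assms by (simp add: field_simps)
  then obtain A0 where A0: "A0 \<subseteq> S" "card A0 = q" using obtain_subset_with_card_n by metis
  let ?F = "{A. A \<subseteq> S \<and> card A = q}"
  have "finite ?F" "?F \<noteq> {}" using A0 assms by auto
  then obtain A where A: "A \<in> ?F" and max: "\<And>A'. A' \<in> ?F \<Longrightarrow> sum c A' \<le> sum c A"
    using finite_argmax[of ?F "sum c"] by blast
  have fA: "finite A" using A assms finite_subset by auto
  have "A \<noteq> {}" using A assms by auto
  then obtain x0 where x0: "x0 \<in> A" "\<And>x. x \<in> A \<Longrightarrow> c x0 \<le> c x"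
    using finite_argmax[of A "\<lambda>x. - c x"] fA by auto
  have out: "c y \<le> c x0" if "y \<in> S - A" for y
  proof -
    let ?B = "insert y (A - {x0})"
    have "card ?B = q" using fA x0 that A by (simp add: card_Suc_Diff1 \<open>A \<noteq> {}\<close> assms(5) card_gt_0_iff)
    then have "?B \<in> ?F" using A that by auto
    then have "sum c ?B \<le> sum c A" by (rule max)
    moreover have "sum c ?B = c y + (sum c A - c x0)" using fA x0 that by (simp add: sum_diff1)
    ultimately show ?thesis by simp
  qed
  have "(\<Sum>x\<in>S. p x * c x) - c x0 = (\<Sum>x\<in>S. p x * (c x - c x0))"
    using assms(4) by (simp add: algebra_simps sum_subtractf flip: sum_distrib_left)
  also have "\<dots> \<le> (\<Sum>x\<in>A. p x * (c x - c x0))"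
  proof -
    have "(\<Sum>x\<in>S - A. p x * (c x - c x0)) \<le> 0"
      using out assms by (intro sum_nonpos mult_nonneg_nonpos) auto
    then show ?thesis using A assms sum.subset_diff[of A S "\<lambda>x. p x * (c x - c x0)"] by auto
  qed
  also have "\<dots> \<le> (\<Sum>x\<in>A. 1 / real q * (c x - c x0))"
    using x0 assms A by (intro sum_mono mult_right_mono) auto
  also have "\<dots> = sum c A / real q - c x0"
    using A assms by (simp add: sum_subtractf flip: sum_distrib_left sum_divide_distrib) (simp add: field_simps)
  finally show ?thesis using A by auto
qed

definition add_pmf :: "real pmf \<Rightarrow> real pmf \<Rightarrow> real pmf" where
  "add_pmf Y X = bind_pmf X (\<lambda>x. map_pmf (\<lambda>y. y + x) Y)"

text \<open>\<open>Y\<close> is at most as concentrated on sets of each size as the sum of \<open>g\<close> independent variables that are uniform on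
  a progression of length \<open>q\<close>.\<close>
definition spread :: "nat \<Rightarrow> nat \<Rightarrow> real pmf \<Rightarrow> bool" where
  "spread q g Y \<longleftrightarrow> (\<forall>T. finite T \<longrightarrow> measure_pmf.prob Y T \<le> window q g (int (card T)))"

lemma prob_shift:
  fixes x :: real
  shows "measure_pmf.prob (map_pmf (\<lambda>y. y + x) Y) T = measure_pmf.prob Y ((\<lambda>t. t - x) ` T)"
proof -
  have "(\<lambda>y. y + x) -` T = (\<lambda>t. t - x) ` T" by (auto simp: image_iff) (metis add_diff_cancel)
  then show ?thesis by simp
qed

lemma measure_bind_pmf:
  "measure_pmf.prob (bind_pmf M N) A = measure_pmf.expectation M (\<lambda>x. measure_pmf.prob (N x) A)"
proof -
  have "ennreal (measure_pmf.prob (bind_pmf M N) A) = (\<integral>\<^sup>+x. ennreal (measure_pmf.prob (N x) A) \<partial>measure_pmf M)"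
    by (simp add: measure_pmf.emeasure_eq_measure[symmetric] emeasure_bind_pmf)
  also have "\<dots> = ennreal (measure_pmf.expectation M (\<lambda>x. measure_pmf.prob (N x) A))"
    by (intro nn_integral_eq_integral measure_pmf.integrable_const_bound[where B=1]) auto
  finally show ?thesis
    by (subst (asm) ennreal_inj) (auto intro!: integral_nonneg_AE)
qed

lemma prob_add_pmf:
  assumes "finite (set_pmf X)"
  shows "measure_pmf.prob (add_pmf Y X) T
    = (\<Sum>x\<in>set_pmf X. pmf X x * measure_pmf.prob Y ((\<lambda>t. t - x) ` T))"
  unfolding add_pmf_def measure_bind_pmf prob_shift
  using assms by (subst integral_measure_pmf_real[of "set_pmf X"]) (auto simp: mult.commute)

lemma spread_return: "spread q 0 (return_pmf y)"
  by (auto simp: spread_def window_0 indicator_def sgn_if card_gt_0_iff)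

lemma spread_add_any:
  assumes "spread q g Y" "finite (set_pmf X)"
  shows "spread q g (add_pmf Y X)"
  unfolding spread_def
proof (intro allI impI)
  fix T :: "real set" assume T: "finite T"
  have "measure_pmf.prob Y ((\<lambda>t. t - x) ` T) \<le> window q g (int (card T))" for x
  proof -
    have "card ((\<lambda>t. t - x) ` T) = card T" by (rule card_image) (auto simp: inj_on_def)
    then show ?thesis using assms(1) T unfolding spread_def by (metis finite_imageI)
  qed
  then have "measure_pmf.prob (add_pmf Y X) T \<le> (\<Sum>x\<in>set_pmf X. pmf X x * window q g (int (card T)))"
    unfolding prob_add_pmf[OF assms(2)] by (intro sum_mono mult_left_mono) auto
  also have "\<dots> = window q g (int (card T))"
    using assms(2) by (simp add: sum_pmf_eq_1 flip: sum_distrib_right)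
  finally show "measure_pmf.prob (add_pmf Y X) T \<le> window q g (int (card T))" .
qed

text \<open>By \<open>bathtub\<close> the variable \<open>X\<close> may be taken uniform on a \<open>q\<close>-element set, and then \<open>hook_bound\<close> reproduces the
  recursion of \<open>window\<close>.\<close>
lemma spread_add:
  assumes Y: "spread q g Y" and X: "finite (set_pmf X)" "\<And>x. pmf X x \<le> 1 / real q" and "q > 0"
  shows "spread q (Suc g) (add_pmf Y X)"
  unfolding spread_def
proof (intro allI impI)
  fix T :: "real set" assume T: "finite T"
  have im: "measure_pmf.prob Y ((\<lambda>t. t - x) ` T) = (\<Sum>t\<in>T. pmf Y (t - x))" for x
    using T by (subst measure_measure_pmf_finite) (auto simp: sum.reindex inj_on_def)
  obtain A where A: "A \<subseteq> set_pmf X" "card A = q"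
    "(\<Sum>x\<in>set_pmf X. pmf X x * (\<Sum>t\<in>T. pmf Y (t - x))) \<le> (\<Sum>a\<in>A. \<Sum>t\<in>T. pmf Y (t - a)) / real q"
    using bathtub[of "set_pmf X" "pmf X" q "\<lambda>x. \<Sum>t\<in>T. pmf Y (t - x)"] X \<open>q > 0\<close>
    by (auto simp: sum_pmf_eq_1)
  have "finite A" using A X finite_subset by blast
  have bd: "sum (pmf Y) T' \<le> window q g (int (card T'))" if "finite T'" for T'
    using Y that by (metis spread_def measure_measure_pmf_finite)
  have "measure_pmf.prob (add_pmf Y X) T \<le> (\<Sum>a\<in>A. \<Sum>t\<in>T. pmf Y (t - a)) / real q"
    unfolding prob_add_pmf[OF X(1)] im by (rule A)
  also have "\<dots> \<le> (\<Sum>i<card A. window q g (int (card T) + int (card A) - 1 - 2 * int i)) / real q"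
    by (intro divide_right_mono hook_bound) (use window_odd bd \<open>finite A\<close> T in auto)
  also have "\<dots> = window q (Suc g) (int (card T))"
    using A by (simp add: window_Suc)
  finally show "measure_pmf.prob (add_pmf Y X) T \<le> window q (Suc g) (int (card T))" .
qed

section \<open>The extremal distribution\<close>

definition step_pm :: "nat \<Rightarrow> (int \<Rightarrow> real) \<Rightarrow> int \<Rightarrow> real" where
  "step_pm c f k = (f (k + int c) + f (k - int c)) / 2"

text \<open>A uniform variable on the progression of length \<open>2c\<close> is a uniform one on the progression of length \<open>c\<close> plus an
  independent fair sign times \<open>c\<close>. The sign carries the factor \<open>1/\<surd>g\<close>, the rest the factor \<open>1/c\<close>.\<close>
lemma avg_double: "avg (2 * c) f = step_pm c (avg c f)"
proof
  fix k
  have "(\<Sum>i<2 * c. f (k + int (2 * c) - 1 - 2 * int i))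
      = (\<Sum>i<c. f (k + int (2 * c) - 1 - 2 * int i)) + (\<Sum>i=c..<c + c. f (k + int (2 * c) - 1 - 2 * int i))"
    using sum.atLeastLessThan_concat[of 0 c "c + c" "\<lambda>i. f (k + int (2 * c) - 1 - 2 * int i)"]
    unfolding lessThan_atLeast0 mult_2[of c] by linarith
  also have "(\<Sum>i=c..<c + c. f (k + int (2 * c) - 1 - 2 * int i)) = (\<Sum>i<c. f (k - int c + int c - 1 - 2 * int i))"
    using sum.shift_bounds_nat_ivl[of "\<lambda>i. f (k + int (2 * c) - 1 - 2 * int i)" 0 c c]
    by (simp add: lessThan_atLeast0 algebra_simps)
  finally show "avg (2 * c) f k = step_pm c (avg c f) k"
    by (simp add: avg_def step_pm_def algebra_simps add_divide_distrib)
qed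

lemma avg_step_pm: "avg c (step_pm d f) = step_pm d (avg c f)"
  by (rule ext) (simp add: avg_def step_pm_def sum.distrib sum_divide_distrib add_divide_distrib algebra_simps)

lemma avg_step_pm_funpow: "avg c ((step_pm d ^^ g) F) = (step_pm d ^^ g) (avg c F)"
proof (induction g)
  case (Suc g)
  show ?case unfolding funpow.simps(2) o_apply avg_step_pm Suc ..
qed simp

lemma avg_double_funpow: "(avg (2 * c) ^^ g) f = (step_pm c ^^ g) ((avg c ^^ g) f)"
proof (induction g)
  case (Suc g)
  have "(avg (2 * c) ^^ Suc g) f = avg (2 * c) ((avg (2 * c) ^^ g) f)"
    unfolding funpow.simps(2) o_apply ..
  also have "\<dots> = avg (2 * c) ((step_pm c ^^ g) ((avg c ^^ g) f))"
    by (rule arg_cong[OF Suc])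
  also have "\<dots> = step_pm c (avg c ((step_pm c ^^ g) ((avg c ^^ g) f)))"
    by (rule avg_double)
  also have "\<dots> = step_pm c ((step_pm c ^^ g) (avg c ((avg c ^^ g) f)))"
    by (rule arg_cong[OF avg_step_pm_funpow])
  also have "\<dots> = (step_pm c ^^ Suc g) ((avg c ^^ Suc g) f)"
    unfolding funpow.simps(2) o_apply ..
  finally show ?case .
qed simp

lemma step_pm_funpow:
  "(step_pm c ^^ g) f k = (\<Sum>i\<le>g. real (g choose i) / 2 ^ g * f (k + (int g - 2 * int i) * int c))"
proof (induction g arbitrary: k)
  case 0
  then show ?case by simp
next
  case (Suc g)
  define x where "x i = f (k + (int (Suc g) - 2 * int i) * int c)" for i
  have 1: "(step_pm c ^^ g) f (k + int c) = (\<Sum>i\<le>g. real (g choose i) / 2 ^ g * x i)"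
    unfolding Suc by (intro sum.cong refl) (simp add: x_def algebra_simps)
  have 2: "(step_pm c ^^ g) f (k - int c) = (\<Sum>i\<le>g. real (g choose i) / 2 ^ g * x (Suc i))"
    unfolding Suc by (intro sum.cong refl) (simp add: x_def algebra_simps)
  have 3: "(\<Sum>i\<le>g. real (g choose i) / 2 ^ g * x i)
      = x 0 / 2 ^ g + (\<Sum>i\<le>g. real (g choose Suc i) / 2 ^ g * x (Suc i))"
  proof -
    have "(\<Sum>i\<le>g. real (g choose i) / 2 ^ g * x i) = (\<Sum>i\<le>Suc g. real (g choose i) / 2 ^ g * x i)"
      by simp
    also have "\<dots> = x 0 / 2 ^ g + (\<Sum>i\<le>g. real (g choose Suc i) / 2 ^ g * x (Suc i))"
      by (subst sum.atMost_Suc_shift) simp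
    finally show ?thesis .
  qed
  have half: "real (A + B) / 2 ^ Suc g * y = (real A / 2 ^ g * y + real B / 2 ^ g * y) / 2" for A B y
    by (simp add: field_simps)
  have "(\<Sum>i\<le>Suc g. real (Suc g choose i) / 2 ^ Suc g * x i)
      = x 0 / 2 ^ Suc g + (\<Sum>i\<le>g. real ((g choose i) + (g choose Suc i)) / 2 ^ Suc g * x (Suc i))"
    by (subst sum.atMost_Suc_shift) simp
  also have "\<dots> = x 0 / 2 ^ Suc g + (\<Sum>i\<le>g. (real (g choose i) / 2 ^ g * x (Suc i) + real (g choose Suc i) / 2 ^ g * x (Suc i)) / 2)"
    by (simp only: half)
  also have "\<dots> = (x 0 / 2 ^ g + (\<Sum>i\<le>g. real (g choose Suc i) / 2 ^ g * x (Suc i))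
      + (\<Sum>i\<le>g. real (g choose i) / 2 ^ g * x (Suc i))) / 2"
    by (simp add: sum.distrib add_divide_distrib flip: sum_divide_distrib)
  also have "\<dots> = (step_pm c ^^ Suc g) f k"
    by (simp only: funpow.simps(2) o_apply step_pm_def[of c "(step_pm c ^^ g) f"] 1 2 3)
  finally show ?case by (simp only: x_def)
qed

text \<open>The discrete derivative of the sign; it turns \<open>window q g 1\<close> into a point probability.\<close>
definition jump :: "int \<Rightarrow> real" where
  "jump k = real_of_int (sgn (k + 1)) - real_of_int (sgn (k - 1))"

lemma jump_eq: "jump k = (if k = 0 then 2 else if k \<in> {1, -1} then 1 else 0)"
  by (auto simp: jump_def sgn_if)

lemma avg_funpow_diff:
  "(avg q ^^ g) (\<lambda>k. f (k + 1) - f (k - 1)) k = (avg q ^^ g) f (k + 1) - (avg q ^^ g) f (k - 1)"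
proof (induction g arbitrary: k)
  case (Suc g)
  have eq: "(avg q ^^ Suc g) F k = (\<Sum>i<q. (avg q ^^ g) F (k + int q - 1 - 2 * int i)) / real q" for F k
    by (simp add: avg_def[of q "(avg q ^^ g) F"])
  show ?case unfolding eq Suc
    by (simp add: sum_subtractf diff_divide_distrib algebra_simps)
qed simp

lemma window_one: "window q g 1 = (avg q ^^ g) jump 0 / 2"
proof -
  have "(avg q ^^ g) jump 0 = window q g 1 - window q g (-1)"
    using avg_funpow_diff[of g q "\<lambda>k. real_of_int (sgn k)" 0]
    by (simp add: window_def jump_def[abs_def])
  then show ?thesis by (simp add: window_odd)
qed

text \<open>The progression of length \<open>c\<close> meets every residue class modulo \<open>2c\<close> at most once, so that after one averaging
  step no residue class carries mass more than \<open>4/c\<close>, the total mass of \<open>jump\<close> being \<open>4\<close>.\<close>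
lemma avg_jump_lattice:
  assumes "c > 0" "finite I"
  shows "(\<Sum>j\<in>I. avg c jump (k + 2 * int c * j)) \<le> 4 / real c"
proof -
  define e where "e = (\<lambda>(j, i). k + 2 * int c * j + int c - 1 - 2 * int i)"
  have inj: "inj_on e (I \<times> {..<c})"
  proof (rule inj_onI)
    fix x y assume x: "x \<in> I \<times> {..<c}" and y: "y \<in> I \<times> {..<c}" and "e x = e y"
    obtain j i where ji: "x = (j, i)" by (cases x)
    obtain j' i' where ji': "y = (j', i')" by (cases y)
    have "i \<in> {..<c}" "i' \<in> {..<c}" "e (j, i) = e (j', i')" using x y \<open>e x = e y\<close> ji ji' by auto
    then have i: "i < c" "i' < c" and eq: "int c * j - int i = int c * j' - int i'"
      by (auto simp: e_def)
    have "int i mod int c = int i' mod int c"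
    proof -
      have "int i = int i' + int c * (j - j')" using eq by (simp add: algebra_simps)
      then show ?thesis by simp
    qed
    then have "i = i'" using i by simp
    then show "x = y" using eq assms ji ji' by simp
  qed
  have fin: "finite (e ` (I \<times> {..<c}))" using assms by auto
  have "(\<Sum>j\<in>I. avg c jump (k + 2 * int c * j)) = (\<Sum>z\<in>e ` (I \<times> {..<c}). jump z) / real c"
    using inj by (simp add: avg_def sum.reindex sum.cartesian_product e_def case_prod_unfold flip: sum_divide_distrib)
  also have "(\<Sum>z\<in>e ` (I \<times> {..<c}). jump z) = (\<Sum>z\<in>e ` (I \<times> {..<c}) \<inter> {-1, 0, 1}. jump z)"
    using fin by (intro sum.mono_neutral_right) (auto simp: jump_eq)
  also have "\<dots> \<le> (\<Sum>z\<in>{-1, 0, 1}. jump z)"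
    by (intro sum_mono2) (auto simp: jump_eq)
  also have "\<dots> = 4" by (simp add: jump_eq)
  finally show ?thesis using assms by (simp add: divide_right_mono)
qed

lemma avg_lattice:
  assumes "c > 0" "\<And>k I. finite I \<Longrightarrow> (\<Sum>j\<in>I. f (k + 2 * int c * j)) \<le> m" "finite I"
  shows "(\<Sum>j\<in>I. avg c f (k + 2 * int c * j)) \<le> m"
proof -
  have "(\<Sum>j\<in>I. avg c f (k + 2 * int c * j))
      = (\<Sum>i<c. \<Sum>j\<in>I. f ((k + int c - 1 - 2 * int i) + 2 * int c * j)) / real c"
    unfolding avg_def sum_divide_distrib[symmetric]
    by (subst sum.swap) (simp add: algebra_simps)
  also have "\<dots> \<le> (\<Sum>i<c. m) / real c"
    using assms by (intro divide_right_mono sum_mono) auto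
  finally show ?thesis using assms by simp
qed

lemma avg_jump_nonneg: "(avg q ^^ h) jump k \<ge> 0"
  by (induction h arbitrary: k) (auto simp: jump_eq avg_def intro!: divide_nonneg_nonneg sum_nonneg)

lemma window_one_nonneg: "window q g 1 \<ge> 0"
  by (simp add: window_one avg_jump_nonneg)

text \<open>The sum of the \<open>g\<close> signs spreads over points of distance \<open>2c\<close>, each with weight at most \<open>\<beta>\<close>; by
  \<open>avg_jump_lattice\<close> the other summand puts mass at most \<open>4/c\<close> on the corresponding residue class.\<close>
lemma window_even_bound:
  assumes "c > 0" "g > 0" and beta: "\<And>i. real (g choose i) / 2 ^ g \<le> \<beta>"
  shows "window (2 * c) g 1 \<le> 2 * \<beta> / real c"
proof -
  have lat: "(\<Sum>j\<in>I. (avg c ^^ Suc h) jump (k + 2 * int c * j)) \<le> 4 / real c" if "finite I" for I h k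
    using that
  proof (induction h arbitrary: I k)
    case 0
    then show ?case using avg_jump_lattice assms by simp
  next
    case (Suc h)
    show ?case
      using avg_lattice[OF assms(1) Suc.IH Suc.prems] by simp
  qed
  have b0: "\<beta> \<ge> 0" using beta[of 0] by (smt (verit) divide_nonneg_nonneg of_nat_0_le_iff zero_le_power)
  let ?F = "(avg c ^^ g) jump"
  have "(avg (2 * c) ^^ g) jump 0 = (\<Sum>i\<le>g. real (g choose i) / 2 ^ g * ?F (0 + (int g - 2 * int i) * int c))"
    by (simp only: avg_double_funpow step_pm_funpow)
  also have "\<dots> \<le> (\<Sum>i\<le>g. \<beta> * ?F (0 + (int g - 2 * int i) * int c))"
    using beta avg_jump_nonneg by (intro sum_mono mult_right_mono) auto
  also have "\<dots> = \<beta> * (\<Sum>j\<in>(\<lambda>i. - int i) ` {..g}. ?F (int g * int c + 2 * int c * j))"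
    by (subst sum.reindex) (auto simp: inj_on_def sum_distrib_left algebra_simps)
  also have "\<dots> \<le> \<beta> * (4 / real c)"
    using lat[of "(\<lambda>i. - int i) ` {..g}" "g - 1" "int g * int c"] assms b0
    by (intro mult_left_mono) auto
  finally show ?thesis by (simp add: window_one mult.commute)
qed

lemma central_binomial_le: "real (2 * a choose a) / 4 ^ a \<le> 1 / sqrt (2 * real a + 1)"
proof (induction a)
  case 0
  then show ?case by simp
next
  case (Suc a)
  have N: "Suc a * (2 * Suc a choose Suc a) = 2 * (2 * a + 1) * (2 * a choose a)"
  proof -
    have e1: "Suc a * (2 * Suc a choose Suc a) = (2 * Suc a) * (Suc (2 * a) choose a)"
      using Suc_times_binomial[of a "Suc (2 * a)"] by simp
    have "Suc (2 * a) choose Suc a = Suc (2 * a) choose a"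
      using binomial_symmetric[of a "Suc (2 * a)"] by simp
    then have e2: "Suc a * (Suc (2 * a) choose a) = Suc (2 * a) * (2 * a choose a)"
      using Suc_times_binomial[of a "2 * a"] by (simp only:)
    show ?thesis unfolding e1 mult.assoc[of 2 "Suc a"] e2
      by (simp only: mult.assoc Suc_eq_plus1)
  qed
  have ratio: "P / (4 * D) = B / (2 * A) * (Q / D)" if "A * P = 2 * B * Q" "A > 0" "D > 0" for A B P Q D :: real
    using that by (simp add: field_simps)
  have "real (Suc a * (2 * Suc a choose Suc a)) = real (2 * (2 * a + 1) * (2 * a choose a))"
    by (simp only: N)
  then have R: "(real a + 1) * real (2 * Suc a choose Suc a) = 2 * (2 * real a + 1) * real (2 * a choose a)"
    unfolding of_nat_mult of_nat_add of_nat_Suc by (simp only: of_nat_numeral of_nat_1 add.commute[of 1])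
  have "real (2 * Suc a choose Suc a) / 4 ^ Suc a
      = (2 * real a + 1) / (2 * (real a + 1)) * (real (2 * a choose a) / 4 ^ a)"
    unfolding power_Suc by (rule ratio[OF R]) auto
  also have "\<dots> \<le> (2 * real a + 1) / (2 * (real a + 1)) * (1 / sqrt (2 * real a + 1))"
    using Suc by (intro mult_left_mono) auto
  also have "\<dots> = sqrt (2 * real a + 1) / (2 * (real a + 1))"
    by (simp add: real_div_sqrt field_simps)
  also have "\<dots> \<le> 1 / sqrt (2 * real (Suc a) + 1)"
  proof -
    have "sqrt (2 * real a + 1) * sqrt (2 * real a + 3) = sqrt ((2 * real a + 1) * (2 * real a + 3))"
      by (simp add: real_sqrt_mult)
    also have "\<dots> \<le> sqrt ((2 * (real a + 1)) ^ 2)"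
      by (intro real_sqrt_le_mono) (simp add: power2_eq_square algebra_simps)
    also have "\<dots> = 2 * (real a + 1)" by (subst real_sqrt_abs) simp
    finally show ?thesis by (simp add: field_simps)
  qed
  finally show ?case .
qed

lemma window_bound:
  assumes "c > 0" "a > 0"
  shows "window (2 * c) (2 * a) 1 \<le> 2 / (real c * sqrt (2 * real a + 1))"
proof -
  have "real (2 * a choose i) / 2 ^ (2 * a) \<le> 1 / sqrt (2 * real a + 1)" for i
  proof -
    have "real (2 * a choose i) \<le> real (2 * a choose a)"
      using binomial_maximum[of "2 * a" i] by simp
    then have "real (2 * a choose i) / 2 ^ (2 * a) \<le> real (2 * a choose a) / 4 ^ a"
      by (simp add: power_mult divide_right_mono)
    then show ?thesis using central_binomial_le[of a] by linarith
  qed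
  then show ?thesis using window_even_bound[of c "2 * a" "1 / sqrt (2 * real a + 1)"] assms by (simp add: mult.commute)
qed

section \<open>Random subsets and random cells\<close>

definition subset_pmf :: "'a set \<Rightarrow> nat \<Rightarrow> 'a set pmf" where
  "subset_pmf S w = pmf_of_set {X. X \<subseteq> S \<and> card X = w}"

lemma subsets_finite_nonempty:
  assumes "finite S" "w \<le> card S"
  shows "finite {X. X \<subseteq> S \<and> card X = w}" "{X. X \<subseteq> S \<and> card X = w} \<noteq> {}"
proof -
  show "finite {X. X \<subseteq> S \<and> card X = w}" using assms by simp
  obtain X where "X \<subseteq> S" "card X = w" using assms obtain_subset_with_card_n by metis
  then show "{X. X \<subseteq> S \<and> card X = w} \<noteq> {}" by auto
qed

lemma set_subset_pmf:
  assumes "finite S" "w \<le> card S"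
  shows "set_pmf (subset_pmf S w) = {X. X \<subseteq> S \<and> card X = w}"
  unfolding subset_pmf_def by (rule set_pmf_of_set) (use subsets_finite_nonempty[OF assms] in auto)

lemma pmf_subset_pmf:
  assumes "finite S" "w \<le> card S"
  shows "pmf (subset_pmf S w) X = (if X \<subseteq> S \<and> card X = w then 1 / real (card S choose w) else 0)"
  unfolding subset_pmf_def
  by (subst pmf_of_set) (use subsets_finite_nonempty[OF assms] n_subsets[OF assms(1)] in auto)

text \<open>Uniformity is proved below by checking that all probabilities agree; their common value follows by itself.\<close>
lemma eq_pmf_of_setI:
  assumes "finite A" "A \<noteq> {}" "set_pmf p \<subseteq> A" "\<And>x. x \<in> A \<Longrightarrow> pmf p x = c"
  shows "p = pmf_of_set A"
proof (rule pmf_eqI)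
  fix x
  have "real (card A) * c = 1" using sum_pmf_eq_1[OF assms(1,3)] assms(4) by simp
  then have c: "c = 1 / real (card A)" using assms(1,2) by (simp add: field_simps)
  show "pmf p x = pmf (pmf_of_set A) x"
  proof (cases "x \<in> A")
    case True
    then show ?thesis using assms c by simp
  next
    case False
    then have "pmf p x = 0" using assms(3) by (meson pmf_eq_0_set_pmf subsetD)
    then show ?thesis using assms False by simp
  qed
qed

lemma card_subsets_meeting_once:
  assumes "finite S" "X \<subseteq> S" "i \<in> X" "L > 0"
  shows "card {R. R \<subseteq> S \<and> card R = L \<and> i \<in> R \<and> X - {i} \<subseteq> S - R} = (card S - card X) choose (L - 1)"
proof -
  have fX: "finite X" using assms finite_subset by auto
  have "bij_betw (\<lambda>R. R - {i}) {R. R \<subseteq> S \<and> card R = L \<and> i \<in> R \<and> X - {i} \<subseteq> S - R}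
      {R. R \<subseteq> S - X \<and> card R = L - 1}"
  proof (rule bij_betw_byWitness[where f' = "insert i"])
    show "\<forall>R\<in>{R. R \<subseteq> S \<and> card R = L \<and> i \<in> R \<and> X - {i} \<subseteq> S - R}. insert i (R - {i}) = R" by auto
    show "\<forall>R\<in>{R. R \<subseteq> S - X \<and> card R = L - 1}. insert i R - {i} = R" using assms by auto
    show "(\<lambda>R. R - {i}) ` {R. R \<subseteq> S \<and> card R = L \<and> i \<in> R \<and> X - {i} \<subseteq> S - R}
        \<subseteq> {R. R \<subseteq> S - X \<and> card R = L - 1}"
      using assms by auto
    show "insert i ` {R. R \<subseteq> S - X \<and> card R = L - 1}
        \<subseteq> {R. R \<subseteq> S \<and> card R = L \<and> i \<in> R \<and> X - {i} \<subseteq> S - R}"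
    proof (rule image_subsetI)
      fix R assume "R \<in> {R. R \<subseteq> S - X \<and> card R = L - 1}"
      then have R: "R \<subseteq> S - X" "card R = L - 1" by auto
      then have "finite R" "i \<notin> R" using assms finite_subset by (blast, auto)
      then have "card (insert i R) = L" using R assms by simp
      then show "insert i R \<in> {R. R \<subseteq> S \<and> card R = L \<and> i \<in> R \<and> X - {i} \<subseteq> S - R}"
        using R assms by auto
    qed
  qed
  then have "card {R. R \<subseteq> S \<and> card R = L \<and> i \<in> R \<and> X - {i} \<subseteq> S - R} = card {R. R \<subseteq> S - X \<and> card R = L - 1}"
    by (rule bij_betw_same_card)
  also have "\<dots> = card (S - X) choose (L - 1)" using assms by (simp add: n_subsets)
  also have "card (S - X) = card S - card X" using assms fX by (simp add: card_Diff_subset)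
  finally show ?thesis .
qed

text \<open>A random \<open>w\<close>-subset can be drawn by choosing a random cell \<open>R\<close> of \<open>L\<close> points, one uniform point \<open>i\<close> of \<open>R\<close>, and the
  remaining \<open>w - 1\<close> points outside \<open>R\<close>. By symmetry every \<open>w\<close>-subset arises equally often. The choice of
  \<open>i\<close> is the source of independent randomness in the small ball estimates.\<close>
lemma subset_pmf_cell:
  assumes "finite S" "L > 0" "w > 0" "L + w \<le> card S + 1"
  shows "subset_pmf S w = bind_pmf (subset_pmf S L) (\<lambda>R. bind_pmf (pmf_of_set R)
    (\<lambda>i. map_pmf (insert i) (subset_pmf (S - R) (w - 1))))" (is "_ = ?N")
proof -
  let ?A = "{X. X \<subseteq> S \<and> card X = w}" and ?B = "{R. R \<subseteq> S \<and> card R = L}"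
  have w: "w \<le> card S" "L \<le> card S" using assms by auto
  have sz: "finite (S - R)" "w - 1 \<le> card (S - R)" "finite R" "R \<noteq> {}" "card (S - R) = card S - L"
    if "R \<in> ?B" for R
  proof -
    show f: "finite R" using that assms finite_subset by auto
    show "card (S - R) = card S - L" using that f by (simp add: card_Diff_subset)
    then show "w - 1 \<le> card (S - R)" using assms by auto
    show "finite (S - R)" using assms by auto
    show "R \<noteq> {}" using that assms by auto
  qed
  have inner: "pmf (map_pmf (insert i) (subset_pmf (S - R) (w - 1))) X
      = (if i \<in> X \<and> X - {i} \<subseteq> S - R then 1 / real ((card S - L) choose (w - 1)) else 0)"
    if R: "R \<in> ?B" and i: "i \<in> R" and X: "X \<in> ?A" for R i X
  proof -
    note s = sz[OF R]
    have fX: "finite X" using X assms finite_subset by auto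
    have "pmf (map_pmf (insert i) (subset_pmf (S - R) (w - 1))) X
        = measure_pmf.prob (subset_pmf (S - R) (w - 1)) (insert i -` {X})"
      by (simp add: pmf_map)
    also have "\<dots> = measure_pmf.prob (subset_pmf (S - R) (w - 1))
        (insert i -` {X} \<inter> {X. X \<subseteq> S - R \<and> card X = w - 1})"
      using set_subset_pmf[OF s(1,2)] by (metis measure_Int_set_pmf)
    also have "insert i -` {X} \<inter> {X. X \<subseteq> S - R \<and> card X = w - 1}
        = (if i \<in> X \<and> X - {i} \<subseteq> S - R then {X - {i}} else {})"
      using i X fX by (auto simp: insert_absorb)
    finally have eq: "pmf (map_pmf (insert i) (subset_pmf (S - R) (w - 1))) X
      = measure_pmf.prob (subset_pmf (S - R) (w - 1)) (if i \<in> X \<and> X - {i} \<subseteq> S - R then {X - {i}} else {})" .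
    have "card (X - {i}) = w - 1" if "i \<in> X" using that X fX by simp
    then show ?thesis unfolding eq
      by (simp add: measure_pmf_single pmf_subset_pmf[OF s(1,2)] s(5) del: One_nat_def)
  qed
  have "?N = pmf_of_set ?A"
  proof (rule eq_pmf_of_setI)
    show "finite ?A" "?A \<noteq> {}" using subsets_finite_nonempty[OF assms(1) w(1)] by auto
    show "set_pmf ?N \<subseteq> ?A"
    proof
      fix X assume "X \<in> set_pmf ?N"
      then obtain R where "R \<in> set_pmf (subset_pmf S L)"
        and XR: "X \<in> set_pmf (bind_pmf (pmf_of_set R) (\<lambda>i. map_pmf (insert i) (subset_pmf (S - R) (w - 1))))"
        unfolding set_bind_pmf by blast
      then have R: "R \<in> ?B" using set_subset_pmf[OF assms(1) w(2)] by blast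
      note s = sz[OF R]
      obtain i where "i \<in> set_pmf (pmf_of_set R)" and Xi: "X \<in> set_pmf (map_pmf (insert i) (subset_pmf (S - R) (w - 1)))"
        using XR unfolding set_bind_pmf by blast
      then have i: "i \<in> R" using s by simp
      obtain X' where X': "X' \<subseteq> S - R" "card X' = w - 1" "X = insert i X'"
        using Xi unfolding set_map_pmf set_subset_pmf[OF s(1,2)] by blast
      have fX': "finite X'" using X'(1) s(1) finite_subset by blast
      have "i \<notin> X'" using X'(1) i by blast
      then have "card X = w" using fX' X' assms(3) by simp
      moreover have "X \<subseteq> S" using X' i R by blast
      ultimately show "X \<in> ?A" by blast
    qed
    fix X assume X: "X \<in> ?A"
    have fX: "finite X" using X assms finite_subset by auto
    define d where "d = 1 / real ((card S - L) choose (w - 1))"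
    have "pmf ?N X = (\<Sum>R\<in>?B. pmf (bind_pmf (pmf_of_set R) (\<lambda>i. map_pmf (insert i) (subset_pmf (S - R) (w - 1)))) X) / real (card ?B)"
      unfolding subset_pmf_def[of S L]
      using subsets_finite_nonempty[OF assms(1) w(2)] by (subst pmf_bind_pmf_of_set) auto
    also have "\<dots> = (\<Sum>R\<in>?B. (\<Sum>i\<in>R. if i \<in> X \<and> X - {i} \<subseteq> S - R then d else 0) / real L) / real (card ?B)"
    proof (intro arg_cong2[where f="(/)"] sum.cong refl)
      fix R assume R: "R \<in> ?B"
      have "pmf (bind_pmf (pmf_of_set R) (\<lambda>i. map_pmf (insert i) (subset_pmf (S - R) (w - 1)))) X
          = (\<Sum>i\<in>R. pmf (map_pmf (insert i) (subset_pmf (S - R) (w - 1))) X) / real (card R)"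
        using sz[OF R] by (subst pmf_bind_pmf_of_set) auto
      also have "\<dots> = (\<Sum>i\<in>R. if i \<in> X \<and> X - {i} \<subseteq> S - R then d else 0) / real L"
      proof (intro arg_cong2[where f="(/)"] sum.cong refl)
        show "pmf (map_pmf (insert i) (subset_pmf (S - R) (w - 1))) X = (if i \<in> X \<and> X - {i} \<subseteq> S - R then d else 0)"
          if "i \<in> R" for i
          using inner[OF R that X] by (simp only: d_def)
        show "real (card R) = real L" using R by simp
      qed
      finally show "pmf (bind_pmf (pmf_of_set R) (\<lambda>i. map_pmf (insert i) (subset_pmf (S - R) (w - 1)))) X
          = (\<Sum>i\<in>R. if i \<in> X \<and> X - {i} \<subseteq> S - R then d else 0) / real L" .
    qed
    also have "\<dots> = (\<Sum>R\<in>?B. \<Sum>i\<in>R. if i \<in> X \<and> X - {i} \<subseteq> S - R then d else 0) / (real L * real (card ?B))"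
      by (simp flip: sum_divide_distrib)
    also have "(\<Sum>R\<in>?B. \<Sum>i\<in>R. if i \<in> X \<and> X - {i} \<subseteq> S - R then d else 0)
        = (\<Sum>R\<in>?B. \<Sum>i\<in>X. if i \<in> R \<and> X - {i} \<subseteq> S - R then d else 0)"
    proof (rule sum.cong[OF refl])
      fix R assume R: "R \<in> ?B"
      have "(\<Sum>i\<in>R. if i \<in> X \<and> X - {i} \<subseteq> S - R then d else 0)
          = (\<Sum>i | i \<in> R \<and> (i \<in> X \<and> X - {i} \<subseteq> S - R). d)"
        by (rule sum.inter_filter[symmetric, OF sz(3)[OF R]])
      also have "\<dots> = (\<Sum>i | i \<in> X \<and> (i \<in> R \<and> X - {i} \<subseteq> S - R). d)"
        by (rule arg_cong[where f="sum (\<lambda>_. d)"]) blast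
      also have "\<dots> = (\<Sum>i\<in>X. if i \<in> R \<and> X - {i} \<subseteq> S - R then d else 0)"
        by (rule sum.inter_filter[OF fX])
      finally show "(\<Sum>i\<in>R. if i \<in> X \<and> X - {i} \<subseteq> S - R then d else 0)
        = (\<Sum>i\<in>X. if i \<in> R \<and> X - {i} \<subseteq> S - R then d else 0)" .
    qed
    also have "\<dots> = (\<Sum>i\<in>X. \<Sum>R\<in>?B. if i \<in> R \<and> X - {i} \<subseteq> S - R then d else 0)"
      by (rule sum.swap)
    also have "\<dots> = (\<Sum>i\<in>X. real ((card S - w) choose (L - 1)) * d)"
    proof (rule sum.cong[OF refl])
      fix i assume i: "i \<in> X"
      have "(\<Sum>R\<in>?B. if i \<in> R \<and> X - {i} \<subseteq> S - R then d else 0)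
          = (\<Sum>R | R \<in> ?B \<and> (i \<in> R \<and> X - {i} \<subseteq> S - R). d)"
        by (rule sum.inter_filter[symmetric, OF subsets_finite_nonempty(1)[OF assms(1) w(2)]])
      also have "\<dots> = real (card {R. R \<subseteq> S \<and> card R = L \<and> i \<in> R \<and> X - {i} \<subseteq> S - R}) * d"
        by simp
      also have "\<dots> = real ((card S - w) choose (L - 1)) * d"
        using card_subsets_meeting_once[OF assms(1) _ i assms(2)] X by simp
      finally show "(\<Sum>R\<in>?B. if i \<in> R \<and> X - {i} \<subseteq> S - R then d else 0)
          = real ((card S - w) choose (L - 1)) * d" .
    qed
    also have "\<dots> = real w * (real ((card S - w) choose (L - 1)) * d)" using X by simp
    finally show "pmf ?N X = real w * (real ((card S - w) choose (L - 1)) * d) / (real L * real (card ?B))" .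
  qed
  then show ?thesis by (simp add: subset_pmf_def)
qed

primrec cells :: "nat \<Rightarrow> nat \<Rightarrow> nat set \<Rightarrow> nat set list pmf" where
  "cells L 0 S = return_pmf []"
| "cells L (Suc h) S = bind_pmf (subset_pmf S L) (\<lambda>R. map_pmf ((#) R) (cells L h (S - R)))"

text \<open>The sum of the values of \<open>u\<close> at independent uniform points, one in each cell.\<close>
primrec pick :: "(nat \<Rightarrow> real) \<Rightarrow> nat set list \<Rightarrow> real pmf" where
  "pick u [] = return_pmf 0"
| "pick u (R # Rs) = bind_pmf (pmf_of_set R) (\<lambda>i. map_pmf (\<lambda>y. u i + y) (pick u Rs))"

definition slice :: "(nat \<Rightarrow> real) \<Rightarrow> nat set \<Rightarrow> nat \<Rightarrow> real pmf" where
  "slice u S w = map_pmf (sum u) (subset_pmf S w)"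

lemma cells_support:
  assumes "finite S" "h * L \<le> card S" "Rs \<in> set_pmf (cells L h S)"
  shows "length Rs = h" "\<Union> (set Rs) \<subseteq> S" "card (\<Union> (set Rs)) = h * L" "\<forall>R\<in>set Rs. card R = L"
proof -
  have "length Rs = h \<and> \<Union> (set Rs) \<subseteq> S \<and> card (\<Union> (set Rs)) = h * L \<and> (\<forall>R\<in>set Rs. card R = L)"
    using assms
  proof (induction h arbitrary: S Rs)
    case 0
    then show ?case by simp
  next
    case (Suc h)
    have L: "L \<le> card S" using Suc.prems(2) by simp
    obtain R where "R \<in> set_pmf (subset_pmf S L)" "Rs \<in> (#) R ` set_pmf (cells L h (S - R))"
      using Suc.prems(3) unfolding cells.simps set_bind_pmf set_map_pmf by blast
    then obtain Rs' where R: "R \<subseteq> S" "card R = L" and Rs': "Rs' \<in> set_pmf (cells L h (S - R))" "Rs = R # Rs'"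
      unfolding set_subset_pmf[OF Suc.prems(1) L] by blast
    have fR: "finite R" using R Suc.prems finite_subset by blast
    have "card (S - R) = card S - L" using R fR by (simp add: card_Diff_subset)
    then have hL: "h * L \<le> card (S - R)" using Suc.prems(2) by simp
    have "length Rs' = h \<and> \<Union> (set Rs') \<subseteq> S - R \<and> card (\<Union> (set Rs')) = h * L \<and> (\<forall>R\<in>set Rs'. card R = L)"
      by (rule Suc.IH[OF _ hL Rs'(1)]) (use Suc.prems(1) in simp)
    then have IH: "length Rs' = h" "\<Union> (set Rs') \<subseteq> S - R" "card (\<Union> (set Rs')) = h * L" "\<forall>R\<in>set Rs'. card R = L"
      by blast+
    have "finite (\<Union> (set Rs'))" using IH(2) Suc.prems(1) finite_subset[of "\<Union> (set Rs')" S] by blast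
    then have "card (R \<union> \<Union> (set Rs')) = L + h * L"
      using IH(2,3) R(2) fR by (subst card_Un_disjoint) auto
    then show ?case using IH R unfolding Rs'(2) by auto
  qed
  then show "length Rs = h" "\<Union> (set Rs) \<subseteq> S" "card (\<Union> (set Rs)) = h * L" "\<forall>R\<in>set Rs. card R = L" by auto
qed

lemma finite_set_pick:
  assumes "\<forall>R\<in>set Rs. card R > 0"
  shows "finite (set_pmf (pick u Rs))"
  using assms by (induction Rs) (auto simp: card_gt_0_iff)

lemma finite_set_slice: "finite S \<Longrightarrow> w \<le> card S \<Longrightarrow> finite (set_pmf (slice u S w))"
  by (simp add: slice_def set_subset_pmf)

lemma finite_set_cells:
  assumes "finite S" "h * L \<le> card S"
  shows "finite (set_pmf (cells L h S))"
  using assms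
proof (induction h arbitrary: S)
  case (Suc h)
  have "finite (set_pmf (cells L h (S - R)))" if "R \<subseteq> S" "card R = L" for R
  proof -
    have "finite R" using that Suc.prems finite_subset by blast
    then have "card (S - R) = card S - L" using that by (simp add: card_Diff_subset)
    then show ?thesis using Suc by auto
  qed
  then show ?case using Suc.prems by (auto simp: set_subset_pmf)
qed simp

lemma slice_cell:
  assumes "finite S" "L > 0" "w > 0" "L + w \<le> card S + 1"
  shows "slice u S w = bind_pmf (subset_pmf S L) (\<lambda>R. bind_pmf (pmf_of_set R)
    (\<lambda>i. map_pmf (\<lambda>z. u i + z) (slice u (S - R) (w - 1))))"
proof -
  have "slice u S w = bind_pmf (subset_pmf S L) (\<lambda>R. bind_pmf (pmf_of_set R)
    (\<lambda>i. map_pmf (sum u) (map_pmf (insert i) (subset_pmf (S - R) (w - 1)))))"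
    unfolding slice_def by (subst subset_pmf_cell[OF assms]) (simp only: map_bind_pmf)
  also have "\<dots> = bind_pmf (subset_pmf S L) (\<lambda>R. bind_pmf (pmf_of_set R)
    (\<lambda>i. map_pmf (\<lambda>z. u i + z) (slice u (S - R) (w - 1))))"
  proof (intro bind_pmf_cong refl)
    fix R i assume R: "R \<in> set_pmf (subset_pmf S L)" and i: "i \<in> set_pmf (pmf_of_set R)"
    have RS: "R \<subseteq> S" "card R = L" using R assms by (auto simp: set_subset_pmf)
    then have fR: "finite R" "R \<noteq> {}" using assms finite_subset by (blast, auto)
    then have iR: "i \<in> R" using i by simp
    have "w - 1 \<le> card (S - R)" using RS fR assms by (simp add: card_Diff_subset)
    then have "map_pmf (\<lambda>X. sum u (insert i X)) (subset_pmf (S - R) (w - 1))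
        = map_pmf (\<lambda>X. u i + sum u X) (subset_pmf (S - R) (w - 1))"
    proof (intro map_pmf_cong refl)
      fix X assume "X \<in> set_pmf (subset_pmf (S - R) (w - 1))"
      then have "X \<subseteq> S - R" using \<open>w - 1 \<le> card (S - R)\<close> assms by (simp add: set_subset_pmf)
      then have "finite X" "i \<notin> X" using assms iR finite_subset by (blast, auto)
      then show "sum u (insert i X) = u i + sum u X" by simp
    qed
    then show "map_pmf (sum u) (map_pmf (insert i) (subset_pmf (S - R) (w - 1)))
        = map_pmf (\<lambda>z. u i + z) (slice u (S - R) (w - 1))"
      by (simp add: pmf.map_comp o_def slice_def)
  qed
  finally show ?thesis .
qed

lemma slice_cells:
  assumes "finite S" "L > 0" "h \<le> w" "h * L + (w - h) \<le> card S"
  shows "slice u S w = bind_pmf (cells L h S) (\<lambda>Rs. bind_pmf (pick u Rs)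
    (\<lambda>x. map_pmf (\<lambda>z. x + z) (slice u (S - \<Union> (set Rs)) (w - h))))"
  using assms(1,3,4)
proof (induction h arbitrary: S w)
  case 0
  then show ?case by (simp add: bind_return_pmf map_pmf_def bind_return_pmf')
next
  case (Suc h)
  have "L + w \<le> card S + 1"
  proof -
    have "h \<le> h * L" using assms(2) by simp
    moreover have "Suc h * L = L + h * L" by simp
    ultimately show ?thesis using Suc.prems(2,3) by linarith
  qed
  then have "slice u S w = bind_pmf (subset_pmf S L) (\<lambda>R. bind_pmf (pmf_of_set R)
    (\<lambda>i. map_pmf (\<lambda>z. u i + z) (slice u (S - R) (w - 1))))"
    using Suc.prems assms(2) by (intro slice_cell) auto
  also have "\<dots> = bind_pmf (subset_pmf S L) (\<lambda>R. bind_pmf (cells L h (S - R)) (\<lambda>Rs.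
      bind_pmf (pick u (R # Rs)) (\<lambda>x. map_pmf (\<lambda>z. x + z) (slice u (S - \<Union> (set (R # Rs))) (w - Suc h)))))"
  proof (intro bind_pmf_cong refl)
    fix R assume R: "R \<in> set_pmf (subset_pmf S L)"
    have "L \<le> card S" using Suc.prems by simp
    then have RS: "R \<subseteq> S" "card R = L" using R Suc.prems by (auto simp: set_subset_pmf)
    then have fR: "finite R" using Suc.prems finite_subset by blast
    have "card (S - R) = card S - L" using RS fR by (simp add: card_Diff_subset)
    then have IH: "slice u (S - R) (w - 1) = bind_pmf (cells L h (S - R)) (\<lambda>Rs. bind_pmf (pick u Rs)
      (\<lambda>x. map_pmf (\<lambda>z. x + z) (slice u (S - R - \<Union> (set Rs)) (w - 1 - h))))"
      using Suc.prems by (intro Suc.IH) auto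
    show "bind_pmf (pmf_of_set R) (\<lambda>i. map_pmf (\<lambda>z. u i + z) (slice u (S - R) (w - 1)))
      = bind_pmf (cells L h (S - R)) (\<lambda>Rs.
      bind_pmf (pick u (R # Rs)) (\<lambda>x. map_pmf (\<lambda>z. x + z) (slice u (S - \<Union> (set (R # Rs))) (w - Suc h))))"
      unfolding IH map_bind_pmf
      by (subst bind_commute_pmf)
        (simp add: bind_assoc_pmf bind_map_pmf pmf.map_comp o_def Diff_eq Int_assoc flip: add.assoc)
  qed
  also have "\<dots> = bind_pmf (cells L (Suc h) S) (\<lambda>Rs. bind_pmf (pick u Rs)
      (\<lambda>x. map_pmf (\<lambda>z. x + z) (slice u (S - \<Union> (set Rs)) (w - Suc h))))"
    by (simp add: bind_assoc_pmf bind_map_pmf)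
  finally show ?case .
qed

lemma add_slice_cells:
  assumes "finite S" "L > 0" "h \<le> w" "h * L + (w - h) \<le> card S"
  shows "add_pmf Y (slice u S w) = bind_pmf (cells L h S) (\<lambda>Rs.
    add_pmf (add_pmf Y (pick u Rs)) (slice u (S - \<Union> (set Rs)) (w - h)))"
proof -
  have "add_pmf Y (slice u S w) = bind_pmf (cells L h S) (\<lambda>Rs. bind_pmf (pick u Rs)
      (\<lambda>x. bind_pmf (slice u (S - \<Union> (set Rs)) (w - h)) (\<lambda>z. map_pmf (\<lambda>y. y + (x + z)) Y)))"
    unfolding add_pmf_def slice_cells[OF assms] by (simp only: bind_assoc_pmf bind_map_pmf)
  also have "\<dots> = bind_pmf (cells L h S) (\<lambda>Rs.
      bind_pmf (slice u (S - \<Union> (set Rs)) (w - h)) (\<lambda>z. bind_pmf (pick u Rs) (\<lambda>x. map_pmf (\<lambda>y. y + (x + z)) Y)))"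
    by (intro bind_pmf_cong refl bind_commute_pmf)
  also have "\<dots> = bind_pmf (cells L h S) (\<lambda>Rs.
    add_pmf (add_pmf Y (pick u Rs)) (slice u (S - \<Union> (set Rs)) (w - h)))"
    unfolding add_pmf_def by (simp only: map_bind_pmf pmf.map_comp o_def add.assoc)
  finally show ?thesis .
qed

text \<open>Groups of \<open>h\<close> cells are split off one after another. A group whose sum has all atoms at most \<open>1/q\<close>
  contributes to \<open>Y\<close>, by \<open>spread_add\<close>; as long as at least \<open>N0\<close> points are left a group fails to do so with
  probability at most \<open>3/4\<close>. The second summand bounds the probability that fewer than \<open>g0\<close> groups contribute: the
  quantity \<open>2\<^bsup>g0 - g\<^esup>\<close> is halved by a good group, so it is multiplied by at most \<open>1/4 \<cdot> 1/2 + 3/4 = 7/8\<close> on average.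
  Once \<open>g0\<close> groups have contributed, further groups are discarded, which avoids comparing \<open>window q g 1\<close> for
  different \<open>g\<close>.\<close>
lemma slice_concentration:
  assumes "finite S0" "L > 0" "q > 0"
    and bad: "\<And>S'. S' \<subseteq> S0 \<Longrightarrow> N0 \<le> card S' \<Longrightarrow>
      measure_pmf.prob (cells L h S') {Rs. \<exists>x. pmf (pick u Rs) x > 1 / real q} \<le> 3 / 4"
    and "S \<subseteq> S0" "N0 + G * h * L \<le> card S" "G * h \<le> w" "w + G * h * L \<le> card S"
    and "g \<le> g0" "spread q g Y"
  shows "measure_pmf.prob (add_pmf Y (slice u S w)) {r} \<le> window q g0 1 + 2 ^ (g0 - g) * (7 / 8) ^ G"
  using assms(5-)
proof (induction G arbitrary: S w g Y)
  case (0 S w g Y)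
  have fS: "finite S" "w \<le> card S" using 0 assms(1) finite_subset by auto
  show ?case
  proof (cases "g = g0")
    case True
    have "spread q g (add_pmf Y (slice u S w))"
      using spread_add_any[OF 0(6)] finite_set_slice[OF fS] by blast
    then have "measure_pmf.prob (add_pmf Y (slice u S w)) {r} \<le> window q g (int (card {r}))"
      unfolding spread_def by blast
    then show ?thesis using True by simp
  next
    case False
    have "measure_pmf.prob (add_pmf Y (slice u S w)) {r} \<le> 1" by simp
    also have "1 \<le> (2::real) ^ (g0 - g)" by simp
    finally show ?thesis using window_one_nonneg[of q g0] by simp
  qed
next
  case (Suc G S w g Y)
  have fS: "finite S" "w \<le> card S" using Suc.prems assms(1) finite_subset by auto
  show ?case
  proof (cases "g = g0")
    case True
    have "spread q g (add_pmf Y (slice u S w))"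
      using spread_add_any[OF Suc.prems(6)] finite_set_slice[OF fS] by blast
    then have "measure_pmf.prob (add_pmf Y (slice u S w)) {r} \<le> window q g (int (card {r}))"
      unfolding spread_def by blast
    then show ?thesis using True by (simp add: add_increasing2)
  next
    case False
    then have g: "g < g0" using Suc.prems by simp
    have sizes: "h \<le> w" "h * L + (w - h) \<le> card S" "h * L \<le> card S" "N0 \<le> card S"
      using Suc.prems by (auto simp: algebra_simps)
    define B where "B = {Rs. \<exists>x. pmf (pick u Rs) x > 1 / real q}"
    define D where "D = (2::real) ^ (g0 - g) * (7 / 8) ^ G"
    have D: "D \<ge> 0" by (simp add: D_def)
    have "measure_pmf.prob (add_pmf Y (slice u S w)) {r}
        = measure_pmf.expectation (cells L h S) (\<lambda>Rs. measure_pmf.prob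
           (add_pmf (add_pmf Y (pick u Rs)) (slice u (S - \<Union> (set Rs)) (w - h))) {r})"
      by (subst add_slice_cells[OF fS(1) assms(2) sizes(1,2)]) (rule measure_bind_pmf)
    also have "\<dots> \<le> measure_pmf.expectation (cells L h S) (\<lambda>Rs. window q g0 1 + D / 2 + D / 2 * indicator B Rs)"
    proof (rule integral_mono_AE)
      show "AE Rs in measure_pmf (cells L h S). measure_pmf.prob
           (add_pmf (add_pmf Y (pick u Rs)) (slice u (S - \<Union> (set Rs)) (w - h))) {r}
           \<le> window q g0 1 + D / 2 + D / 2 * indicator B Rs"
      proof (rule AE_pmfI)
        fix Rs assume Rs: "Rs \<in> set_pmf (cells L h S)"
        note sup = cells_support[OF fS(1) sizes(3) Rs]
        have fin: "finite (set_pmf (pick u Rs))" using sup assms(2) by (intro finite_set_pick) auto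
        have fU: "finite (\<Union> (set Rs))" using sup(2) fS(1) finite_subset by blast
        have cd: "card (S - \<Union> (set Rs)) = card S - h * L"
          using sup fU by (simp add: card_Diff_subset)
        have IH: "measure_pmf.prob (add_pmf Y' (slice u (S - \<Union> (set Rs)) (w - h))) {r}
            \<le> window q g0 1 + 2 ^ (g0 - g') * (7 / 8) ^ G" if "g' \<le> g0" "spread q g' Y'" for g' Y'
        proof (rule Suc.IH[OF _ _ _ _ that])
          show "S - \<Union> (set Rs) \<subseteq> S0" using Suc.prems by auto
          show "N0 + G * h * L \<le> card (S - \<Union> (set Rs))"
            using Suc.prems(2) cd by (simp add: algebra_simps)
          show "G * h \<le> w - h" using Suc.prems(3) by simp
          show "w - h + G * h * L \<le> card (S - \<Union> (set Rs))"
            using Suc.prems(4) cd by (simp add: algebra_simps)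
        qed
        show "measure_pmf.prob (add_pmf (add_pmf Y (pick u Rs)) (slice u (S - \<Union> (set Rs)) (w - h))) {r}
           \<le> window q g0 1 + D / 2 + D / 2 * indicator B Rs"
        proof (cases "Rs \<in> B")
          case True
          then show ?thesis using IH[of g "add_pmf Y (pick u Rs)"] g spread_add_any[OF Suc.prems(6) fin]
            by (simp add: D_def)
        next
          case False
          have "spread q (Suc g) (add_pmf Y (pick u Rs))"
            using False by (intro spread_add[OF Suc.prems(6) fin _ assms(3)]) (auto simp: B_def not_less)
          then have "measure_pmf.prob (add_pmf (add_pmf Y (pick u Rs)) (slice u (S - \<Union> (set Rs)) (w - h))) {r}
              \<le> window q g0 1 + 2 ^ (g0 - Suc g) * (7 / 8) ^ G"
            using g by (intro IH) auto
          also have "2 ^ (g0 - Suc g) * (7 / 8) ^ G = D / 2"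
          proof -
            have "g0 - g = Suc (g0 - Suc g)" using g by simp
            then show ?thesis by (simp add: D_def)
          qed
          finally show ?thesis using False by simp
        qed
      qed
    qed (intro integrable_measure_pmf_finite finite_set_cells[OF fS(1) sizes(3)])+
    also have "\<dots> = window q g0 1 + D / 2 + D / 2 * measure_pmf.prob (cells L h S) B"
      using finite_set_cells[OF fS(1) sizes(3)]
      by (subst Bochner_Integration.integral_add) (auto intro!: integrable_measure_pmf_finite)
    also have "\<dots> \<le> window q g0 1 + D / 2 + D / 2 * (3 / 4)"
      using bad[OF Suc.prems(1) sizes(4)] D by (intro add_left_mono mult_left_mono) (auto simp: B_def)
    also have "\<dots> = window q g0 1 + 2 ^ (g0 - g) * (7 / 8) ^ Suc G" by (simp add: D_def)
    finally show ?thesis .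
  qed
qed

section \<open>Additive relations and collisions\<close>

lemma binomial_superset_ratio:
  "a \<le> w \<Longrightarrow> w \<le> j \<Longrightarrow> real ((j - a) choose (w - a)) \<le> (real w / real j) ^ a * real (j choose w)"
proof (induction a arbitrary: w j)
  case (Suc a)
  obtain w' j' where wj: "w = Suc w'" "j = Suc j'" using Suc.prems by (metis Suc_le_D le_trans)
  have absorb: "real (j' choose w') = real w / real j * real (j choose w)"
  proof -
    have "Suc w' * (Suc j' choose Suc w') = Suc j' * (j' choose w')" by (rule Suc_times_binomial)
    then have "real (Suc w') * real (Suc j' choose Suc w') = real (Suc j') * real (j' choose w')"
      by (metis of_nat_mult)
    then show ?thesis unfolding wj by (simp add: nonzero_eq_divide_eq mult.commute del: binomial_Suc_Suc of_nat_Suc)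
  qed
  have "real w' / real j' \<le> real w / real j"
    using Suc.prems by (cases "j' = 0") (simp_all add: wj field_simps)
  then have "(real w' / real j') ^ a \<le> (real w / real j) ^ a" by (intro power_mono) auto
  have "real ((j - Suc a) choose (w - Suc a)) = real ((j' - a) choose (w' - a))" by (simp add: wj)
  also have "\<dots> \<le> (real w' / real j') ^ a * real (j' choose w')"
    using Suc.prems wj by (intro Suc.IH) auto
  also have "\<dots> \<le> (real w / real j) ^ a * real (j' choose w')"
    using \<open>(real w' / real j') ^ a \<le> (real w / real j) ^ a\<close> by (intro mult_right_mono) auto
  also have "\<dots> = (real w / real j) ^ Suc a * real (j choose w)" by (simp add: absorb)
  finally show ?case .
qed simp

text \<open>Sampling without replacement is dominated by sampling with replacement.\<close>
lemma prob_superset: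
  assumes "finite S" "w \<le> card S" "A \<subseteq> S"
  shows "measure_pmf.prob (subset_pmf S w) {X. A \<subseteq> X} \<le> (real w / real (card S)) ^ card A"
proof -
  have fA: "finite A" using assms finite_subset by auto
  have "measure_pmf.prob (subset_pmf S w) {X. A \<subseteq> X} = real (card ({X. X \<subseteq> S \<and> card X = w} \<inter> {X. A \<subseteq> X})) / real (card S choose w)"
    unfolding subset_pmf_def
    by (subst measure_pmf_of_set) (use subsets_finite_nonempty[OF assms(1,2)] n_subsets[OF assms(1)] in auto)
  also have "\<dots> \<le> (real w / real (card S)) ^ card A"
  proof (cases "card A \<le> w")
    case True
    have "bij_betw (\<lambda>X. X - A) ({X. X \<subseteq> S \<and> card X = w} \<inter> {X. A \<subseteq> X}) {Z. Z \<subseteq> S - A \<and> card Z = w - card A}"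
    proof (rule bij_betw_byWitness[where f' = "\<lambda>Z. Z \<union> A"])
      show "(\<lambda>X. X - A) ` ({X. X \<subseteq> S \<and> card X = w} \<inter> {X. A \<subseteq> X}) \<subseteq> {Z. Z \<subseteq> S - A \<and> card Z = w - card A}"
        using fA by (auto simp: card_Diff_subset)
      show "(\<lambda>Z. Z \<union> A) ` {Z. Z \<subseteq> S - A \<and> card Z = w - card A} \<subseteq> {X. X \<subseteq> S \<and> card X = w} \<inter> {X. A \<subseteq> X}"
      proof (rule image_subsetI)
        fix Z assume Z: "Z \<in> {Z. Z \<subseteq> S - A \<and> card Z = w - card A}"
        then have "finite Z" using assms(1) finite_subset[of Z S] by auto
        then have "card (Z \<union> A) = w" using Z fA True by (subst card_Un_disjoint) auto
        then show "Z \<union> A \<in> {X. X \<subseteq> S \<and> card X = w} \<inter> {X. A \<subseteq> X}" using Z assms(3) by auto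
      qed
    qed auto
    then have "card ({X. X \<subseteq> S \<and> card X = w} \<inter> {X. A \<subseteq> X}) = (card S - card A) choose (w - card A)"
      using assms fA by (simp add: bij_betw_same_card n_subsets card_Diff_subset)
    moreover have "real (card S choose w) > 0" using assms by simp
    ultimately show ?thesis using binomial_superset_ratio[OF True assms(2)] by (simp add: divide_le_eq)
  next
    case False
    have "{X. X \<subseteq> S \<and> card X = w} \<inter> {X. A \<subseteq> X} = {}"
      using False assms(1) by (auto dest: card_mono[rotated] finite_subset)
    then show ?thesis by (simp only: card.empty) simp
  qed
  finally show ?thesis .
qed

text \<open>Lists of \<open>k\<close> index pairs, where distinct pairs share no index but the two entries of a pair may coincide. Such a
  list \<open>(i\<^sub>1, j\<^sub>1), \<dots>, (i\<^sub>k, j\<^sub>k)\<close> stands for the relation \<open>u\<^sub>i\<^sub>1 + \<dots> + u\<^sub>i\<^sub>k = u\<^sub>j\<^sub>1 + \<dots> + u\<^sub>j\<^sub>k\<close>.\<close>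
primrec pairings :: "nat \<Rightarrow> nat set \<Rightarrow> (nat \<times> nat) list set" where
  "pairings 0 S = {[]}"
| "pairings (Suc k) S = (\<Union>e\<in>S \<times> S. (#) e ` pairings k (S - {fst e, snd e}))"

text \<open>This is, up to a constant, the probability that two independent uniform points of a random cell of \<open>L\<close> points, drawn
  from a set of \<open>j\<close> points, form the pair \<open>e\<close>.\<close>
definition weight :: "nat \<Rightarrow> nat \<Rightarrow> nat \<times> nat \<Rightarrow> real" where
  "weight L j e = (if fst e = snd e then 1 / (real L * real j) else 1 / real j ^ 2)"

definition pairing_weight :: "nat \<Rightarrow> nat \<Rightarrow> (nat \<times> nat) list \<Rightarrow> real" where
  "pairing_weight L j ps = prod_list (map (weight L j) ps)"

definition drift :: "(nat \<Rightarrow> 'a :: ab_group_add) \<Rightarrow> (nat \<times> nat) list \<Rightarrow> 'a" where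
  "drift u ps = sum_list (map (\<lambda>e. u (fst e) - u (snd e)) ps)"

text \<open>For \<open>z = 0\<close>: the weighted density of the relations that hold for \<open>u\<close>. The parameter \<open>j\<close> is separate from \<open>S\<close> so that
  the weights stay fixed while points are removed from \<open>S\<close>.\<close>
definition rel_density :: "nat \<Rightarrow> nat \<Rightarrow> nat \<Rightarrow> nat set \<Rightarrow> (nat \<Rightarrow> 'a :: ab_group_add) \<Rightarrow> 'a \<Rightarrow> real" where
  "rel_density k L j S u z = (\<Sum>ps\<in>pairings k S. if drift u ps = z then pairing_weight L j ps else 0)"

lemma finite_pairings: "finite S \<Longrightarrow> finite (pairings k S)"
  by (induction k arbitrary: S) auto

lemma pairings_mono: "S \<subseteq> T \<Longrightarrow> pairings k S \<subseteq> pairings k T"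
proof (induction k arbitrary: S T)
  case (Suc k)
  have "pairings k (S - {fst e, snd e}) \<subseteq> pairings k (T - {fst e, snd e})" for e
    using Suc.prems by (intro Suc.IH) auto
  then show ?case using Suc.prems unfolding pairings.simps by (intro UN_mono image_mono) auto
qed simp

lemma weight_nonneg: "weight L j e \<ge> 0"
  by (simp add: weight_def)

lemma pairing_weight_nonneg: "pairing_weight L j ps \<ge> 0"
  unfolding pairing_weight_def by (induction ps) (auto simp: weight_nonneg)

lemma rel_density_nonneg: "rel_density k L j S u z \<ge> 0"
  by (auto simp: rel_density_def pairing_weight_nonneg intro!: sum_nonneg)

lemma rel_density_mono: "finite T \<Longrightarrow> S \<subseteq> T \<Longrightarrow> rel_density k L j S u z \<le> rel_density k L j T u z"
  unfolding rel_density_def by (intro sum_mono2 finite_pairings pairings_mono) (auto simp: pairing_weight_nonneg)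

lemma sum_pairings_Suc:
  assumes "finite S"
  shows "(\<Sum>ps\<in>pairings (Suc k) S. f ps) = (\<Sum>e\<in>S \<times> S. \<Sum>ps\<in>pairings k (S - {fst e, snd e}). f (e # ps))"
proof -
  have "(\<Sum>ps\<in>pairings (Suc k) S. f ps) = (\<Sum>e\<in>S \<times> S. \<Sum>ps\<in>(#) e ` pairings k (S - {fst e, snd e}). f ps)"
    unfolding pairings.simps using assms by (intro sum.UNION_disjoint) (auto intro: finite_pairings)
  also have "\<dots> = (\<Sum>e\<in>S \<times> S. \<Sum>ps\<in>pairings k (S - {fst e, snd e}). f (e # ps))"
    by (rule sum.cong[OF refl]) (subst sum.reindex, auto simp: o_def)
  finally show ?thesis .
qed

lemma rel_density_Suc:
  assumes "finite S"
  shows "rel_density (Suc k) L j S u z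
    = (\<Sum>e\<in>S \<times> S. weight L j e * rel_density k L j (S - {fst e, snd e}) u (z - (u (fst e) - u (snd e))))"
proof -
  have "drift u (e # ps) = z \<longleftrightarrow> drift u ps = z - (u (fst e) - u (snd e))" for e ps
    by (auto simp: drift_def algebra_simps)
  then show ?thesis
    unfolding rel_density_def sum_pairings_Suc[OF assms] sum_distrib_left
    by (intro sum.cong refl) (simp add: pairing_weight_def)
qed

text \<open>The difference of two independent copies of \<open>pick\<close> on the same cells. Its atom at \<open>0\<close> is a collision probability,
  that is, the sum of the squares of the atoms of \<open>pick\<close>.\<close>
primrec pick_diff :: "(nat \<Rightarrow> real) \<Rightarrow> nat set list \<Rightarrow> real pmf" where
  "pick_diff u [] = return_pmf 0"
| "pick_diff u (R # Rs) = bind_pmf (pmf_of_set R) (\<lambda>i. bind_pmf (pmf_of_set R)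
    (\<lambda>i'. map_pmf (\<lambda>z. u i - u i' + z) (pick_diff u Rs)))"

lemma pmf_map_plus: "pmf (map_pmf (\<lambda>z. c + z) p) x = pmf p (x - (c :: real))"
  using pmf_map_inj'[of "\<lambda>z. c + z" p "x - c"] by (simp add: inj_def)

lemma pick_diff_eq:
  "pick_diff u Rs = bind_pmf (pick u Rs) (\<lambda>x. map_pmf (\<lambda>y. x - y) (pick u Rs))"
proof (induction Rs)
  case Nil
  then show ?case by (simp add: bind_return_pmf)
next
  case (Cons R Rs)
  have "pick_diff u (R # Rs) = bind_pmf (pmf_of_set R) (\<lambda>i. bind_pmf (pmf_of_set R)
    (\<lambda>i'. bind_pmf (pick u Rs) (\<lambda>x. map_pmf (\<lambda>y. (u i + x) - (u i' + y)) (pick u Rs))))"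
    by (simp add: Cons map_bind_pmf pmf.map_comp o_def algebra_simps)
  also have "\<dots> = bind_pmf (pmf_of_set R) (\<lambda>i. bind_pmf (pick u Rs) (\<lambda>x.
    bind_pmf (pmf_of_set R) (\<lambda>i'. map_pmf (\<lambda>y. (u i + x) - (u i' + y)) (pick u Rs))))"
    by (intro bind_pmf_cong refl bind_commute_pmf)
  also have "\<dots> = bind_pmf (pick u (R # Rs)) (\<lambda>x. map_pmf (\<lambda>y. x - y) (pick u (R # Rs)))"
    by (simp add: bind_assoc_pmf bind_map_pmf map_bind_pmf pmf.map_comp o_def)
  finally show ?case .
qed

lemma pmf_pick_diff_0:
  assumes "\<forall>R\<in>set Rs. card R > 0"
  shows "pmf (pick_diff u Rs) 0 = (\<Sum>x\<in>set_pmf (pick u Rs). pmf (pick u Rs) x ^ 2)"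
proof -
  have "pmf (map_pmf (\<lambda>y. x - y) (pick u Rs)) 0 = pmf (pick u Rs) x" for x
    using pmf_map_inj'[of "\<lambda>y. x - y" "pick u Rs" x] by (simp add: inj_def)
  then show ?thesis
    unfolding pick_diff_eq pmf_bind using finite_set_pick[OF assms]
    by (subst integral_measure_pmf_real[of "set_pmf (pick u Rs)"]) (auto simp: power2_eq_square)
qed

lemma pick_append: "pick u (Rs @ Rs') = bind_pmf (pick u Rs) (\<lambda>x. map_pmf (\<lambda>y. x + y) (pick u Rs'))"
proof (induction Rs)
  case Nil
  have "(+) (0 :: real) = id" by auto
  then show ?case by (simp add: bind_return_pmf pmf.map_id)
next
  case (Cons R Rs)
  then show ?case
    by (simp add: bind_assoc_pmf bind_map_pmf map_bind_pmf pmf.map_comp o_def flip: add.assoc)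
qed

lemma cells_append:
  "cells L (k + k') S = bind_pmf (cells L k S) (\<lambda>Rs. map_pmf (\<lambda>Rs'. Rs @ Rs') (cells L k' (S - \<Union> (set Rs))))"
proof (induction k arbitrary: S)
  case 0
  have "(@) ([] :: nat set list) = id" by auto
  then show ?case by (simp add: bind_return_pmf pmf.map_id)
next
  case (Suc k)
  then show ?case
    by (simp add: bind_assoc_pmf bind_map_pmf map_bind_pmf pmf.map_comp o_def Diff_eq Int_assoc
        del: append_Cons flip: append_Cons)
qed

text \<open>Cauchy-Schwarz, in the form \<open>2xy \<le> x\<^sup>2 + y\<^sup>2\<close>. Two lists of cells are needed so that an atom, not just its square, is
  bounded by collision probabilities.\<close>
lemma pmf_pick_append_le:
  assumes "\<forall>R\<in>set Rs. card R > 0" "\<forall>R\<in>set Rs'. card R > 0"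
  shows "pmf (pick u (Rs @ Rs')) r \<le> (pmf (pick_diff u Rs) 0 + pmf (pick_diff u Rs') 0) / 2"
proof -
  let ?p = "pmf (pick u Rs)" and ?q = "pmf (pick u Rs')"
  let ?P = "set_pmf (pick u Rs)" and ?Q = "set_pmf (pick u Rs')"
  note fin = finite_set_pick[OF assms(1), of u] finite_set_pick[OF assms(2), of u]
  have "pmf (pick u (Rs @ Rs')) r = (\<Sum>x\<in>?P. ?p x * ?q (r - x))"
    unfolding pick_append pmf_bind pmf_map_plus using fin
    by (subst integral_measure_pmf_real[of ?P]) (auto simp: mult.commute)
  also have "\<dots> \<le> (\<Sum>x\<in>?P. (?p x ^ 2 + ?q (r - x) ^ 2) / 2)"
  proof (rule sum_mono)
    fix x
    have "0 \<le> (?p x - ?q (r - x)) ^ 2" by simp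
    then show "?p x * ?q (r - x) \<le> (?p x ^ 2 + ?q (r - x) ^ 2) / 2"
      by (simp add: power2_eq_square algebra_simps)
  qed
  also have "\<dots> = ((\<Sum>x\<in>?P. ?p x ^ 2) + (\<Sum>x\<in>?P. ?q (r - x) ^ 2)) / 2"
    by (simp add: sum.distrib flip: sum_divide_distrib)
  also have "(\<Sum>x\<in>?P. ?q (r - x) ^ 2) = (\<Sum>y\<in>(\<lambda>x. r - x) ` ?P. ?q y ^ 2)"
    by (subst sum.reindex) (auto simp: inj_on_def)
  also have "\<dots> = (\<Sum>y\<in>(\<lambda>x. r - x) ` ?P \<inter> ?Q. ?q y ^ 2)"
    using fin by (intro sum.mono_neutral_right) (auto simp: set_pmf_iff)
  also have "\<dots> \<le> (\<Sum>y\<in>?Q. ?q y ^ 2)"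
    using fin by (intro sum_mono2) auto
  finally show ?thesis
    by (simp add: pmf_pick_diff_0[OF assms(1)] pmf_pick_diff_0[OF assms(2)] divide_right_mono)
qed

text \<open>A collision in \<open>k\<close> random cells is a relation whose pairs are drawn from the cells, so by \<open>prob_superset\<close> the list
  of pairs has at most its weight as probability. The constant \<open>16\<close> pays for the shrinking of \<open>S\<close>, which keeps at
  least \<open>j/4\<close> points.\<close>
lemma expected_collision:
  assumes "finite S" "L > 0" "j + 4 * (k * L) \<le> 4 * card S" "j > 0"
  shows "pmf (bind_pmf (cells L k S) (pick_diff u)) z \<le> 16 ^ k * rel_density k L j S u z"
  using assms(1,3)
proof (induction k arbitrary: S z)
  case 0
  show ?case
    unfolding rel_density_def pairings.simps cells.simps bind_return_pmf pick_diff.simps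
    by (simp add: drift_def pairing_weight_def indicator_def)
next
  case (Suc k)
  let ?D = "\<lambda>k S. bind_pmf (cells L k S) (pick_diff u)"
  have sz: "L \<le> card S" "j \<le> 4 * card S" using Suc.prems(2) by auto
  have cS: "card S > 0" using sz assms by auto
  define \<phi> where "\<phi> e = 16 ^ k * rel_density k L j (S - {fst e, snd e}) u (z - (u (fst e) - u (snd e)))" for e
  have \<phi>0: "\<phi> e \<ge> 0" for e by (simp add: \<phi>_def rel_density_nonneg)
  have "?D (Suc k) S = bind_pmf (subset_pmf S L) (\<lambda>R. bind_pmf (cells L k (S - R)) (\<lambda>Rs. pick_diff u (R # Rs)))"
    by (simp add: bind_assoc_pmf bind_map_pmf)
  also have "\<dots> = bind_pmf (subset_pmf S L) (\<lambda>R. bind_pmf (pmf_of_set R) (\<lambda>i. bind_pmf (pmf_of_set R)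
      (\<lambda>i'. map_pmf (\<lambda>z. u i - u i' + z) (?D k (S - R)))))"
    unfolding pick_diff.simps map_bind_pmf
    by (subst (2) bind_commute_pmf, subst bind_commute_pmf) (rule refl)
  finally have D: "?D (Suc k) S = \<dots>" .
  have fin: "finite (set_pmf (subset_pmf S L))" using Suc.prems sz by (simp add: set_subset_pmf)
  have "pmf (?D (Suc k) S) z = measure_pmf.expectation (subset_pmf S L) (\<lambda>R. pmf (bind_pmf (pmf_of_set R)
      (\<lambda>i. bind_pmf (pmf_of_set R) (\<lambda>i'. map_pmf (\<lambda>z. u i - u i' + z) (?D k (S - R))))) z)"
    unfolding D pmf_bind ..
  also have "\<dots> \<le> measure_pmf.expectation (subset_pmf S L)
      (\<lambda>R. \<Sum>e\<in>S \<times> S. \<phi> e / real L ^ 2 * indicator {R. {fst e, snd e} \<subseteq> R} R)"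
  proof (rule integral_mono_AE)
    show "AE R in measure_pmf (subset_pmf S L). pmf (bind_pmf (pmf_of_set R)
      (\<lambda>i. bind_pmf (pmf_of_set R) (\<lambda>i'. map_pmf (\<lambda>z. u i - u i' + z) (?D k (S - R))))) z
      \<le> (\<Sum>e\<in>S \<times> S. \<phi> e / real L ^ 2 * indicator {R. {fst e, snd e} \<subseteq> R} R)"
    proof (rule AE_pmfI)
      fix R assume "R \<in> set_pmf (subset_pmf S L)"
      then have R: "R \<subseteq> S" "card R = L" using set_subset_pmf[OF Suc.prems(1) sz(1)] by auto
      then have fR: "finite R" "R \<noteq> {}" using assms(2) by (auto simp: card_gt_0_iff)
      have cR: "card (S - R) = card S - L" using R fR by (simp add: card_Diff_subset)
      have "pmf (bind_pmf (pmf_of_set R) (\<lambda>i. bind_pmf (pmf_of_set R)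
          (\<lambda>i'. map_pmf (\<lambda>z. u i - u i' + z) (?D k (S - R))))) z
          = (\<Sum>i\<in>R. (\<Sum>i'\<in>R. pmf (?D k (S - R)) (z - (u i - u i'))) / real L) / real L"
        using fR R by (simp add: pmf_bind_pmf_of_set pmf_map_plus)
      also have "\<dots> = (\<Sum>e\<in>R \<times> R. pmf (?D k (S - R)) (z - (u (fst e) - u (snd e)))) / real L ^ 2"
        by (simp add: sum.cartesian_product case_prod_unfold power2_eq_square flip: sum_divide_distrib)
      also have "\<dots> \<le> (\<Sum>e\<in>R \<times> R. \<phi> e) / real L ^ 2"
      proof (intro divide_right_mono sum_mono)
        fix e assume e: "e \<in> R \<times> R"
        have "pmf (?D k (S - R)) (z - (u (fst e) - u (snd e)))
            \<le> 16 ^ k * rel_density k L j (S - R) u (z - (u (fst e) - u (snd e)))"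
          using Suc.prems cR by (intro Suc.IH) auto
        also have "\<dots> \<le> \<phi> e"
          unfolding \<phi>_def using e Suc.prems(1) by (intro mult_left_mono rel_density_mono) auto
        finally show "pmf (?D k (S - R)) (z - (u (fst e) - u (snd e))) \<le> \<phi> e" .
      qed simp
      also have "\<dots> = (\<Sum>e\<in>R \<times> R. \<phi> e / real L ^ 2 * indicator {R. {fst e, snd e} \<subseteq> R} R)"
        unfolding sum_divide_distrib by (intro sum.cong refl) (auto simp: indicator_def)
      also have "\<dots> \<le> (\<Sum>e\<in>S \<times> S. \<phi> e / real L ^ 2 * indicator {R. {fst e, snd e} \<subseteq> R} R)"
        using R Suc.prems(1) \<phi>0 by (intro sum_mono2) auto
      finally show "pmf (bind_pmf (pmf_of_set R) (\<lambda>i. bind_pmf (pmf_of_set R)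
          (\<lambda>i'. map_pmf (\<lambda>z. u i - u i' + z) (?D k (S - R))))) z
          \<le> (\<Sum>e\<in>S \<times> S. \<phi> e / real L ^ 2 * indicator {R. {fst e, snd e} \<subseteq> R} R)" .
    qed
  qed (intro integrable_measure_pmf_finite fin)+
  also have "\<dots> = (\<Sum>e\<in>S \<times> S. \<phi> e / real L ^ 2 * measure_pmf.prob (subset_pmf S L) {R. {fst e, snd e} \<subseteq> R})"
    by (subst Bochner_Integration.integral_sum) (auto intro!: integrable_measure_pmf_finite fin)
  also have "\<dots> \<le> (\<Sum>e\<in>S \<times> S. \<phi> e * (16 * weight L j e))"
  proof (rule sum_mono)
    fix e assume e: "e \<in> S \<times> S"
    have "measure_pmf.prob (subset_pmf S L) {R. {fst e, snd e} \<subseteq> R} \<le> (real L / real (card S)) ^ card {fst e, snd e}"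
      using e Suc.prems(1) sz by (intro prob_superset) auto
    also have "\<dots> \<le> real L ^ 2 * (16 * weight L j e)"
    proof (cases "fst e = snd e")
      case True
      have "real L / real (card S) \<le> real L * (16 / real j)"
       proof -
        have "real j \<le> 16 * real (card S)" using sz(2) by linarith
        then have "1 / real (card S) \<le> 16 / real j" using cS assms(4) by (simp add: field_simps)
        then have "real L * (1 / real (card S)) \<le> real L * (16 / real j)" by (intro mult_left_mono) auto
        then show ?thesis by simp
      qed
      then show ?thesis using True assms(2) by (simp add: weight_def power2_eq_square)
    next
      case False
      have "real j \<le> 4 * real (card S)" using sz(2) by linarith
      then have "real j ^ 2 \<le> (4 * real (card S)) ^ 2" by (intro power_mono) auto
      then have "1 / real (card S) ^ 2 \<le> 16 / real j ^ 2"
        using cS assms by (simp add: field_simps)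
      then have "real L ^ 2 * (1 / real (card S) ^ 2) \<le> real L ^ 2 * (16 / real j ^ 2)"
        by (intro mult_left_mono) auto
      then show ?thesis using False by (simp add: weight_def power_divide numeral_2_eq_2[symmetric])
    qed
    finally have "\<phi> e / real L ^ 2 * measure_pmf.prob (subset_pmf S L) {R. {fst e, snd e} \<subseteq> R}
        \<le> \<phi> e / real L ^ 2 * (real L ^ 2 * (16 * weight L j e))"
      using \<phi>0 by (intro mult_left_mono) auto
    then show "\<phi> e / real L ^ 2 * measure_pmf.prob (subset_pmf S L) {R. {fst e, snd e} \<subseteq> R} \<le> \<phi> e * (16 * weight L j e)"
      using assms(2) by simp
  qed
  also have "\<dots> = 16 ^ Suc k * rel_density (Suc k) L j S u z"
    unfolding rel_density_Suc[OF Suc.prems(1)] \<phi>_def sum_distrib_left by (intro sum.cong refl) (simp add: mult_ac)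
  finally show ?case .
qed

section \<open>Atoms of the sum over a random subset\<close>

lemma expectation_affine:
  fixes f :: "'a \<Rightarrow> real"
  assumes "finite (set_pmf M)"
  shows "measure_pmf.expectation M (\<lambda>x. b * (c + f x)) = b * (c + measure_pmf.expectation M f)"
proof -
  have "measure_pmf.expectation M (\<lambda>x. b * (c + f x)) = b * measure_pmf.expectation M (\<lambda>x. c + f x)"
    by simp
  also have "measure_pmf.expectation M (\<lambda>x. c + f x) = c + measure_pmf.expectation M f"
    using integrable_measure_pmf_finite[OF assms, of f] by (subst Bochner_Integration.integral_add) auto
  finally show ?thesis .
qed

text \<open>Markov's inequality for the two collision probabilities of a group of \<open>2k\<close> cells.\<close>
lemma bad_group_prob:
  assumes "finite S" "L > 0" "j > 0" "q > 0" "j + 8 * (k * L) \<le> 4 * card S"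
  shows "measure_pmf.prob (cells L (k + k) S) {Rs. \<exists>x. pmf (pick u Rs) x > 1 / real q}
    \<le> real q * 16 ^ k * rel_density k L j S u 0"
proof -
  let ?B = "{Rs. \<exists>x. pmf (pick u Rs) x > 1 / real q}"
  let ?c = "\<lambda>Rs. pmf (pick_diff u Rs) 0"
  define K where "K = 16 ^ k * rel_density k L j S u 0"
  have kS: "k * L \<le> card S" using assms by auto
  note fin = finite_set_cells[OF assms(1) kS]
  have step: "measure_pmf.prob (map_pmf (\<lambda>Rs'. Rs @ Rs') (cells L k (S - \<Union> (set Rs)))) ?B
      \<le> real q / 2 * (?c Rs + K)" if Rs: "Rs \<in> set_pmf (cells L k S)" for Rs
  proof -
    let ?S = "S - \<Union> (set Rs)"
    note sup = cells_support[OF assms(1) kS Rs]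
    have "finite (\<Union> (set Rs))" using sup(2) assms(1) finite_subset by blast
    then have cS: "card ?S = card S - k * L" using sup by (simp add: card_Diff_subset)
    have kS': "k * L \<le> card ?S" using cS assms by auto
    have fS: "finite ?S" using assms by auto
    note fin' = finite_set_cells[OF fS kS']
    have "measure_pmf.prob (map_pmf (\<lambda>Rs'. Rs @ Rs') (cells L k ?S)) ?B
        = measure_pmf.expectation (cells L k ?S) (indicator ((\<lambda>Rs'. Rs @ Rs') -` ?B))"
      by simp
    also have "\<dots> \<le> measure_pmf.expectation (cells L k ?S) (\<lambda>Rs'. real q / 2 * (?c Rs + ?c Rs'))"
    proof (rule integral_mono_AE)
      show "AE Rs' in measure_pmf (cells L k ?S). indicator ((\<lambda>Rs'. Rs @ Rs') -` ?B) Rs' \<le> real q / 2 * (?c Rs + ?c Rs')"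
      proof (rule AE_pmfI)
        fix Rs' assume Rs': "Rs' \<in> set_pmf (cells L k ?S)"
        show "indicator ((\<lambda>Rs'. Rs @ Rs') -` ?B) Rs' \<le> real q / 2 * (?c Rs + ?c Rs')"
        proof (cases "Rs @ Rs' \<in> ?B")
          case True
          then obtain x where "1 / real q < pmf (pick u (Rs @ Rs')) x" by auto
          also have "\<dots> \<le> (?c Rs + ?c Rs') / 2"
            using sup(4) cells_support(4)[OF fS kS' Rs'] assms(2) by (intro pmf_pick_append_le) auto
          finally have "1 \<le> real q * ((?c Rs + ?c Rs') / 2)" using assms(4) by (simp add: field_simps)
          then show ?thesis using True by simp
        next
          case False
          then show ?thesis by (simp add: add_nonneg_nonneg)
        qed
      qed
    qed (intro integrable_measure_pmf_finite fin')+
    also have "\<dots> = real q / 2 * (?c Rs + measure_pmf.expectation (cells L k ?S) ?c)"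
      by (rule expectation_affine[OF fin'])
    also have "measure_pmf.expectation (cells L k ?S) ?c = pmf (bind_pmf (cells L k ?S) (pick_diff u)) 0"
      by (simp add: pmf_bind)
    also have "\<dots> \<le> 16 ^ k * rel_density k L j ?S u 0"
      using cS assms by (intro expected_collision) auto
    also have "\<dots> \<le> K" unfolding K_def using assms(1) by (intro mult_left_mono rel_density_mono) auto
    finally show ?thesis by (simp add: mult_left_mono)
  qed
  have "measure_pmf.prob (cells L (k + k) S) ?B
      = measure_pmf.expectation (cells L k S) (\<lambda>Rs. measure_pmf.prob (map_pmf (\<lambda>Rs'. Rs @ Rs') (cells L k (S - \<Union> (set Rs)))) ?B)"
    unfolding cells_append by (rule measure_bind_pmf)
  also have "\<dots> \<le> measure_pmf.expectation (cells L k S) (\<lambda>Rs. real q / 2 * (?c Rs + K))"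
    by (rule integral_mono_AE) (use step in \<open>auto intro!: integrable_measure_pmf_finite fin AE_pmfI\<close>)
  also have "\<dots> = real q / 2 * (measure_pmf.expectation (cells L k S) ?c + K)"
    using expectation_affine[OF fin, of "real q / 2" K ?c] by (simp only: add.commute)
  also have "\<dots> \<le> real q / 2 * (K + K)"
  proof (intro mult_left_mono add_right_mono)
    show "measure_pmf.expectation (cells L k S) ?c \<le> K"
      unfolding pmf_bind[symmetric] K_def using assms by (intro expected_collision) auto
  qed simp
  finally show ?thesis by (simp add: K_def mult_ac)
qed

lemma add_pmf_return: "add_pmf (return_pmf 0) X = X"
  by (simp add: add_pmf_def bind_return_pmf')

lemma seven_eighths_power: "2 ^ (2 * a) * (7 / 8) ^ (16 * a) \<le> (1 / 2 :: real) ^ a"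
proof -
  have "2 ^ (2 * a) * (7 / 8) ^ (16 * a) = ((4 :: real) * (7 / 8) ^ 16) ^ a"
    by (simp add: power_mult power_mult_distrib)
  also have "\<dots> \<le> (1 / 2) ^ a" by (intro power_mono) (simp_all add: power_divide)
  finally show ?thesis .
qed

text \<open>With \<open>16a\<close> groups, of which \<open>2a\<close> have to be good, the failure term of \<open>slice_concentration\<close> is exponentially small.\<close>
lemma slice_bound:
  assumes "finite S0" "L > 0" "c > 0" "a > 0"
    and bad: "\<And>S'. S' \<subseteq> S0 \<Longrightarrow> N0 \<le> card S' \<Longrightarrow>
      measure_pmf.prob (cells L h S') {Rs. \<exists>x. pmf (pick u Rs) x > 1 / real (2 * c)} \<le> 3 / 4"
    and "N0 + 16 * a * h * L \<le> card S0" "16 * a * h \<le> w" "w + 16 * a * h * L \<le> card S0"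
  shows "measure_pmf.prob (slice u S0 w) {r} \<le> 2 / (real c * sqrt (2 * real a + 1)) + (1 / 2) ^ a"
proof -
  have "measure_pmf.prob (add_pmf (return_pmf 0) (slice u S0 w)) {r}
      \<le> window (2 * c) (2 * a) 1 + 2 ^ (2 * a - 0) * (7 / 8) ^ (16 * a)"
    by (rule slice_concentration[where ?N0.0 = N0 and h = h and L = L and ?S0.0 = S0])
      (use assms spread_return in auto)
  then show ?thesis using window_bound[OF assms(3,4)] seven_eighths_power[of a] by (simp add: add_pmf_return)
qed

text \<open>The bound is useful when relations are rare: the assumption on the density makes a group of \<open>2k\<close> cells good with probability at least \<open>1/4\<close>.\<close>
lemma slice_bound_relations:
  assumes "finite S" "L > 0" "k > 0" "c > 0" "a > 0"
    and "real (2 * c) * 16 ^ k * rel_density k L (card S) S u 0 \<le> 3 / 4"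
    and "64 * (a * k * L) \<le> card S" "32 * (a * k * L) \<le> w" "w + 32 * (a * k * L) \<le> card S"
  shows "measure_pmf.prob (slice u S w) {r} \<le> 2 / (real c * sqrt (2 * real a + 1)) + (1 / 2) ^ a"
proof (rule slice_bound[OF assms(1,2,4,5), of "card S - 32 * (a * k * L)" "k + k"])
  have kL: "k * L \<le> a * k * L" and "a * k \<le> a * k * L" using assms by auto
  show "16 * a * (k + k) \<le> w" 
  proof -
    have "16 * a * (k + k) = 32 * (a * k)" by simp
    then show ?thesis using \<open>a * k \<le> a * k * L\<close> assms(8) by linarith
  qed
  show "card S - 32 * (a * k * L) + 16 * a * (k + k) * L \<le> card S"
    "w + 16 * a * (k + k) * L \<le> card S"
    using assms(7,9) by (simp_all add: algebra_simps)
  have "a * k * L > 0" using assms by simp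
  then have c0: "card S > 0" using assms(7) by linarith
  fix S' assume S': "S' \<subseteq> S" "card S - 32 * (a * k * L) \<le> card S'"
  have "measure_pmf.prob (cells L (k + k) S') {Rs. \<exists>x. pmf (pick u Rs) x > 1 / real (2 * c)}
      \<le> real (2 * c) * 16 ^ k * rel_density k L (card S) S' u 0"
  proof (rule bad_group_prob)
    show "finite S'" using S' assms(1) finite_subset by blast
    show "card S + 8 * (k * L) \<le> 4 * card S'" using S'(2) kL assms(7) by linarith
  qed (use assms c0 in auto)
  also have "\<dots> \<le> real (2 * c) * 16 ^ k * rel_density k L (card S) S u 0"
    using S' assms(1) by (intro mult_left_mono rel_density_mono) auto
  finally show "measure_pmf.prob (cells L (k + k) S') {Rs. \<exists>x. pmf (pick u Rs) x > 1 / real (2 * c)} \<le> 3 / 4"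
    using assms(6) by linarith
qed

text \<open>The cells are now pairs. A pair with two different values has atoms \<open>1/2\<close>. If no value is taken on more than half of
  \<open>S\<close>, then a random pair from a large part of \<open>S\<close> has equal values with probability at most \<open>3/4\<close>.\<close>
lemma equal_pair_prob:
  assumes "finite S'" "S' \<subseteq> S" "finite S" "\<And>x. 2 * card {i\<in>S. u i = x} \<le> card S"
    "2 * card S \<le> 3 * card S'" "card S > 1"
  shows "measure_pmf.prob (cells 2 1 S') {Rs. \<exists>x. pmf (pick u Rs) x > 1 / 2} \<le> 3 / 4"
proof -
  let ?E = "{R. R \<subseteq> S' \<and> card R = 2 \<and> (\<exists>a\<in>R. \<exists>b\<in>R. a \<noteq> b \<and> u a = u b)}"
  define O' where "O' = (SIGMA a:S'. {b\<in>S'. b \<noteq> a \<and> u b = u a})"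
  define J where "J = real (card S')"
  have J: "2 \<le> card S'" using assms(5,6) by linarith
  have set2: "set_pmf (subset_pmf S' 2) = {R. R \<subseteq> S' \<and> card R = 2}"
    by (rule set_subset_pmf[OF assms(1) J])
  have "measure_pmf.prob (cells 2 1 S') {Rs. \<exists>x. pmf (pick u Rs) x > 1 / 2}
      = measure_pmf.prob (subset_pmf S' 2) ((\<lambda>R. [R]) -` {Rs. \<exists>x. pmf (pick u Rs) x > 1 / 2})"
    by (simp add: map_pmf_def[symmetric] flip: map_pmf_def)
  also have "\<dots> \<le> measure_pmf.prob (subset_pmf S' 2) ?E"
  proof -
    have "measure_pmf.prob (subset_pmf S' 2) ((\<lambda>R. [R]) -` {Rs. \<exists>x. pmf (pick u Rs) x > 1 / 2})
      = measure_pmf.prob (subset_pmf S' 2) ((\<lambda>R. [R]) -` {Rs. \<exists>x. pmf (pick u Rs) x > 1 / 2} \<inter> set_pmf (subset_pmf S' 2))"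
      by (simp add: measure_Int_set_pmf)
    also have "\<dots> \<le> measure_pmf.prob (subset_pmf S' 2) ?E"
    proof (rule measure_pmf.finite_measure_mono)
      show "(\<lambda>R. [R]) -` {Rs. \<exists>x. pmf (pick u Rs) x > 1 / 2} \<inter> set_pmf (subset_pmf S' 2) \<subseteq> ?E"
      proof
        fix R assume R: "R \<in> (\<lambda>R. [R]) -` {Rs. \<exists>x. pmf (pick u Rs) x > 1 / 2} \<inter> set_pmf (subset_pmf S' 2)"
        then have RS: "R \<subseteq> S'" "card R = 2" using set2 by auto
        then obtain a b where ab: "R = {a, b}" "a \<noteq> b" by (auto simp: card_2_iff)
        obtain x where x: "pmf (pick u [R]) x > 1 / 2" using R by auto
        have "pmf (pick u [R]) x = ((if u a = x then 1 else 0) + (if u b = x then 1 else 0)) / 2"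
          using ab by (simp add: pmf_bind_pmf_of_set map_pmf_def bind_return_pmf indicator_def)
        then have "u a = u b" using x by (auto split: if_splits)
        then show "R \<in> ?E" using RS ab by auto
      qed
    qed simp
    finally show ?thesis .
  qed
  also have "\<dots> = real (card ?E) / real (card S' choose 2)"
  proof -
    have "{R. R \<subseteq> S' \<and> card R = 2} \<inter> ?E = ?E" by auto
    then show ?thesis unfolding subset_pmf_def
      using subsets_finite_nonempty[OF assms(1) J] by (subst measure_pmf_of_set) (auto simp: n_subsets[OF assms(1)])
  qed
  also have "\<dots> \<le> 3 / 4"
  proof -
    have fO: "finite O'" using assms(1) by (auto simp: O'_def)
    have fE: "finite ?E" using assms(1) by simp
    have "2 * card ?E \<le> card O'"
    proof -
      have "2 * card ?E = (\<Sum>R\<in>?E. 2)" by simp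
      also have "\<dots> \<le> (\<Sum>R\<in>?E. card {p\<in>O'. {fst p, snd p} = R})"
      proof (rule sum_mono)
        fix R assume "R \<in> ?E"
        then obtain a b where ab: "a \<in> R" "b \<in> R" "a \<noteq> b" "u a = u b" "R \<subseteq> S'" "card R = 2" by auto
        then have "R = {a, b}" by (auto simp: card_2_iff)
        then have "{(a, b), (b, a)} \<subseteq> {p\<in>O'. {fst p, snd p} = R}" using ab by (auto simp: O'_def)
        then have "card {(a, b), (b, a)} \<le> card {p\<in>O'. {fst p, snd p} = R}"
          using fO by (intro card_mono) auto
        then show "2 \<le> card {p\<in>O'. {fst p, snd p} = R}" using ab by simp
      qed
      also have "\<dots> = card (\<Union>R\<in>?E. {p\<in>O'. {fst p, snd p} = R})"
        using fE fO by (intro card_UN_disjoint[symmetric]) auto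
      also have "\<dots> \<le> card O'" using fO by (intro card_mono) auto
      finally show ?thesis .
    qed
    moreover have "card O' \<le> card S' * (card S div 2 - 1)"
    proof -
      have "card O' = (\<Sum>a\<in>S'. card {b\<in>S'. b \<noteq> a \<and> u b = u a})"
        unfolding O'_def using assms(1) by (subst card_SigmaI) auto
      also have "\<dots> \<le> (\<Sum>a\<in>S'. card S div 2 - 1)"
      proof (rule sum_mono)
        fix a assume a: "a \<in> S'"
        have "card {b\<in>S'. b \<noteq> a \<and> u b = u a} \<le> card ({i\<in>S. u i = u a} - {a})"
          using assms(2,3) by (intro card_mono) auto
        also have "\<dots> = card {i\<in>S. u i = u a} - 1" using a assms(2) by (subst card_Diff_singleton) auto
        also have "\<dots> \<le> card S div 2 - 1" using assms(4)[of "u a"] by auto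
        finally show "card {b\<in>S'. b \<noteq> a \<and> u b = u a} \<le> card S div 2 - 1" .
      qed
      finally show ?thesis by simp
    qed
    ultimately have "2 * card ?E \<le> card S' * (card S div 2 - 1)" by linarith
    then have "2 * real (card ?E) \<le> J * real (card S div 2 - 1)"
    proof -
      assume "2 * card ?E \<le> card S' * (card S div 2 - 1)"
      then have "real (2 * card ?E) \<le> real (card S' * (card S div 2 - 1))" by (simp only: of_nat_le_iff)
      then show ?thesis by (simp add: J_def)
    qed
    also have "\<dots> \<le> J * ((3 / 4) * (J - 1))"
    proof (rule mult_left_mono)
      have "4 * (card S div 2 - 1) \<le> 3 * (card S' - 1)" using assms(5) J by linarith
      then have "4 * real (card S div 2 - 1) \<le> 3 * real (card S' - 1)" by linarith
      then show "real (card S div 2 - 1) \<le> 3 / 4 * (J - 1)" using J by (simp add: J_def of_nat_diff)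
    qed (simp add: J_def)
    finally have "real (card ?E) \<le> 3 / 4 * (J * (J - 1) / 2)" by (simp add: algebra_simps)
    also have "J * (J - 1) / 2 = real (card S' choose 2)"
    proof -
      have "2 * (card S' choose 2) = card S' * (card S' - 1)"
      proof -
        have "even (card S' * (card S' - 1))" by (cases "even (card S')") auto
        then show ?thesis unfolding choose_two by (rule dvd_mult_div_cancel)
      qed
      then have "2 * real (card S' choose 2) = real (card S') * real (card S' - 1)"
      proof -
        assume "2 * (card S' choose 2) = card S' * (card S' - 1)"
        then have "real (2 * (card S' choose 2)) = real (card S' * (card S' - 1))" by (simp only:)
        then show ?thesis by (simp only: of_nat_mult of_nat_numeral)
      qed
      then show ?thesis using J by (simp add: J_def of_nat_diff)
    qed
    finally have "real (card ?E) \<le> 3 / 4 * real (card S' choose 2)" .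
    moreover have "real (card S' choose 2) > 0" using J by simp
    ultimately show ?thesis by (simp add: divide_le_eq)
  qed
  finally show ?thesis .
qed

text \<open>The weaker bound that remains when every large set of coordinates has many relations.\<close>
lemma slice_bound_pairs:
  assumes "finite S" "a > 0" "\<And>x. 2 * card {i\<in>S. u i = x} \<le> card S"
    and "96 * a \<le> card S" "32 * a \<le> w" "w + 32 * a \<le> card S"
  shows "measure_pmf.prob (slice u S w) {r} \<le> 2 / sqrt (2 * real a + 1) + (1 / 2) ^ a"
proof -
  have "measure_pmf.prob (slice u S w) {r} \<le> 2 / (real 1 * sqrt (2 * real a + 1)) + (1 / 2) ^ a"
  proof (rule slice_bound[OF assms(1) _ _ assms(2), of 2 1 "card S - 32 * a" 1])
    fix S' assume S': "S' \<subseteq> S" "card S - 32 * a \<le> card S'"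
    have "measure_pmf.prob (cells 2 1 S') {Rs. \<exists>x. pmf (pick u Rs) x > 1 / 2} \<le> 3 / 4"
    proof (rule equal_pair_prob[OF _ S'(1) assms(1,3)])
      show "finite S'" using S' assms(1) finite_subset by blast
    qed (use S' assms in linarith)+
    then show "measure_pmf.prob (cells 2 1 S') {Rs. \<exists>x. pmf (pick u Rs) x > 1 / real (2 * 1)} \<le> 3 / 4"
      by simp
  qed (use assms in simp_all)
  then show ?thesis by simp
qed

section \<open>Restriction to a subset of the coordinates\<close>

text \<open>Given its trace outside \<open>S\<close>, the trace of a random subset on \<open>S\<close> is a uniform subset of its size.\<close>
lemma subset_pmf_resample:
  assumes "finite V" "S \<subseteq> V" "s \<le> card V"
  shows "subset_pmf V s = bind_pmf (subset_pmf V s)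
    (\<lambda>X. map_pmf (\<lambda>Z. (X - S) \<union> Z) (subset_pmf S (card (X \<inter> S))))" (is "_ = ?N")
proof -
  let ?A = "{X. X \<subseteq> V \<and> card X = s}"
  have fS: "finite S" using assms finite_subset by blast
  have cXS: "card (X \<inter> S) \<le> card S" for X using fS by (intro card_mono) auto
  have fX: "finite X" if "X \<in> ?A" for X using that assms(1) finite_subset by blast
  have "?N = pmf_of_set ?A"
  proof (rule eq_pmf_of_setI)
    show "finite ?A" "?A \<noteq> {}" using subsets_finite_nonempty[OF assms(1,3)] by auto
    show "set_pmf ?N \<subseteq> ?A"
    proof
      fix Y assume "Y \<in> set_pmf ?N"
      then obtain X where "X \<in> set_pmf (subset_pmf V s)"
        and Y: "Y \<in> set_pmf (map_pmf (\<lambda>Z. (X - S) \<union> Z) (subset_pmf S (card (X \<inter> S))))"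
        unfolding set_bind_pmf by blast
      then have X: "X \<in> ?A" using set_subset_pmf[OF assms(1,3)] by blast
      from Y obtain Z where Z: "Z \<subseteq> S" "card Z = card (X \<inter> S)" "Y = (X - S) \<union> Z"
        unfolding set_map_pmf set_subset_pmf[OF fS cXS] by blast
      have "finite Z" using Z fS finite_subset by blast
      then have "card Y = card (X - S) + card Z" unfolding Z(3) using Z(1) fX[OF X] by (intro card_Un_disjoint) auto
      also have "\<dots> = card X" using Z(2) fX[OF X] by (metis card_Int_Diff add.commute)
      finally show "Y \<in> ?A" using X Z assms(2) by auto
    qed
    fix Y assume Y: "Y \<in> ?A"
    let ?w = "card (Y \<inter> S)"
    define d where "d = 1 / real (card S choose ?w)"
    have inner: "pmf (map_pmf (\<lambda>Z. (X - S) \<union> Z) (subset_pmf S (card (X \<inter> S)))) Y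
        = (if X - S = Y - S \<and> card (X \<inter> S) = ?w then d else 0)" if X: "X \<in> ?A" for X
    proof -
      have "pmf (map_pmf (\<lambda>Z. (X - S) \<union> Z) (subset_pmf S (card (X \<inter> S)))) Y
          = measure_pmf.prob (subset_pmf S (card (X \<inter> S))) (((\<lambda>Z. (X - S) \<union> Z) -` {Y}) \<inter> {Z. Z \<subseteq> S \<and> card Z = card (X \<inter> S)})"
        unfolding pmf_map set_subset_pmf[OF fS cXS, symmetric] by (simp add: measure_Int_set_pmf)
      also have "((\<lambda>Z. (X - S) \<union> Z) -` {Y}) \<inter> {Z. Z \<subseteq> S \<and> card Z = card (X \<inter> S)}
          = (if X - S = Y - S \<and> card (X \<inter> S) = ?w then {Y \<inter> S} else {})"
      proof -
        have 1: "Z = Y \<inter> S" "X - S = Y - S" if "Z \<subseteq> S" "(X - S) \<union> Z = Y" for Z using that by auto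
        have 2: "(X - S) \<union> (Y \<inter> S) = Y" if "X - S = Y - S" using that by auto
        show ?thesis
        proof (cases "X - S = Y - S \<and> card (X \<inter> S) = ?w")
          case True
          then have "Y \<inter> S \<in> ((\<lambda>Z. (X - S) \<union> Z) -` {Y}) \<inter> {Z. Z \<subseteq> S \<and> card Z = card (X \<inter> S)}"
            using 2 by simp
          then have "((\<lambda>Z. (X - S) \<union> Z) -` {Y}) \<inter> {Z. Z \<subseteq> S \<and> card Z = card (X \<inter> S)} = {Y \<inter> S}"
            using 1(1) by blast
          then show ?thesis using True by simp
        next
          case False
          have "Z \<notin> ((\<lambda>Z. (X - S) \<union> Z) -` {Y}) \<inter> {Z. Z \<subseteq> S \<and> card Z = card (X \<inter> S)}" for Z
          proof
            assume "Z \<in> ((\<lambda>Z. (X - S) \<union> Z) -` {Y}) \<inter> {Z. Z \<subseteq> S \<and> card Z = card (X \<inter> S)}"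
            then have Z: "Z \<subseteq> S" "(X - S) \<union> Z = Y" "card Z = card (X \<inter> S)" by simp_all
            from 1[OF Z(1,2)] Z(3) False show False by simp
          qed
          then show ?thesis unfolding if_not_P[OF False] by blast
        qed
      qed
      finally show ?thesis by (auto simp: measure_pmf_single pmf_subset_pmf[OF fS cXS] d_def)
    qed
    have "pmf ?N Y = (\<Sum>X\<in>?A. pmf (map_pmf (\<lambda>Z. (X - S) \<union> Z) (subset_pmf S (card (X \<inter> S)))) Y) / real (card ?A)"
      unfolding subset_pmf_def[of V s]
      using subsets_finite_nonempty[OF assms(1,3)] by (subst pmf_bind_pmf_of_set) auto
    also have "(\<Sum>X\<in>?A. pmf (map_pmf (\<lambda>Z. (X - S) \<union> Z) (subset_pmf S (card (X \<inter> S)))) Y)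
        = (\<Sum>X\<in>?A. if X - S = Y - S \<and> card (X \<inter> S) = ?w then d else 0)"
      using inner by (intro sum.cong refl) blast
    also have "\<dots> = (\<Sum>X | X \<in> ?A \<and> (X - S = Y - S \<and> card (X \<inter> S) = ?w). d)"
      by (rule sum.inter_filter[symmetric, OF subsets_finite_nonempty(1)[OF assms(1,3)]])
    also have "\<dots> = real (card {X. X \<in> ?A \<and> (X - S = Y - S \<and> card (X \<inter> S) = ?w)}) * d" by simp
    also have "card {X. X \<in> ?A \<and> (X - S = Y - S \<and> card (X \<inter> S) = ?w)} = card {Z. Z \<subseteq> S \<and> card Z = ?w}"
    proof (rule bij_betw_same_card)
      show "bij_betw (\<lambda>X. X \<inter> S) {X. X \<in> ?A \<and> (X - S = Y - S \<and> card (X \<inter> S) = ?w)} {Z. Z \<subseteq> S \<and> card Z = ?w}"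
      proof (rule bij_betw_byWitness[where f' = "\<lambda>Z. (Y - S) \<union> Z"])
        show "(\<lambda>Z. (Y - S) \<union> Z) ` {Z. Z \<subseteq> S \<and> card Z = ?w}
            \<subseteq> {X. X \<in> ?A \<and> (X - S = Y - S \<and> card (X \<inter> S) = ?w)}"
        proof (rule image_subsetI)
          fix Z assume Z: "Z \<in> {Z. Z \<subseteq> S \<and> card Z = ?w}"
          then have fZ: "finite Z" using fS finite_subset by blast
          have "card ((Y - S) \<union> Z) = card (Y - S) + card Z" using Z fX[OF Y] fZ by (intro card_Un_disjoint) auto
          also have "\<dots> = card Y" using Z fX[OF Y] by (simp add: card_Int_Diff[of Y S])
          finally have "(Y - S) \<union> Z \<in> ?A" using Y Z assms(2) by auto
          moreover have "((Y - S) \<union> Z) \<inter> S = Z" "((Y - S) \<union> Z) - S = Y - S" using Z by auto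
          ultimately show "(Y - S) \<union> Z \<in> {X. X \<in> ?A \<and> (X - S = Y - S \<and> card (X \<inter> S) = ?w)}"
            using Z by auto
        qed
      qed auto
    qed
    also have "\<dots> = card S choose ?w" using fS by (simp add: n_subsets)
    also have "real (card S choose ?w) * d = 1"
    proof -
      have "(card S choose ?w) > 0" using cXS by simp
      then show ?thesis by (simp add: d_def)
    qed
    finally show "pmf ?N Y = 1 / real (card ?A)" .
  qed
  then show ?thesis by (simp add: subset_pmf_def)
qed

lemma subset_pmf_complement:
  assumes "finite V" "s \<le> card V"
  shows "map_pmf (\<lambda>X. V - X) (subset_pmf V s) = subset_pmf V (card V - s)"
proof -
  let ?A = "{X. X \<subseteq> V \<and> card X = s}"
  have "inj_on (\<lambda>X. V - X) ?A" by (auto simp: inj_on_def)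
  then have "map_pmf (\<lambda>X. V - X) (subset_pmf V s) = pmf_of_set ((\<lambda>X. V - X) ` ?A)"
    unfolding subset_pmf_def using subsets_finite_nonempty[OF assms] by (intro map_pmf_of_set_inj) auto
  also have "(\<lambda>X. V - X) ` ?A = {X. X \<subseteq> V \<and> card X = card V - s}"
  proof (intro equalityI image_subsetI)
    fix X assume X: "X \<in> ?A"
    then have "finite X" using assms finite_subset by blast
    then show "V - X \<in> {X. X \<subseteq> V \<and> card X = card V - s}" using X by (auto simp: card_Diff_subset)
  next
    show "{X. X \<subseteq> V \<and> card X = card V - s} \<subseteq> (\<lambda>X. V - X) ` ?A"
    proof
      fix X assume X: "X \<in> {X. X \<subseteq> V \<and> card X = card V - s}"
      then have "finite X" using assms finite_subset by blast
      then have "V - X \<in> ?A" using X assms by (auto simp: card_Diff_subset)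
      moreover have "X = V - (V - X)" using X by auto
      ultimately show "X \<in> (\<lambda>X. V - X) ` ?A" by blast
    qed
  qed
  finally show ?thesis by (simp add: subset_pmf_def)
qed

text \<open>A set that misses at most \<open>d\<close> points of \<open>S\<close> contains \<open>S - D\<close> for some \<open>d\<close>-element set \<open>D\<close>, and there are at most \<open>|S|\<^sup>d\<close> choices for \<open>D\<close>. The bound is crude,
  but \<open>d\<close> will be much smaller than \<open>|S|\<close>.\<close>
lemma prob_large_intersection:
  assumes "finite V" "S \<subseteq> V" "s \<le> card V" "d \<le> card S"
  shows "measure_pmf.prob (subset_pmf V s) {X. card S \<le> card (X \<inter> S) + d}
    \<le> real (card S) ^ d * (real s / real (card V)) ^ (card S - d)"
proof -
  have fS: "finite S" using assms finite_subset by blast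
  let ?Ds = "{D. D \<subseteq> S \<and> card D = d}"
  have fD: "finite ?Ds" using fS by simp
  have "measure_pmf.prob (subset_pmf V s) {X. card S \<le> card (X \<inter> S) + d}
      \<le> measure_pmf.prob (subset_pmf V s) (\<Union>D\<in>?Ds. {X. S - D \<subseteq> X})"
  proof (rule measure_pmf.finite_measure_mono)
    show "{X. card S \<le> card (X \<inter> S) + d} \<subseteq> (\<Union>D\<in>?Ds. {X. S - D \<subseteq> X})"
    proof
      fix X assume "X \<in> {X. card S \<le> card (X \<inter> S) + d}"
      moreover have "card S = card (S \<inter> X) + card (S - X)" using fS by (rule card_Int_Diff)
      ultimately have "card (S - X) \<le> d" by (simp add: Int_commute)
      then obtain D where "S - X \<subseteq> D" "D \<subseteq> S" "card D = d"
        using exists_subset_between[of "S - X" d S] assms(4) fS by auto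
      then show "X \<in> (\<Union>D\<in>?Ds. {X. S - D \<subseteq> X})" by auto
    qed
  qed simp
  also have "\<dots> \<le> (\<Sum>D\<in>?Ds. measure_pmf.prob (subset_pmf V s) {X. S - D \<subseteq> X})"
    using fD by (intro measure_pmf.finite_measure_subadditive_finite) auto
  also have "\<dots> \<le> (\<Sum>D\<in>?Ds. (real s / real (card V)) ^ (card S - d))"
  proof (rule sum_mono)
    fix D assume D: "D \<in> ?Ds"
    then have "finite D" using fS finite_subset by blast
    then have "card (S - D) = card S - d" using D by (simp add: card_Diff_subset)
    then show "measure_pmf.prob (subset_pmf V s) {X. S - D \<subseteq> X} \<le> (real s / real (card V)) ^ (card S - d)"
      using prob_superset[OF assms(1,3), of "S - D"] assms(2) by auto
  qed
  also have "\<dots> = real (card S choose d) * (real s / real (card V)) ^ (card S - d)"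
    by (simp add: n_subsets[OF fS])
  also have "\<dots> \<le> real (card S) ^ d * (real s / real (card V)) ^ (card S - d)"
  proof (rule mult_right_mono)
    have "card S choose d \<le> card S ^ d" using assms(4) by (rule binomial_le_pow)
    then show "real (card S choose d) \<le> real (card S) ^ d" by (metis of_nat_le_iff of_nat_power)
  qed simp
  finally show ?thesis .
qed

lemma prob_small_intersection:
  assumes "finite V" "S \<subseteq> V" "s \<le> card V" "d \<le> card S"
  shows "measure_pmf.prob (subset_pmf V s) {X. card (X \<inter> S) \<le> d}
    \<le> real (card S) ^ d * (real (card V - s) / real (card V)) ^ (card S - d)"
proof -
  have fS: "finite S" using assms finite_subset by blast
  have eq: "card (X \<inter> S) + card ((V - X) \<inter> S) = card S" for X
  proof -
    have "(V - X) \<inter> S = S - X" using assms(2) by auto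
    then show ?thesis using card_Int_Diff[OF fS, of X] by (simp add: Int_commute)
  qed
  have "measure_pmf.prob (subset_pmf V s) {X. card (X \<inter> S) \<le> d}
      = measure_pmf.prob (map_pmf (\<lambda>X. V - X) (subset_pmf V s)) {X. card S \<le> card (X \<inter> S) + d}"
  proof -
    have "(\<lambda>X. V - X) -` {X. card S \<le> card (X \<inter> S) + d} = {X. card (X \<inter> S) \<le> d}"
      using eq by (auto simp: algebra_simps) (metis add_le_cancel_right add.commute)+
    then show ?thesis by simp
  qed
  also have "\<dots> \<le> real (card S) ^ d * (real (card V - s) / real (card V)) ^ (card S - d)"
    unfolding subset_pmf_complement[OF assms(1,3)]
    using prob_large_intersection[OF assms(1,2) _ assms(4), of "card V - s"] by simp
  finally show ?thesis .
qed

text \<open>A uniform bound for all slices of \<open>S\<close> whose size is not within \<open>d\<close> of an extreme value transfers to the random subset of \<open>V\<close>.\<close>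
lemma prob_sum_restrict:
  fixes u :: "nat \<Rightarrow> real"
  assumes "finite V" "S \<subseteq> V" "s \<le> card V" "d \<le> card S" "\<rho> \<ge> 0"
    and "\<And>w r. d < w \<Longrightarrow> w + d < card S \<Longrightarrow> measure_pmf.prob (slice u S w) {r} \<le> \<rho>"
  shows "measure_pmf.prob (subset_pmf V s) {X. sum u X = r} \<le> \<rho>
    + real (card S) ^ d * ((real (card V - s) / real (card V)) ^ (card S - d) + (real s / real (card V)) ^ (card S - d))"
proof -
  have fS: "finite S" using assms finite_subset by blast
  let ?T1 = "{X. card (X \<inter> S) \<le> d}" and ?T2 = "{X. card S \<le> card (X \<inter> S) + d}"
  have fin: "finite (set_pmf (subset_pmf V s))" using assms by (simp add: set_subset_pmf)
  have "measure_pmf.prob (subset_pmf V s) {X. sum u X = r}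
      = measure_pmf.expectation (subset_pmf V s) (\<lambda>X. measure_pmf.prob
         (map_pmf (\<lambda>Z. (X - S) \<union> Z) (subset_pmf S (card (X \<inter> S)))) {X. sum u X = r})"
    by (subst subset_pmf_resample[OF assms(1-3)]) (rule measure_bind_pmf)
  also have "\<dots> \<le> measure_pmf.expectation (subset_pmf V s) (\<lambda>X. \<rho> + (indicator ?T1 X + indicator ?T2 X))"
  proof (rule integral_mono_AE)
    show "AE X in measure_pmf (subset_pmf V s). measure_pmf.prob
         (map_pmf (\<lambda>Z. (X - S) \<union> Z) (subset_pmf S (card (X \<inter> S)))) {X. sum u X = r} \<le> \<rho> + (indicator ?T1 X + indicator ?T2 X)"
    proof (rule AE_pmfI)
      fix X assume "X \<in> set_pmf (subset_pmf V s)"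
      then have "X \<subseteq> V" using set_subset_pmf[OF assms(1,3)] by blast
      then have fX: "finite X" using assms(1) finite_subset by blast
      let ?P = "measure_pmf.prob (map_pmf (\<lambda>Z. (X - S) \<union> Z) (subset_pmf S (card (X \<inter> S)))) {X. sum u X = r}"
      show "?P \<le> \<rho> + (indicator ?T1 X + indicator ?T2 X)"
      proof (cases "X \<in> ?T1 \<or> X \<in> ?T2")
        case True
        have "?P \<le> 1" by (rule measure_pmf.prob_le_1)
        also have "1 \<le> \<rho> + (indicator ?T1 X + indicator ?T2 X)" using True assms(5) by (auto simp: indicator_def)
        finally show ?thesis .
      next
        case False
        have wS: "card (X \<inter> S) \<le> card S" using fS by (intro card_mono) auto
        have "?P = measure_pmf.prob (subset_pmf S (card (X \<inter> S))) {Z. sum u ((X - S) \<union> Z) = r}"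
          by (simp add: vimage_def)
        also have "\<dots> = measure_pmf.prob (subset_pmf S (card (X \<inter> S))) {Z. sum u Z = r - sum u (X - S)}"
        proof (rule measure_pmf.finite_measure_eq_AE)
          show "AE Z in measure_pmf (subset_pmf S (card (X \<inter> S))).
              (Z \<in> {Z. sum u ((X - S) \<union> Z) = r}) = (Z \<in> {Z. sum u Z = r - sum u (X - S)})"
          proof (rule AE_pmfI)
            fix Z assume "Z \<in> set_pmf (subset_pmf S (card (X \<inter> S)))"
            then have "Z \<subseteq> S" using set_subset_pmf[OF fS wS] by blast
            moreover from this have "finite Z" using fS finite_subset by blast
            ultimately have "sum u ((X - S) \<union> Z) = sum u (X - S) + sum u Z"
              using fX by (intro sum.union_disjoint) auto
            then show "(Z \<in> {Z. sum u ((X - S) \<union> Z) = r}) = (Z \<in> {Z. sum u Z = r - sum u (X - S)})" by auto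
          qed
        qed simp_all
        also have "\<dots> = measure_pmf.prob (slice u S (card (X \<inter> S))) {r - sum u (X - S)}"
          by (simp add: slice_def vimage_def)
        also have "\<dots> \<le> \<rho>" using False by (intro assms(6)) auto
        finally show ?thesis by (simp add: add_increasing2)
      qed
    qed
  qed (intro integrable_measure_pmf_finite fin)+
  also have "\<dots> = \<rho> + (measure_pmf.prob (subset_pmf V s) ?T1 + measure_pmf.prob (subset_pmf V s) ?T2)"
  proof -
    note i = integrable_measure_pmf_finite[OF fin]
    have "measure_pmf.expectation (subset_pmf V s) (\<lambda>X. \<rho> + (indicator ?T1 X + indicator ?T2 X))
      = measure_pmf.expectation (subset_pmf V s) (\<lambda>X. \<rho>) + measure_pmf.expectation (subset_pmf V s) (\<lambda>X. indicator ?T1 X + indicator ?T2 X)"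
      by (rule Bochner_Integration.integral_add[OF i i])
    also have "measure_pmf.expectation (subset_pmf V s) (\<lambda>X. indicator ?T1 X + indicator ?T2 X :: real)
      = measure_pmf.expectation (subset_pmf V s) (indicator ?T1) + measure_pmf.expectation (subset_pmf V s) (indicator ?T2)"
      by (rule Bochner_Integration.integral_add[OF i i])
    finally show ?thesis by simp
  qed
  also have "\<dots> \<le> \<rho> + real (card S) ^ d * ((real (card V - s) / real (card V)) ^ (card S - d) + (real s / real (card V)) ^ (card S - d))"
    using prob_small_intersection[OF assms(1-4)] prob_large_intersection[OF assms(1-4)]
    by (simp add: distrib_left)
  finally show ?thesis .
qed

section \<open>From complex to real coordinates\<close>

definition proj :: "real \<Rightarrow> complex \<Rightarrow> real" where
  "proj c z = Re z + c * Im z"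

text \<open>Each nonzero number in \<open>F\<close> excludes at most one value of \<open>c\<close>.\<close>
lemma generic_proj:
  assumes "finite F"
  shows "\<exists>c. \<forall>z\<in>F. proj c z = 0 \<longrightarrow> z = 0"
proof -
  have "finite ((\<lambda>z. - Re z / Im z) ` F)" using assms by simp
  then obtain c where c: "c \<notin> (\<lambda>z. - Re z / Im z) ` F"
    using ex_new_if_finite[OF infinite_UNIV_char_0] by blast
  have "z = 0" if "z \<in> F" "proj c z = 0" for z
  proof (cases "Im z = 0")
    case True
    then show ?thesis using that by (simp add: proj_def complex_eq_iff)
  next
    case False
    then have "c = - Re z / Im z" using that by (simp add: proj_def field_simps)
    then show ?thesis using c that by auto
  qed
  then show ?thesis by blast
qed

lemma proj_sum: "proj c (sum v X) = sum (\<lambda>i. proj c (v i)) X"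
  by (simp add: proj_def sum.distrib sum_distrib_left)

lemma proj_drift: "proj c (drift v ps) = drift (\<lambda>i. proj c (v i)) ps"
  by (induction ps) (simp_all add: drift_def proj_def algebra_simps)

lemma exists_generic_projection:
  fixes v :: "nat \<Rightarrow> complex"
  assumes "finite V"
  shows "\<exists>c. (\<forall>k'\<le>k. \<forall>ps\<in>pairings k' V. drift (\<lambda>i. proj c (v i)) ps = 0 \<longleftrightarrow> drift v ps = 0)
    \<and> (\<forall>i\<in>V. \<forall>j\<in>V. proj c (v i) = proj c (v j) \<longleftrightarrow> v i = v j)"
proof -
  let ?F = "(\<Union>k'\<le>k. drift v ` pairings k' V) \<union> (\<lambda>(i, j). v i - v j) ` (V \<times> V)"
  have "finite ?F" using assms by (auto intro: finite_pairings)
  then obtain c where c: "\<forall>z\<in>?F. proj c z = 0 \<longrightarrow> z = 0" using generic_proj by blast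
  have 1: "drift (\<lambda>i. proj c (v i)) ps = 0 \<longleftrightarrow> drift v ps = 0" if "k' \<le> k" "ps \<in> pairings k' V" for k' ps
  proof
    assume "drift (\<lambda>i. proj c (v i)) ps = 0"
    then have "proj c (drift v ps) = 0" by (simp add: proj_drift)
    then show "drift v ps = 0" using c that by blast
  next
    assume "drift v ps = 0"
    then show "drift (\<lambda>i. proj c (v i)) ps = 0" by (simp add: proj_drift[symmetric]) (simp add: proj_def)
  qed
  have 2: "proj c (v i) = proj c (v j) \<longleftrightarrow> v i = v j" if "i \<in> V" "j \<in> V" for i j
  proof
    assume "proj c (v i) = proj c (v j)"
    then have "proj c (v i - v j) = 0" by (simp add: proj_def algebra_simps)
    moreover have "v i - v j \<in> ?F" using that by force
    ultimately have "v i - v j = 0" using c by blast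
    then show "v i = v j" by simp
  qed simp
  show ?thesis using 1 2 by blast
qed

text \<open>The probability, for a random \<open>s\<close>-subset of \<open>n\<close> points, that its trace on a given set of \<open>j\<close> points has at most \<open>d\<close> or at
  least \<open>j - d\<close> elements is at most this number.\<close>
definition tail_bound :: "nat \<Rightarrow> nat \<Rightarrow> nat \<Rightarrow> nat \<Rightarrow> real" where
  "tail_bound n s j d = real j ^ d * ((real (n - s) / real n) ^ (j - d) + (real s / real n) ^ (j - d))"

lemma row_bound_relations:
  fixes v :: "nat \<Rightarrow> complex"
  assumes "finite V" "S \<subseteq> V" "s \<le> card V" "L > 0" "k > 0" "c > 0" "a > 0"
    and "real (2 * c) * 16 ^ k * rel_density k L (card S) S v 0 \<le> 3 / 4"
    and "64 * (a * k * L) \<le> card S"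
  shows "measure_pmf.prob (subset_pmf V s) {X. sum v X = r}
    \<le> 2 / (real c * sqrt (2 * real a + 1)) + (1 / 2) ^ a + tail_bound (card V) s (card S) (32 * (a * k * L))"
proof -
  obtain \<theta> where \<theta>: "\<forall>k'\<le>k. \<forall>ps\<in>pairings k' V. drift (\<lambda>i. proj \<theta> (v i)) ps = 0 \<longleftrightarrow> drift v ps = 0"
    using exists_generic_projection[OF assms(1)] by blast
  let ?u = "\<lambda>i. proj \<theta> (v i)"
  have "pairings k S \<subseteq> pairings k V" using assms(2) by (rule pairings_mono)
  then have "rel_density k L (card S) S ?u 0 = rel_density k L (card S) S v 0"
    unfolding rel_density_def using \<theta> by (intro sum.cong refl) auto
  then have d: "real (2 * c) * 16 ^ k * rel_density k L (card S) S ?u 0 \<le> 3 / 4" using assms(8) by simp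
  have fS: "finite S" using assms finite_subset by blast
  have "measure_pmf.prob (subset_pmf V s) {X. sum v X = r} \<le> measure_pmf.prob (subset_pmf V s) {X. sum ?u X = proj \<theta> r}"
    by (intro measure_pmf.finite_measure_mono) (auto simp: proj_sum[symmetric])
  also have "\<dots> \<le> 2 / (real c * sqrt (2 * real a + 1)) + (1 / 2) ^ a
    + tail_bound (card V) s (card S) (32 * (a * k * L))"
    unfolding tail_bound_def
  proof (rule prob_sum_restrict[OF assms(1-3)])
    fix w r assume "32 * (a * k * L) < w" "w + 32 * (a * k * L) < card S"
    then show "measure_pmf.prob (slice ?u S w) {r} \<le> 2 / (real c * sqrt (2 * real a + 1)) + (1 / 2) ^ a"
      by (intro slice_bound_relations[OF fS assms(4-7) d assms(9)]) auto
  qed (use assms(9) in \<open>auto intro!: add_nonneg_nonneg divide_nonneg_nonneg\<close>)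
  finally show ?thesis .
qed

lemma row_bound_pairs:
  fixes v :: "nat \<Rightarrow> complex"
  assumes "finite V" "S \<subseteq> V" "s \<le> card V" "a > 0"
    and "\<And>x. 2 * card {i\<in>S. v i = x} \<le> card S" "96 * a \<le> card S"
  shows "measure_pmf.prob (subset_pmf V s) {X. sum v X = r}
    \<le> 2 / sqrt (2 * real a + 1) + (1 / 2) ^ a + tail_bound (card V) s (card S) (32 * a)"
proof -
  obtain \<theta> where \<theta>: "\<forall>i\<in>V. \<forall>j\<in>V. proj \<theta> (v i) = proj \<theta> (v j) \<longleftrightarrow> v i = v j"
    using exists_generic_projection[OF assms(1), of 0 v] by (elim exE conjE) (rule that)
  let ?u = "\<lambda>i. proj \<theta> (v i)"
  have fS: "finite S" using assms finite_subset by blast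
  have m: "2 * card {i\<in>S. ?u i = x} \<le> card S" for x
  proof (cases "\<exists>i\<in>S. ?u i = x")
    case True
    then obtain i0 where i0: "i0 \<in> S" "?u i0 = x" by blast
    have "?u i = x \<longleftrightarrow> v i = v i0" if "i \<in> S" for i
      using \<theta>[rule_format, of i i0] i0 assms(2) that by auto
    then have "{i\<in>S. ?u i = x} = {i\<in>S. v i = v i0}" by (intro Collect_cong) auto
    then show ?thesis using assms(5) by simp
  next
    case False
    then have "{i\<in>S. ?u i = x} = {}" by blast
    then show ?thesis by (simp only: card.empty)
  qed
  have "measure_pmf.prob (subset_pmf V s) {X. sum v X = r} \<le> measure_pmf.prob (subset_pmf V s) {X. sum ?u X = proj \<theta> r}"
    by (intro measure_pmf.finite_measure_mono) (auto simp: proj_sum[symmetric])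
  also have "\<dots> \<le> 2 / sqrt (2 * real a + 1) + (1 / 2) ^ a + tail_bound (card V) s (card S) (32 * a)"
    unfolding tail_bound_def
  proof (rule prob_sum_restrict[OF assms(1-3)])
    fix w r assume "32 * a < w" "w + 32 * a < card S"
    then show "measure_pmf.prob (slice ?u S w) {r} \<le> 2 / sqrt (2 * real a + 1) + (1 / 2) ^ a"
      by (intro slice_bound_pairs[OF fS assms(4) m assms(6)]) auto
  qed (use assms(6) in \<open>auto intro!: add_nonneg_nonneg divide_nonneg_nonneg\<close>)
  finally show ?thesis .
qed

section \<open>Random equations on a linear space of small dimension\<close>

definition linear_set :: "(nat \<Rightarrow> complex) set \<Rightarrow> bool" where
  "linear_set W \<longleftrightarrow> (\<lambda>_. 0) \<in> W \<and> (\<forall>v\<in>W. \<forall>w\<in>W. \<forall>c. (\<lambda>i. v i + c * w i) \<in> W)"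

text \<open>A linear space with this property has dimension at most \<open>card D\<close>; the set \<open>D\<close> replaces the dimension in the arguments below.\<close>
definition determined :: "nat set \<Rightarrow> (nat \<Rightarrow> complex) set \<Rightarrow> bool" where
  "determined D W \<longleftrightarrow> (\<forall>v\<in>W. (\<forall>i\<in>D. v i = 0) \<longrightarrow> v = (\<lambda>_. 0))"

definition lin_fun :: "((nat \<Rightarrow> complex) \<Rightarrow> complex) \<Rightarrow> bool" where
  "lin_fun \<phi> \<longleftrightarrow> (\<forall>v w c. \<phi> (\<lambda>i. v i + c * w i) = \<phi> v + c * \<phi> w)"

lemma lin_fun_0: "lin_fun \<phi> \<Longrightarrow> \<phi> (\<lambda>_. 0) = 0"
proof -
  assume "lin_fun \<phi>"
  then have "\<phi> (\<lambda>i. v i + c * w i) = \<phi> v + c * \<phi> w" for v w c unfolding lin_fun_def by blast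
  from this[of "\<lambda>_. 0" "-1" "\<lambda>_. 0"] have "\<phi> (\<lambda>_. 0) = \<phi> (\<lambda>_. 0) + (-1) * \<phi> (\<lambda>_. 0)" by simp
  then show ?thesis by simp
qed

lemma linear_set_kernel:
  assumes "linear_set W" "lin_fun \<phi>"
  shows "linear_set {v\<in>W. \<phi> v = 0}"
  using assms lin_fun_0[OF assms(2)] unfolding linear_set_def lin_fun_def by simp

text \<open>A linear functional that does not vanish on the space cuts its dimension by one. If no coordinate of \<open>D\<close> could be
  dropped, there would be vectors of the kernel dual to the coordinates in \<open>D\<close>, and these would span the whole space.\<close>
lemma determined_kernel:
  assumes W: "linear_set W" "determined D W" and "finite D" and \<phi>: "lin_fun \<phi>" and u: "u \<in> W" "\<phi> u \<noteq> 0"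
  shows "\<exists>i\<in>D. determined (D - {i}) {v\<in>W. \<phi> v = 0}"
proof (rule ccontr)
  assume "\<not> (\<exists>i\<in>D. determined (D - {i}) {v\<in>W. \<phi> v = 0})"
  then have "\<forall>i\<in>D. \<exists>w. w \<in> W \<and> \<phi> w = 0 \<and> (\<forall>j\<in>D - {i}. w j = 0) \<and> w \<noteq> (\<lambda>_. 0)"
    unfolding determined_def by blast
  then obtain w where w: "\<And>i. i \<in> D \<Longrightarrow> w i \<in> W" "\<And>i. i \<in> D \<Longrightarrow> \<phi> (w i) = 0"
      "\<And>i j. i \<in> D \<Longrightarrow> j \<in> D \<Longrightarrow> j \<noteq> i \<Longrightarrow> w i j = 0" "\<And>i. i \<in> D \<Longrightarrow> w i \<noteq> (\<lambda>_. 0)"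
    by (auto dest!: bchoice)
  have wi: "w i i \<noteq> 0" if "i \<in> D" for i
  proof
    assume "w i i = 0"
    then have "\<forall>j\<in>D. w i j = 0" using w(3)[OF that] by metis
    then show False using W(2) w(1,4)[OF that] unfolding determined_def by blast
  qed
  \<comment> \<open>The entries of \<open>u\<close> in \<open>D\<close> are cleared one by one with the vectors \<open>w i\<close>, without changing its value under \<open>\<phi>\<close>.\<close>
  have "\<exists>v\<in>W. \<phi> v = \<phi> u \<and> (\<forall>i\<in>E. v i = 0)" if "finite E" "E \<subseteq> D" for E
    using that
  proof (induction E rule: finite_induct)
    case empty
    then show ?case using u by auto
  next
    case (insert i E)
    then obtain v where v: "v \<in> W" "\<phi> v = \<phi> u" "\<forall>j\<in>E. v j = 0" by auto
    have iD: "i \<in> D" using insert by auto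
    define c where "c = - v i / w i i"
    let ?v = "\<lambda>j. v j + c * w i j"
    have "?v \<in> W" using W(1) v(1) w(1)[OF iD] unfolding linear_set_def by blast
    moreover have "\<phi> ?v = \<phi> u" using \<phi> v(2) w(2)[OF iD] unfolding lin_fun_def by simp
    moreover have "?v j = 0" if "j \<in> insert i E" for j
    proof (cases "j = i")
      case True
      then show ?thesis using wi[OF iD] by (simp add: c_def)
    next
      case False
      then have "j \<in> D" "v j = 0" using that insert v by auto
      then show ?thesis using w(3)[OF iD _ False] by simp
    qed
    ultimately show ?case by blast
  qed
  then obtain v where v: "v \<in> W" "\<phi> v = \<phi> u" "\<forall>i\<in>D. v i = 0" using assms(3) by blast
  then have "v = (\<lambda>_. 0)" using W(2) unfolding determined_def by blast
  then show False using v(2) u(2) lin_fun_0[OF \<phi>] by simp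
qed

lemma prob_Pi_pmf_insert:
  assumes "finite I" "x \<notin> I"
  shows "measure_pmf.prob (Pi_pmf (insert x I) d (\<lambda>_. p)) E
    = measure_pmf.expectation p (\<lambda>y. measure_pmf.prob (Pi_pmf I d (\<lambda>_. p)) {f. f(x := y) \<in> E})"
proof -
  have "Pi_pmf (insert x I) d (\<lambda>_. p) = bind_pmf p (\<lambda>y. map_pmf (\<lambda>f. f(x := y)) (Pi_pmf I d (\<lambda>_. p)))"
    by (simp add: Pi_pmf_insert[OF assms] pair_pmf_def map_bind_pmf map_pmf_def bind_assoc_pmf bind_return_pmf)
  then show ?thesis by (simp add: measure_bind_pmf vimage_def)
qed

text \<open>Expose the rows one by one. If the current space \<open>W\<close> meets \<open>B\<close>, fix a vector of the intersection: a row annihilates it with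
  probability at most \<open>\<rho>\<close>, and otherwise the row is nonzero on \<open>W\<close> and cuts its dimension. This gives the
  recursion \<open>p(I + 1, D) \<le> \<rho> p(I, D) + p(I, D - 1)\<close>, which the right-hand side satisfies.\<close>
lemma kernel_prob:
  fixes \<phi> :: "nat \<Rightarrow> 'r \<Rightarrow> (nat \<Rightarrow> complex) \<Rightarrow> complex"
  assumes "finite I" "finite D" "linear_set W" "determined D W" "finite (set_pmf p)"
    and \<phi>: "\<And>i r. lin_fun (\<phi> i r)" and "(\<lambda>_. 0) \<notin> B"
    and \<rho>: "\<And>v i. v \<in> B \<Longrightarrow> i \<in> I \<Longrightarrow> measure_pmf.prob p {r. \<phi> i r v = 0} \<le> \<rho>" "0 < \<rho>" "\<rho> \<le> 1"
  shows "measure_pmf.prob (Pi_pmf I d (\<lambda>_. p)) {f. \<exists>v\<in>W \<inter> B. \<forall>i\<in>I. \<phi> i (f i) v = 0}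
    \<le> real (card I + 1) ^ card D * \<rho> ^ card I / \<rho> ^ card D"
  using assms(1-4) \<rho>(1)
proof (induction I arbitrary: W D rule: finite_induct)
  case empty
  have "measure_pmf.prob (Pi_pmf {} d (\<lambda>_. p)) {f. \<exists>v\<in>W \<inter> B. \<forall>i\<in>{}. \<phi> i (f i) v = 0} \<le> 1"
    by (rule measure_pmf.prob_le_1)
  also have "1 \<le> real (card ({} :: nat set) + 1) ^ card D * \<rho> ^ card ({} :: nat set) / \<rho> ^ card D"
    using \<rho>(2,3) by (simp add: power_le_one)
  finally show ?case .
next
  case (insert x I)
  let ?P = "Pi_pmf I d (\<lambda>_. p)"
  show ?case
  proof (cases "W \<inter> B = {}")
    case True
    then show ?thesis using \<rho>(2) by (simp add: divide_nonneg_nonneg)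
  next
    case False
    then obtain v0 where v0: "v0 \<in> W" "v0 \<in> B" by auto
    have "D \<noteq> {}"
    proof
      assume "D = {}"
      then have "v0 = (\<lambda>_. 0)" using insert.prems(3) v0(1) unfolding determined_def by blast
      then show False using v0(2) assms(7) by blast
    qed
    then obtain m where m: "card D = Suc m" using insert.prems(1) by (metis card_0_eq not0_implies_Suc)
    define N where "N = card I"
    define A where "A = real (N + 1) ^ Suc m * \<rho> ^ N / \<rho> ^ Suc m"
    define C where "C = real (N + 1) ^ m * \<rho> ^ N / \<rho> ^ m"
    have AC: "A \<ge> 0" "C \<ge> 0" using \<rho>(2) by (simp_all add: A_def C_def)
    have IH: "measure_pmf.prob ?P {f. \<exists>v\<in>W' \<inter> B. \<forall>i\<in>I. \<phi> i (f i) v = 0}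
        \<le> real (N + 1) ^ card D' * \<rho> ^ N / \<rho> ^ card D'"
      if "finite D'" "linear_set W'" "determined D' W'" for W' D'
      unfolding N_def by (rule insert.IH[OF that]) (use insert.prems in auto)
    let ?E = "{f. \<exists>v\<in>W \<inter> B. \<forall>i\<in>insert x I. \<phi> i (f i) v = 0}"
    have "measure_pmf.prob (Pi_pmf (insert x I) d (\<lambda>_. p)) ?E
        = measure_pmf.expectation p (\<lambda>y. measure_pmf.prob ?P {f. f(x := y) \<in> ?E})"
      by (rule prob_Pi_pmf_insert[OF insert.hyps])
    also have "\<dots> \<le> measure_pmf.expectation p (\<lambda>y. C + A * indicator {r. \<phi> x r v0 = 0} y)"
    proof (rule integral_mono)
      fix y
      show "measure_pmf.prob ?P {f. f(x := y) \<in> ?E} \<le> C + A * indicator {r. \<phi> x r v0 = 0} y"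
      proof (cases "\<phi> x y v0 = 0")
        case True
        have "measure_pmf.prob ?P {f. f(x := y) \<in> ?E} \<le> measure_pmf.prob ?P {f. \<exists>v\<in>W \<inter> B. \<forall>i\<in>I. \<phi> i (f i) v = 0}"
        proof (intro measure_pmf.finite_measure_mono subsetI)
          fix f assume "f \<in> {f. f(x := y) \<in> ?E}"
          then obtain v where v: "v \<in> W \<inter> B" "\<forall>i\<in>insert x I. \<phi> i ((f(x := y)) i) v = 0" by blast
          have "\<phi> i (f i) v = 0" if "i \<in> I" for i using v(2)[rule_format, of i] that insert.hyps(2) by (auto split: if_splits)
          then show "f \<in> {f. \<exists>v\<in>W \<inter> B. \<forall>i\<in>I. \<phi> i (f i) v = 0}" using v(1) by blast
        qed simp
        also have "\<dots> \<le> A" using IH[OF insert.prems(1-3)] by (simp only: m A_def)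
        finally show ?thesis using True AC by simp
      next
        case False
        obtain i where i: "i \<in> D" "determined (D - {i}) {v\<in>W. \<phi> x y v = 0}"
          using determined_kernel[OF insert.prems(2,3,1) \<phi> v0(1) False] by blast
        have ci: "card (D - {i}) = m" using i(1) m insert.prems(1) by simp
        have "measure_pmf.prob ?P {f. f(x := y) \<in> ?E}
            \<le> measure_pmf.prob ?P {f. \<exists>v\<in>{v\<in>W. \<phi> x y v = 0} \<inter> B. \<forall>i\<in>I. \<phi> i (f i) v = 0}"
        proof (intro measure_pmf.finite_measure_mono subsetI)
          fix f assume "f \<in> {f. f(x := y) \<in> ?E}"
          then obtain v where v: "v \<in> W \<inter> B" "\<forall>i\<in>insert x I. \<phi> i ((f(x := y)) i) v = 0" by blast
          have "\<phi> i (f i) v = 0" if "i \<in> I" for i using v(2)[rule_format, of i] that insert.hyps(2) by (auto split: if_splits)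
          moreover have "\<phi> x y v = 0" using v(2)[rule_format, of x] by simp
          ultimately show "f \<in> {f. \<exists>v\<in>{v\<in>W. \<phi> x y v = 0} \<inter> B. \<forall>i\<in>I. \<phi> i (f i) v = 0}" using v(1) by blast
        qed simp
        also have "\<dots> \<le> C"
          using IH[OF _ linear_set_kernel[OF insert.prems(2) \<phi>] i(2)] insert.prems(1) ci by (simp add: C_def)
        finally show ?thesis using False by simp
      qed
    qed (intro integrable_measure_pmf_finite assms(5))+
    also have "\<dots> = C + A * measure_pmf.prob p {r. \<phi> x r v0 = 0}"
      by (subst Bochner_Integration.integral_add) (auto intro!: integrable_measure_pmf_finite assms(5))
    also have "\<dots> \<le> C + A * \<rho>"
      using insert.prems(4)[OF v0(2), of x] AC by (intro add_left_mono mult_left_mono) auto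
    also have "\<dots> = \<rho> ^ N / \<rho> ^ m * (real (N + 1) ^ m + real (N + 1) ^ Suc m)"
      using \<rho>(2) by (simp add: A_def C_def field_simps)
    also have "\<dots> \<le> \<rho> ^ N / \<rho> ^ m * real (N + 2) ^ Suc m"
    proof (rule mult_left_mono)
      have "real (N + 1) ^ m + real (N + 1) ^ Suc m = real (N + 2) * real (N + 1) ^ m" by (simp add: algebra_simps)
      also have "\<dots> \<le> real (N + 2) * real (N + 2) ^ m" by (intro mult_left_mono power_mono) auto
      finally show "real (N + 1) ^ m + real (N + 1) ^ Suc m \<le> real (N + 2) ^ Suc m" by simp
    qed (use \<rho>(2) in simp)
    also have "\<dots> = real (card (insert x I) + 1) ^ card D * \<rho> ^ card (insert x I) / \<rho> ^ card D"
      using \<rho>(2) insert.hyps by (simp add: m N_def)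
    finally show ?thesis .
  qed
qed

section \<open>Imposing relations on structured vectors\<close>

text \<open>A relation all of whose pairs are diagonal holds for every vector.\<close>
abbreviation "trivial ps \<equiv> (\<forall>e\<in>set ps. fst e = snd e)"

text \<open>Trivial relations carry little weight, so a larger density comes from nontrivial ones.\<close>
lemma sum_trivial_pairings:
  assumes "finite S" "card S \<le> j" "L > 0" "j > 0"
  shows "(\<Sum>ps\<in>pairings k S. if trivial ps then pairing_weight L j ps else 0) \<le> (1 / real L) ^ k"
  using assms(1,2)
proof (induction k arbitrary: S)
  case 0
  then show ?case by (simp add: pairing_weight_def)
next
  case (Suc k)
  have "(\<Sum>ps\<in>pairings (Suc k) S. if trivial ps then pairing_weight L j ps else 0)
      = (\<Sum>e\<in>S \<times> S. \<Sum>ps\<in>pairings k (S - {fst e, snd e}). if trivial (e # ps) then pairing_weight L j (e # ps) else 0)"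
    by (rule sum_pairings_Suc[OF Suc.prems(1)])
  also have "\<dots> \<le> (\<Sum>e\<in>S \<times> S. if fst e = snd e then 1 / (real L * real j) * (1 / real L) ^ k else 0)"
  proof (rule sum_mono)
    fix e assume e: "e \<in> S \<times> S"
    show "(\<Sum>ps\<in>pairings k (S - {fst e, snd e}). if trivial (e # ps) then pairing_weight L j (e # ps) else 0)
        \<le> (if fst e = snd e then 1 / (real L * real j) * (1 / real L) ^ k else 0)"
    proof (cases "fst e = snd e")
      case True
      have "(\<Sum>ps\<in>pairings k (S - {fst e, snd e}). if trivial (e # ps) then pairing_weight L j (e # ps) else 0)
          = 1 / (real L * real j) * (\<Sum>ps\<in>pairings k (S - {fst e, snd e}). if trivial ps then pairing_weight L j ps else 0)"
        unfolding sum_distrib_left using True by (intro sum.cong refl) (simp add: pairing_weight_def weight_def)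
      also have "\<dots> \<le> 1 / (real L * real j) * (1 / real L) ^ k"
      proof (intro mult_left_mono Suc.IH)
        have "card (S - {fst e, snd e}) \<le> card S" using Suc.prems(1) by (intro card_mono) auto
        then show "card (S - {fst e, snd e}) \<le> j" using Suc.prems(2) by simp
      qed (use Suc.prems in auto)
      finally show ?thesis using True by simp
    qed simp
  qed
  also have "\<dots> = (\<Sum>e | e \<in> S \<times> S \<and> fst e = snd e. 1 / (real L * real j) * (1 / real L) ^ k)"
    using Suc.prems(1) by (intro sum.inter_filter[symmetric]) auto
  also have "\<dots> = real (card S) * (1 / (real L * real j) * (1 / real L) ^ k)"
  proof -
    have "{e. e \<in> S \<times> S \<and> fst e = snd e} = (\<lambda>i. (i, i)) ` S" by auto
    moreover have "card ((\<lambda>i. (i, i)) ` S) = card S" by (rule card_image) (auto simp: inj_on_def)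
    ultimately show ?thesis by simp
  qed
  also have "\<dots> \<le> real j * (1 / (real L * real j) * (1 / real L) ^ k)"
    using Suc.prems(2) by (intro mult_right_mono) auto
  also have "\<dots> = (1 / real L) ^ Suc k" using assms(3,4) by (simp add: field_simps)
  finally show ?case .
qed

lemma sum_all_pairings:
  assumes "finite S" "card S \<le> j" "L > 0" "j > 0"
  shows "(\<Sum>ps\<in>pairings k S. pairing_weight L j ps) \<le> 2 ^ k"
  using assms(1,2)
proof (induction k arbitrary: S)
  case 0
  then show ?case by (simp add: pairing_weight_def)
next
  case (Suc k)
  have "(\<Sum>ps\<in>pairings (Suc k) S. pairing_weight L j ps)
      = (\<Sum>e\<in>S \<times> S. weight L j e * (\<Sum>ps\<in>pairings k (S - {fst e, snd e}). pairing_weight L j ps))"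
    unfolding sum_pairings_Suc[OF Suc.prems(1)] sum_distrib_left by (simp add: pairing_weight_def)
  also have "\<dots> \<le> (\<Sum>e\<in>S \<times> S. weight L j e * 2 ^ k)"
  proof (intro sum_mono mult_left_mono Suc.IH weight_nonneg)
    fix e
    have "card (S - {fst e, snd e}) \<le> card S" using Suc.prems(1) by (intro card_mono) auto
    then show "card (S - {fst e, snd e}) \<le> j" using Suc.prems(2) by simp
  qed (use Suc.prems in auto)
  also have "\<dots> = (\<Sum>e\<in>S \<times> S. weight L j e) * 2 ^ k" by (simp add: sum_distrib_right)
  also have "(\<Sum>e\<in>S \<times> S. weight L j e) \<le> (\<Sum>e\<in>S \<times> S. (if fst e = snd e then 1 / (real L * real j) else 0) + 1 / real j ^ 2)"
    by (intro sum_mono) (auto simp: weight_def)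
  also have "\<dots> = real (card S) * (1 / (real L * real j)) + real (card S * card S) / real j ^ 2"
  proof -
    have "{e. e \<in> S \<times> S \<and> fst e = snd e} = (\<lambda>i. (i, i)) ` S" by auto
    moreover have "card ((\<lambda>i. (i, i)) ` S) = card S" by (rule card_image) (auto simp: inj_on_def)
    moreover have "(\<Sum>e\<in>S \<times> S. if fst e = snd e then 1 / (real L * real j) else 0)
        = (\<Sum>e | e \<in> S \<times> S \<and> fst e = snd e. 1 / (real L * real j))"
      using Suc.prems(1) by (intro sum.inter_filter[symmetric]) auto
    ultimately show ?thesis by (simp add: sum.distrib card_cartesian_product)
  qed
  also have "\<dots> \<le> 1 + 1"
  proof (rule add_mono)
    have "real (card S) \<le> real L * real j"
    proof -
      have "card S \<le> L * j" using Suc.prems(2) assms(3) by (metis One_nat_def Suc_leI le_trans mult_1 mult_le_mono1)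
      then show ?thesis by (metis of_nat_le_iff of_nat_mult)
    qed
    then show "real (card S) * (1 / (real L * real j)) \<le> 1" using assms(3,4) by (simp add: divide_le_eq)
    have "card S * card S \<le> j * j" using Suc.prems(2) by (intro mult_mono) auto
    then have "real (card S * card S) \<le> real j ^ 2" by (simp add: power2_eq_square del: of_nat_mult flip: of_nat_mult)
    then show "real (card S * card S) / real j ^ 2 \<le> 1" using assms(4) by (simp add: divide_le_eq)
  qed
  finally show ?case by (simp add: mult_right_mono)
qed

text \<open>If an outcome \<open>f\<close> admits some \<open>v\<close> in \<open>U\<close>, then nontrivial relations of total weight at least \<open>t - 1/L\<^sup>k\<close> hold for \<open>v\<close>.
  Taking expectations, and using that all weights add up to at most \<open>2\<^sup>k\<close>, some nontrivial relation is as
  claimed. A union bound over the vectors themselves would be impossible, as there are infinitely many.\<close>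
lemma encode_step:
  assumes "finite S" "L > 0" "card S > 0" "finite (set_pmf M)"
    and t: "\<And>v. v \<in> U \<Longrightarrow> t < rel_density k L (card S) S v 0"
    and pos: "measure_pmf.prob M {f. \<exists>v\<in>U. Q f v} > 0" "t > (1 / real L) ^ k"
  shows "\<exists>ps\<in>pairings k S. \<not> trivial ps \<and> measure_pmf.prob M {f. \<exists>v\<in>U. Q f v} * (t - (1 / real L) ^ k)
    \<le> 2 ^ k * measure_pmf.prob M {f. \<exists>v\<in>U. drift v ps = 0 \<and> Q f v}"
proof (rule ccontr)
  let ?pr = "measure_pmf.prob M {f. \<exists>v\<in>U. Q f v}"
  let ?E = "\<lambda>ps. {f. \<exists>v\<in>U. drift v ps = 0 \<and> Q f v}"
  let ?N = "{ps\<in>pairings k S. \<not> trivial ps}"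
  define \<eta> where "\<eta> = t - (1 / real L) ^ k"
  have fN: "finite ?N" and fp: "finite (pairings k S)" using finite_pairings[OF assms(1)] by auto
  assume notex: "\<not> (\<exists>ps\<in>pairings k S. \<not> trivial ps \<and> ?pr * (t - (1 / real L) ^ k) \<le> 2 ^ k * measure_pmf.prob M (?E ps))"
  have lt: "2 ^ k * measure_pmf.prob M (?E ps) < ?pr * \<eta>" if "ps \<in> ?N" for ps
  proof -
    have "\<not> ?pr * \<eta> \<le> 2 ^ k * measure_pmf.prob M (?E ps)"
      using that notex unfolding \<eta>_def by blast
    then show ?thesis by simp
  qed
  have "?pr * \<eta> = measure_pmf.expectation M (\<lambda>f. indicator {f. \<exists>v\<in>U. Q f v} f * \<eta>)" by simp
  also have "\<dots> \<le> measure_pmf.expectation M (\<lambda>f. \<Sum>ps\<in>?N. pairing_weight L (card S) ps * indicator (?E ps) f)"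
  proof (rule integral_mono)
    fix f
    show "indicator {f. \<exists>v\<in>U. Q f v} f * \<eta> \<le> (\<Sum>ps\<in>?N. pairing_weight L (card S) ps * indicator (?E ps) f)"
    proof (cases "\<exists>v\<in>U. Q f v")
      case True
      then obtain v where v: "v \<in> U" "Q f v" by blast
      have "t < (\<Sum>ps\<in>pairings k S. if drift v ps = 0 then pairing_weight L (card S) ps else 0)"
        using t[OF v(1)] by (simp add: rel_density_def)
      also have "\<dots> \<le> (\<Sum>ps\<in>pairings k S. (if trivial ps then pairing_weight L (card S) ps else 0)
          + (if \<not> trivial ps then pairing_weight L (card S) ps * indicator (?E ps) f else 0))"
      proof (rule sum_mono)
        fix ps
        have "f \<in> ?E ps" if "drift v ps = 0" using v that by blast
        then have "drift v ps = 0 \<Longrightarrow> indicator (?E ps) f = (1 :: real)" by (rule indicator_simps(1))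
        then show "(if drift v ps = 0 then pairing_weight L (card S) ps else 0)
          \<le> (if trivial ps then pairing_weight L (card S) ps else 0)
          + (if \<not> trivial ps then pairing_weight L (card S) ps * indicator (?E ps) f else 0)"
          using pairing_weight_nonneg[of L "card S" ps] by simp
      qed
      also have "\<dots> = (\<Sum>ps\<in>pairings k S. if trivial ps then pairing_weight L (card S) ps else 0)
          + (\<Sum>ps\<in>?N. pairing_weight L (card S) ps * indicator (?E ps) f)"
        unfolding sum.distrib sum.inter_filter[OF fp] ..
      also have "\<dots> \<le> (1 / real L) ^ k + (\<Sum>ps\<in>?N. pairing_weight L (card S) ps * indicator (?E ps) f)"
        using sum_trivial_pairings[OF assms(1) order_refl assms(2,3)] by (rule add_right_mono)
      finally show ?thesis using True by (simp add: \<eta>_def)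
    next
      case False
      then show ?thesis by (simp add: sum_nonneg pairing_weight_nonneg)
    qed
  qed (intro integrable_measure_pmf_finite assms(4))+
  also have "\<dots> = (\<Sum>ps\<in>?N. pairing_weight L (card S) ps * measure_pmf.prob M (?E ps))"
    by (subst Bochner_Integration.integral_sum) (auto intro!: integrable_measure_pmf_finite assms(4))
  finally have le: "?pr * \<eta> \<le> (\<Sum>ps\<in>?N. pairing_weight L (card S) ps * measure_pmf.prob M (?E ps))" .
  have \<eta>0: "?pr * \<eta> > 0" using pos by (simp add: \<eta>_def)
  have tot: "(\<Sum>ps\<in>?N. pairing_weight L (card S) ps) \<le> 2 ^ k"
  proof -
    have "(\<Sum>ps\<in>?N. pairing_weight L (card S) ps) \<le> (\<Sum>ps\<in>pairings k S. pairing_weight L (card S) ps)"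
      using fp by (intro sum_mono2) (auto simp: pairing_weight_nonneg)
    also have "\<dots> \<le> 2 ^ k" by (rule sum_all_pairings[OF assms(1) order_refl assms(2,3)])
    finally show ?thesis .
  qed
  define b where "b = ?pr * \<eta> / 2 ^ k"
  have b0: "b > 0" using \<eta>0 by (simp add: b_def)
  have ltb: "measure_pmf.prob M (?E ps) < b" if "ps \<in> ?N" for ps
    using lt[OF that] by (simp add: b_def field_simps)
  have wpos: "\<exists>ps\<in>?N. pairing_weight L (card S) ps > 0"
  proof (rule ccontr)
    assume "\<not> ?thesis"
    then have "pairing_weight L (card S) ps * measure_pmf.prob M (?E ps) \<le> 0" if "ps \<in> ?N" for ps
      using that by (intro mult_nonpos_nonneg) (auto simp: not_less)
    then have "(\<Sum>ps\<in>?N. pairing_weight L (card S) ps * measure_pmf.prob M (?E ps)) \<le> 0"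
      by (rule sum_nonpos)
    then show False using le \<eta>0 by linarith
  qed
  have "(\<Sum>ps\<in>?N. pairing_weight L (card S) ps * measure_pmf.prob M (?E ps)) < (\<Sum>ps\<in>?N. pairing_weight L (card S) ps * b)"
  proof (rule sum_strict_mono_ex1[OF fN])
    show "\<forall>ps\<in>?N. pairing_weight L (card S) ps * measure_pmf.prob M (?E ps) \<le> pairing_weight L (card S) ps * b"
      by (intro ballI mult_left_mono less_imp_le[OF ltb] pairing_weight_nonneg)
    obtain ps where ps: "ps \<in> ?N" "pairing_weight L (card S) ps > 0" using wpos by blast
    then show "\<exists>ps\<in>?N. pairing_weight L (card S) ps * measure_pmf.prob M (?E ps) < pairing_weight L (card S) ps * b"
      using ltb[OF ps(1)] by (intro bexI[of _ ps] mult_strict_left_mono)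
  qed
  also have "\<dots> = (\<Sum>ps\<in>?N. pairing_weight L (card S) ps) * b" by (simp only: sum_distrib_right)
  also have "\<dots> \<le> 2 ^ k * b" using tot b0 by (intro mult_right_mono) auto
  also have "\<dots> = ?pr * \<eta>" by (simp add: b_def)
  finally show False using le by linarith
qed

lemma pairings_subset: "ps \<in> pairings k S \<Longrightarrow> e \<in> set ps \<Longrightarrow> fst e \<in> S \<and> snd e \<in> S"
proof (induction k arbitrary: S ps)
  case (Suc k)
  then obtain e0 ps' where e0: "e0 \<in> S \<times> S" "ps' \<in> pairings k (S - {fst e0, snd e0})" "ps = e0 # ps'" by auto
  show ?case
  proof (cases "e = e0")
    case True
    then show ?thesis using e0(1) by auto
  next
    case False
    then show ?thesis using Suc.IH[OF e0(2)] Suc.prems(2) e0(3) by auto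
  qed
qed simp

lemma drift_zero: "(\<forall>e\<in>set ps. v (fst e) = 0 \<and> v (snd e) = 0) \<Longrightarrow> drift v ps = 0"
  for v :: "nat \<Rightarrow> complex"
  by (induction ps) (simp_all add: drift_def)

text \<open>A nontrivial relation has a coordinate \<open>fst e\<close> that occurs in it exactly once and is therefore determined by the others.\<close>
lemma drift_isolated:
  fixes v :: "nat \<Rightarrow> complex"
  assumes "ps \<in> pairings k S" "e \<in> set ps" "fst e \<noteq> snd e" "\<forall>i\<in>S - {fst e}. v i = 0"
  shows "drift v ps = v (fst e)"
  using assms(1,2,4)
proof (induction k arbitrary: S ps)
  case (Suc k)
  then obtain e0 ps' where e0: "e0 \<in> S \<times> S" "ps' \<in> pairings k (S - {fst e0, snd e0})" "ps = e0 # ps'" by auto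
  have D: "drift v ps = v (fst e0) - v (snd e0) + drift v ps'" by (simp add: e0(3) drift_def)
  show ?case
  proof (cases "e = e0")
    case True
    have "drift v ps' = 0"
    proof (rule drift_zero, rule ballI)
      fix e' assume "e' \<in> set ps'"
      then have "fst e' \<in> S - {fst e0, snd e0} \<and> snd e' \<in> S - {fst e0, snd e0}" using pairings_subset[OF e0(2)] by blast
      then show "v (fst e') = 0 \<and> v (snd e') = 0" using Suc.prems(3) True by auto
    qed
    moreover have "v (snd e0) = 0" using Suc.prems(3) True assms(3) e0(1) by auto
    ultimately show ?thesis using D True by simp
  next
    case False
    then have e: "e \<in> set ps'" using Suc.prems(2) e0(3) by auto
    then have "fst e \<in> S - {fst e0, snd e0}" using pairings_subset[OF e0(2)] by blast
    then have "v (fst e0) = 0" "v (snd e0) = 0" using Suc.prems(3) e0(1) by auto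
    moreover have "drift v ps' = v (fst e)" using Suc.prems(3) by (intro Suc.IH[OF e0(2) e]) auto
    ultimately show ?thesis using D by simp
  qed
qed simp

lemma lin_fun_drift: "lin_fun (\<lambda>v. drift v ps)"
  unfolding lin_fun_def
proof (intro allI)
  fix v w :: "nat \<Rightarrow> complex" and c
  show "drift (\<lambda>i. v i + c * w i) ps = drift v ps + c * drift w ps"
    by (induction ps) (simp_all add: drift_def algebra_simps)
qed

text \<open>Each use of \<open>encode_step\<close> removes the determined coordinate from \<open>S\<close>. It can be repeated until only \<open>m\<close>
  coordinates are left because the density of relations is assumed to be large on every subset with at least \<open>m\<close> points.\<close>
lemma encode_structured:
  assumes "finite S" "L > 0" "m > 0" "finite (set_pmf M)" "\<tau> > 0"
    and "m \<le> card S" "linear_set W" "determined S W"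
    and B: "\<And>v S'. v \<in> B \<Longrightarrow> S' \<subseteq> S \<Longrightarrow> m \<le> card S' \<Longrightarrow> \<tau> + (1 / real L) ^ k < rel_density k L (card S') S' v 0"
  shows "\<exists>W' D. linear_set W' \<and> determined D W' \<and> D \<subseteq> S \<and> card D = m \<and> W' \<subseteq> W \<and>
    measure_pmf.prob M {f. \<exists>v\<in>W \<inter> B. Q f v}
    \<le> (2 ^ k / \<tau>) ^ (card S - m) * measure_pmf.prob M {f. \<exists>v\<in>W' \<inter> B. Q f v}"
  using assms(1,6-)
proof (induction "card S - m" arbitrary: S W)
  case 0
  then have "card S = m" by simp
  then show ?case using 0 by (intro exI[of _ W] exI[of _ S]) simp
next
  case (Suc x)
  show ?case
  proof (cases "measure_pmf.prob M {f. \<exists>v\<in>W \<inter> B. Q f v} > 0")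
    case False
    obtain D where D: "D \<subseteq> S" "card D = m" using Suc.prems(2) obtain_subset_with_card_n by metis
    have "linear_set {\<lambda>_. 0}" "determined D {\<lambda>_. 0}" by (auto simp: linear_set_def determined_def)
    moreover have "(\<lambda>_. 0) \<in> W" using Suc.prems(3) by (simp add: linear_set_def)
    moreover have "measure_pmf.prob M {f. \<exists>v\<in>W \<inter> B. Q f v} \<le> 0" using False by (simp add: not_less)
    then have "measure_pmf.prob M {f. \<exists>v\<in>W \<inter> B. Q f v}
      \<le> (2 ^ k / \<tau>) ^ (card S - m) * measure_pmf.prob M {f. \<exists>v\<in>{\<lambda>_. 0} \<inter> B. Q f v}"
      using assms(5) by (meson order_trans mult_nonneg_nonneg zero_le_power divide_nonneg_pos measure_nonneg zero_le_numeral)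
    ultimately show ?thesis using D by (intro exI[of _ "{\<lambda>_. 0}"] exI[of _ D]) simp
  next
    case True
    have cS: "card S > 0" using Suc.prems(2) assms(3) by linarith
    let ?pr = "\<lambda>W. measure_pmf.prob M {f. \<exists>v\<in>W \<inter> B. Q f v}"
    have "\<exists>ps\<in>pairings k S. \<not> trivial ps \<and> ?pr W * ((\<tau> + (1 / real L) ^ k) - (1 / real L) ^ k)
        \<le> 2 ^ k * measure_pmf.prob M {f. \<exists>v\<in>W \<inter> B. drift v ps = 0 \<and> Q f v}"
    proof (rule encode_step[OF Suc.prems(1) assms(2) cS assms(4) _ True])
      show "\<tau> + (1 / real L) ^ k < rel_density k L (card S) S v 0" if "v \<in> W \<inter> B" for v
        using that Suc.prems(2) by (intro Suc.prems(5)) auto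
    qed (use assms(5) in simp)
    then obtain ps where ps: "ps \<in> pairings k S" "\<not> trivial ps"
      and le: "?pr W * \<tau> \<le> 2 ^ k * measure_pmf.prob M {f. \<exists>v\<in>W \<inter> B. drift v ps = 0 \<and> Q f v}"
      by auto
    obtain e where e: "e \<in> set ps" "fst e \<noteq> snd e" using ps(2) by blast
    define W1 where "W1 = {v\<in>W. drift v ps = 0}"
    have eS: "fst e \<in> S" using pairings_subset[OF ps(1) e(1)] by blast
    have c1: "card (S - {fst e}) = card S - 1" using eS Suc.prems(1) by simp
    have lin: "linear_set W1" unfolding W1_def by (rule linear_set_kernel[OF Suc.prems(3) lin_fun_drift])
    have det: "determined (S - {fst e}) W1"
      unfolding determined_def
    proof (intro ballI impI)
      fix v assume v: "v \<in> W1" "\<forall>i\<in>S - {fst e}. v i = 0"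
      have "v (fst e) = 0" using drift_isolated[OF ps(1) e v(2)] v(1) by (simp add: W1_def)
      then have "\<forall>i\<in>S. v i = 0" using v(2) by blast
      then show "v = (\<lambda>_. 0)" using Suc.prems(4) v(1) unfolding determined_def W1_def by blast
    qed
    have "\<exists>W' D. linear_set W' \<and> determined D W' \<and> D \<subseteq> S - {fst e} \<and> card D = m \<and> W' \<subseteq> W1 \<and>
      ?pr W1 \<le> (2 ^ k / \<tau>) ^ (card (S - {fst e}) - m) * ?pr W'"
    proof (rule Suc.hyps(1))
      show "x = card (S - {fst e}) - m" "finite (S - {fst e})" "m \<le> card (S - {fst e})"
        using Suc.hyps(2) Suc.prems(1,2) c1 by auto
      show "\<tau> + (1 / real L) ^ k < rel_density k L (card S') S' v 0"
        if "v \<in> B" "S' \<subseteq> S - {fst e}" "m \<le> card S'" for v S'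
        using that by (intro Suc.prems(5)) auto
    qed (use lin det in auto)
    then obtain W' D where W': "linear_set W'" "determined D W'" "D \<subseteq> S - {fst e}" "card D = m" "W' \<subseteq> W1"
      "?pr W1 \<le> (2 ^ k / \<tau>) ^ (card (S - {fst e}) - m) * ?pr W'"
      by blast
    have "{f. \<exists>v\<in>W \<inter> B. drift v ps = 0 \<and> Q f v} = {f. \<exists>v\<in>W1 \<inter> B. Q f v}"
      by (auto simp: W1_def)
    then have "?pr W \<le> 2 ^ k / \<tau> * ?pr W1" using le assms(5) by (simp add: field_simps)
    also have "\<dots> \<le> 2 ^ k / \<tau> * ((2 ^ k / \<tau>) ^ (card (S - {fst e}) - m) * ?pr W')"
      using W'(6) assms(5) by (intro mult_left_mono) auto
    also have "\<dots> = (2 ^ k / \<tau>) ^ (card S - m) * ?pr W'"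
    proof -
      have "card S - m = Suc (card (S - {fst e}) - m)" using Suc.hyps(2) c1 by simp
      then show ?thesis by (simp only: power_Suc mult.assoc)
    qed
    finally have "?pr W \<le> (2 ^ k / \<tau>) ^ (card S - m) * ?pr W'" .
    moreover have "D \<subseteq> S" "W' \<subseteq> W" using W' by (auto simp: W1_def)
    ultimately show ?thesis using W'(1,2,4) by blast
  qed
qed

section \<open>Almost constant vectors\<close>

text \<open>Exchanging \<open>i\<close> and \<open>j\<close> changes the sum of any set that contains exactly one of them; the subtracted fraction is a lower
  bound for the probability of the sets that contain \<open>i\<close> but not \<open>j\<close>.\<close>
lemma prob_nonconstant:
  fixes v :: "nat \<Rightarrow> complex"
  assumes "finite V" "s \<le> card V" "i \<in> V" "j \<in> V" "v i \<noteq> v j" "s > 0"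
  shows "measure_pmf.prob (subset_pmf V s) {X. sum v X = r}
    \<le> 1 - real s * real (card V - s) / real (card V) ^ 2"
proof -
  let ?n = "card V"
  let ?A = "{X. X \<subseteq> V \<and> card X = s}"
  have ij: "i \<noteq> j" using assms by auto
  have n2: "?n \<ge> 2"
  proof -
    have "card {i, j} \<le> ?n" using assms by (intro card_mono) auto
    then show ?thesis using ij by simp
  qed
  note fA = subsets_finite_nonempty[OF assms(1,2)]
  let ?Z = "{Z. Z \<subseteq> V - {i, j} \<and> card Z = s - 1}"
  have fZ: "finite ?Z" using assms by simp
  have Zfin: "finite Z" if "Z \<in> ?Z" for Z using that assms(1) finite_subset[of Z V] by auto
  \<comment> \<open>Among the two sets obtained from Z by adding i or j, at most one has sum r.\<close>
  define g where "g Z = (if sum v (insert i Z) = r then insert j Z else insert i Z)" for Z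
  have gA: "g ` ?Z \<subseteq> ?A \<inter> {X. sum v X \<noteq> r}"
  proof (rule image_subsetI)
    fix Z assume Z: "Z \<in> ?Z"
    have nin: "i \<notin> Z" "j \<notin> Z" using Z by auto
    have "sum v (insert i Z) = v i + sum v Z" "sum v (insert j Z) = v j + sum v Z"
      using nin Zfin[OF Z] by auto
    then have "sum v (g Z) \<noteq> r" using assms(5) by (auto simp: g_def)
    moreover have "card (insert i Z) = s" "card (insert j Z) = s"
      using nin Zfin[OF Z] Z assms(6) by auto
    then have "g Z \<in> ?A" using Z assms(3,4) by (auto simp: g_def)
    ultimately show "g Z \<in> ?A \<inter> {X. sum v X \<noteq> r}" by auto
  qed
  have "inj_on g ?Z"
  proof (rule inj_on_inverseI)
    fix Z assume "Z \<in> ?Z"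
    then show "g Z - {i, j} = Z" by (auto simp: g_def)
  qed
  then have "card ?Z \<le> card (?A \<inter> {X. sum v X \<noteq> r})"
    using gA fA by (intro card_inj_on_le) auto
  moreover have "card ?Z = (?n - 2) choose (s - 1)"
  proof -
    have "card (V - {i, j}) = ?n - 2" using assms ij by (simp add: card_Diff_subset)
    then show ?thesis using assms(1) by (simp add: n_subsets)
  qed
  ultimately have cnt: "real ((?n - 2) choose (s - 1)) \<le> real (card (?A \<inter> {X. sum v X \<noteq> r}))" by simp
  have "measure_pmf.prob (subset_pmf V s) {X. sum v X = r} = 1 - measure_pmf.prob (subset_pmf V s) {X. sum v X \<noteq> r}"
    using measure_pmf.prob_compl[of "{X. sum v X \<noteq> r}" "subset_pmf V s"] by (simp add: Compl_eq_Diff_UNIV[symmetric] Collect_neg_eq[symmetric])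
  also have "measure_pmf.prob (subset_pmf V s) {X. sum v X \<noteq> r} = real (card (?A \<inter> {X. sum v X \<noteq> r})) / real (?n choose s)"
    unfolding subset_pmf_def using fA by (subst measure_pmf_of_set) (auto simp: n_subsets[OF assms(1)])
  also have "1 - real (card (?A \<inter> {X. sum v X \<noteq> r})) / real (?n choose s)
      \<le> 1 - real ((?n - 2) choose (s - 1)) / real (?n choose s)"
    using cnt by (simp add: divide_right_mono)
  also have "\<dots> \<le> 1 - real s * real (?n - s) / real ?n ^ 2"
  proof -
    have 1: "real s * real (?n choose s) = real ?n * real ((?n - 1) choose (s - 1))"
    proof -
      have "s * (?n choose s) = ?n * ((?n - 1) choose (s - 1))"
        using Suc_times_binomial[of "s - 1" "?n - 1"] assms(6) n2 by simp
      then show ?thesis by (metis of_nat_mult)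
    qed
    have 2: "real (?n - s) * real ((?n - 1) choose (s - 1)) = real (?n - 1) * real ((?n - 2) choose (s - 1))"
    proof -
      have "(?n - 1 - (s - 1)) * ((?n - 1) choose (s - 1)) = (?n - 1) * ((?n - 1 - 1) choose (s - 1))"
        by (rule binomial_absorb_comp)
      moreover have "?n - 1 - (s - 1) = ?n - s" "?n - 1 - 1 = ?n - 2" using assms(6) by auto
      ultimately show ?thesis by (metis of_nat_mult)
    qed
    define C where "C = real (?n choose s)"
    define C1 where "C1 = real ((?n - 1) choose (s - 1))"
    define C2 where "C2 = real ((?n - 2) choose (s - 1))"
    have C: "C > 0" using assms(2) by (simp add: C_def)
    have np: "real ?n > 0" "real (?n - 1) > 0" using n2 by auto
    have C1: "C1 = real s * C / real ?n" using 1 np by (simp add: C_def C1_def field_simps)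
    have C2: "C2 = real (?n - s) * C1 / real (?n - 1)" using 2 np by (simp add: C2_def C1_def field_simps)
    have "C2 / C = real s * real (?n - s) / (real ?n * real (?n - 1))"
      unfolding C2 C1 using C np by (simp add: field_simps)
    moreover have "real s * real (?n - s) / (real ?n ^ 2) \<le> real s * real (?n - s) / (real ?n * real (?n - 1))"
      using np by (intro divide_left_mono) (auto simp: power2_eq_square)
    ultimately show ?thesis by (simp add: C_def C2_def)
  qed
  finally show ?thesis .
qed

definition vecs :: "nat \<Rightarrow> (nat \<Rightarrow> complex) set" where
  "vecs n = {v. \<forall>i\<ge>n. v i = 0}"

text \<open>Row \<open>i\<close> of \<open>M - \<mu>\<close>, whose ones are at the positions in \<open>X\<close>, applied to \<open>v\<close>.\<close>
definition row_form :: "complex \<Rightarrow> nat \<Rightarrow> nat set \<Rightarrow> (nat \<Rightarrow> complex) \<Rightarrow> complex" where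
  "row_form \<mu> i X v = sum v X - \<mu> * v i"

lemma lin_fun_row_form: "lin_fun (row_form \<mu> i X)"
  by (simp add: lin_fun_def row_form_def sum.distrib sum_distrib_left algebra_simps)

lemma linear_set_vecs: "linear_set (vecs n)"
  by (simp add: linear_set_def vecs_def)

lemma determined_vecs: "determined {..<n} (vecs n)"
  unfolding determined_def vecs_def by (auto simp: not_less[symmetric])

definition almost_constant :: "nat \<Rightarrow> nat \<Rightarrow> (nat \<Rightarrow> complex) set" where
  "almost_constant n m = {v \<in> vecs n. v \<noteq> (\<lambda>_. 0) \<and>
     (\<exists>D\<subseteq>{..<n}. card D = m \<and> (\<exists>c. \<forall>i<n. i \<notin> D \<longrightarrow> v i = c))}"

lemma prob_row_form: "measure_pmf.prob p {X. row_form \<mu> i X v = 0} = measure_pmf.prob p {X. sum v X = \<mu> * v i}"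
  by (simp add: row_form_def)

text \<open>For each exceptional set \<open>D\<close> these vectors lie in a space of dimension \<open>m + 1\<close>, to which \<open>kernel_prob\<close> applies:
  nonconstant vectors are handled by \<open>prob_nonconstant\<close>, and a constant vector \<open>c\<close> would require \<open>s c = \<mu> c\<close>. There are at most \<open>n\<^sup>m\<close> sets \<open>D\<close>.\<close>
lemma almost_constant_prob:
  assumes "s \<le> n" "0 < s" "m < n" "\<mu> \<noteq> of_nat s" "I \<subseteq> {..<n}"
    and \<rho>: "\<rho> = 1 - real s * real (n - s) / real n ^ 2" "0 < \<rho>"
  shows "measure_pmf.prob (Pi_pmf I d (\<lambda>_. subset_pmf {..<n} s))
      {f. \<exists>v\<in>almost_constant n m. \<forall>i\<in>I. row_form \<mu> i (f i) v = 0}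
    \<le> real n ^ m * (real (card I + 1) ^ (m + 1) * \<rho> ^ card I / \<rho> ^ (m + 1))"
proof -
  let ?p = "subset_pmf {..<n} s"
  let ?P = "Pi_pmf I d (\<lambda>_. ?p)"
  let ?Ds = "{D. D \<subseteq> {..<n} \<and> card D = m}"
  define W where "W D = {v \<in> vecs n. \<exists>c. \<forall>i<n. i \<notin> D \<longrightarrow> v i = c}" for D
  have finI: "finite I" using assms(5) finite_subset by blast
  have finp: "finite (set_pmf ?p)" using assms(1) by (simp add: set_subset_pmf)
  have fD: "finite ?Ds" by simp
  have each: "measure_pmf.prob ?P {f. \<exists>v\<in>W D \<inter> (W D - {\<lambda>_. 0}). \<forall>i\<in>I. row_form \<mu> i (f i) v = 0}
      \<le> real (card I + 1) ^ (m + 1) * \<rho> ^ card I / \<rho> ^ (m + 1)" if D: "D \<in> ?Ds" for D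
  proof -
    have "card ({..<n} - D) = n - m" using D by (subst card_Diff_subset) (auto intro: finite_subset)
    then have "{..<n} - D \<noteq> {}" using assms(3) by force
    then obtain i0 where i0: "i0 < n" "i0 \<notin> D" by auto
    have finD: "finite D" using D finite_subset by blast
    then have cD: "card (insert i0 D) = m + 1" using D i0 by simp
    have lin: "linear_set (W D)"
      unfolding linear_set_def
    proof (intro conjI ballI allI)
      show "(\<lambda>_. 0) \<in> W D" by (auto simp: W_def vecs_def)
      fix v w c assume v: "v \<in> W D" and w: "w \<in> W D"
      obtain x y where "\<forall>i<n. i \<notin> D \<longrightarrow> v i = x" "\<forall>i<n. i \<notin> D \<longrightarrow> w i = y"
        using v w unfolding W_def by auto
      then have "\<forall>i<n. i \<notin> D \<longrightarrow> v i + c * w i = x + c * y" by simp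
      moreover have "(\<lambda>i. v i + c * w i) \<in> vecs n" using v w by (simp add: W_def vecs_def)
      ultimately show "(\<lambda>i. v i + c * w i) \<in> W D" unfolding W_def by blast
    qed
    have det: "determined (insert i0 D) (W D)"
      unfolding determined_def
    proof (intro ballI impI)
      fix v assume v: "v \<in> W D" "\<forall>i\<in>insert i0 D. v i = 0"
      then obtain c where c: "\<forall>i<n. i \<notin> D \<longrightarrow> v i = c" unfolding W_def by auto
      then have "c = 0" using i0 v(2) by auto
      then have "v i = 0" for i using c v by (cases "i < n"; cases "i \<in> D") (auto simp: W_def vecs_def)
      then show "v = (\<lambda>_. 0)" by auto
    qed
    have row: "measure_pmf.prob ?p {X. row_form \<mu> i X v = 0} \<le> \<rho>" if v: "v \<in> W D - {\<lambda>_. 0}" and i: "i \<in> I" for v i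
    proof (cases "\<exists>i<n. \<exists>j<n. v i \<noteq> v j")
      case True
      then obtain i1 j1 where "i1 < n" "j1 < n" "v i1 \<noteq> v j1" by blast
      then show ?thesis unfolding prob_row_form \<rho>(1)
        using prob_nonconstant[of "{..<n}" s i1 j1 v] assms(1,2) by simp
    next
      case False
      define c where "c = v i0"
      have vc: "v j = c" if "j < n" for j using False i0(1) that unfolding c_def by blast
      have "c \<noteq> 0"
      proof
        assume "c = 0"
        then have "v j = 0" for j using vc[of j] v by (cases "j < n") (auto simp: W_def vecs_def)
        then show False using v by auto
      qed
      have "measure_pmf.prob ?p {X. row_form \<mu> i X v = 0} = 0"
      proof (subst measure_pmf_zero_iff, rule ccontr)
        assume "set_pmf ?p \<inter> {X. row_form \<mu> i X v = 0} \<noteq> {}"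
        then obtain X where X: "X \<in> set_pmf ?p" "row_form \<mu> i X v = 0" by auto
        then have X': "X \<subseteq> {..<n}" "card X = s" using assms(1) by (auto simp: set_subset_pmf)
        have "sum v X = (\<Sum>j\<in>X. c)" using X' vc by (intro sum.cong) auto
        then have "sum v X = of_nat s * c" using X' by simp
        moreover have "i < n" using i assms(5) by auto
        ultimately show False using X(2) \<open>c \<noteq> 0\<close> assms(4) vc[of i] by (simp add: row_form_def)
      qed
      then show ?thesis using \<rho>(2) by simp
    qed
    have "\<rho> \<le> 1" unfolding \<rho>(1) by simp
    show ?thesis
      using kernel_prob[of I "insert i0 D" "W D" ?p "row_form \<mu>" "W D - {\<lambda>_. 0}" \<rho> d]
        finI finD lin det finp lin_fun_row_form row \<rho>(2) \<open>\<rho> \<le> 1\<close> cD by auto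
  qed
  have "measure_pmf.prob ?P {f. \<exists>v\<in>almost_constant n m. \<forall>i\<in>I. row_form \<mu> i (f i) v = 0}
      \<le> measure_pmf.prob ?P (\<Union>D\<in>?Ds. {f. \<exists>v\<in>W D \<inter> (W D - {\<lambda>_. 0}). \<forall>i\<in>I. row_form \<mu> i (f i) v = 0})"
  proof (intro measure_pmf.finite_measure_mono subsetI)
    fix f assume "f \<in> {f. \<exists>v\<in>almost_constant n m. \<forall>i\<in>I. row_form \<mu> i (f i) v = 0}"
    then obtain v where v: "v \<in> almost_constant n m" "\<forall>i\<in>I. row_form \<mu> i (f i) v = 0" by blast
    then obtain D where "D \<in> ?Ds" "v \<in> W D \<inter> (W D - {\<lambda>_. 0})" unfolding almost_constant_def W_def by blast
    then show "f \<in> (\<Union>D\<in>?Ds. {f. \<exists>v\<in>W D \<inter> (W D - {\<lambda>_. 0}). \<forall>i\<in>I. row_form \<mu> i (f i) v = 0})"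
      using v(2) by blast
  qed simp
  also have "\<dots> \<le> (\<Sum>D\<in>?Ds. measure_pmf.prob ?P {f. \<exists>v\<in>W D \<inter> (W D - {\<lambda>_. 0}). \<forall>i\<in>I. row_form \<mu> i (f i) v = 0})"
    using fD by (intro measure_pmf.finite_measure_subadditive_finite) auto
  also have "\<dots> \<le> (\<Sum>D\<in>?Ds. real (card I + 1) ^ (m + 1) * \<rho> ^ card I / \<rho> ^ (m + 1))"
    by (intro sum_mono each)
  also have "\<dots> = real (n choose m) * (real (card I + 1) ^ (m + 1) * \<rho> ^ card I / \<rho> ^ (m + 1))"
    by (simp add: n_subsets)
  also have "\<dots> \<le> real n ^ m * (real (card I + 1) ^ (m + 1) * \<rho> ^ card I / \<rho> ^ (m + 1))"
  proof (rule mult_right_mono)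
    have "n choose m \<le> n ^ m" using assms(3) by (intro binomial_le_pow) simp
    then show "real (n choose m) \<le> real n ^ m" by (metis of_nat_le_iff of_nat_power)
  qed (use \<rho>(2) in simp)
  finally show ?thesis .
qed

text \<open>If a value is taken by more than half of the coordinates, combine all coordinates with other values, of which there are more than \<open>m\<close>,
  with equally many coordinates of the dominant value.\<close>
lemma balanced_subset:
  assumes v: "v \<in> vecs n" "v \<noteq> (\<lambda>_. 0)" "v \<notin> almost_constant n m" and "m \<le> n"
  shows "\<exists>S\<subseteq>{..<n}. m \<le> card S \<and> (\<forall>x. 2 * card {i\<in>S. v i = x} \<le> card S)"
proof (cases "\<exists>c. 2 * card {i\<in>{..<n}. v i = c} > n")
  case False
  then show ?thesis using assms(4) by (intro exI[of _ "{..<n}"]) (auto simp: not_less)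
next
  case True
  then obtain c where c: "2 * card {i\<in>{..<n}. v i = c} > n" by blast
  let ?C = "{i\<in>{..<n}. v i = c}"
  define D where "D = {i\<in>{..<n}. v i \<noteq> c}"
  have part: "card ?C + card D = n"
  proof -
    have "card (?C \<union> D) = card ?C + card D" by (rule card_Un_disjoint) (auto simp: D_def)
    moreover have "?C \<union> D = {..<n}" by (auto simp: D_def)
    ultimately show ?thesis by simp
  qed
  have "m < card D"
  proof (rule ccontr)
    assume "\<not> m < card D"
    then obtain D' where "D \<subseteq> D'" "D' \<subseteq> {..<n}" "card D' = m"
      using exists_subset_between[of D m "{..<n}"] assms(4) by (auto simp: D_def)
    then have "v \<in> almost_constant n m" using v(1,2) unfolding almost_constant_def D_def by blast
    then show False using v(3) by blast
  qed
  have "card D \<le> card ?C" using c part by linarith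
  then obtain C' where C': "C' \<subseteq> ?C" "card C' = card D" using obtain_subset_with_card_n by metis
  have fin: "finite C'" "finite D" using C' finite_subset[of C' "{..<n}"] by (auto simp: D_def)
  have cS: "card (D \<union> C') = 2 * card D"
    using C' fin by (subst card_Un_disjoint) (auto simp: D_def)
  have "2 * card {i\<in>D \<union> C'. v i = x} \<le> card (D \<union> C')" for x
  proof (cases "x = c")
    case True
    then have "card {i\<in>D \<union> C'. v i = x} \<le> card C'" using fin by (intro card_mono) (auto simp: D_def)
    then show ?thesis using cS C' by simp
  next
    case False
    then have "card {i\<in>D \<union> C'. v i = x} \<le> card D" using fin C'(1) by (intro card_mono) auto
    then show ?thesis using cS by simp
  qed
  moreover have "D \<union> C' \<subseteq> {..<n}" using C'(1) by (auto simp: D_def)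
  moreover have "m \<le> card (D \<union> C')" using cS \<open>m < card D\<close> by simp
  ultimately show ?thesis by blast
qed

section \<open>A fixed eigenvalue\<close>

lemma prob_Pi_pmf_insert':
  assumes "finite I" "x \<notin> I"
  shows "measure_pmf.prob (Pi_pmf (insert x I) d (\<lambda>_. p)) E
    = measure_pmf.expectation (Pi_pmf I d (\<lambda>_. p)) (\<lambda>f. measure_pmf.prob p {y. f(x := y) \<in> E})"
proof -
  have "Pi_pmf (insert x I) d (\<lambda>_. p) = bind_pmf p (\<lambda>y. bind_pmf (Pi_pmf I d (\<lambda>_. p)) (\<lambda>f. return_pmf (f(x := y))))"
    by (simp add: Pi_pmf_insert[OF assms] pair_pmf_def map_bind_pmf map_pmf_def bind_assoc_pmf bind_return_pmf)
  also have "\<dots> = bind_pmf (Pi_pmf I d (\<lambda>_. p)) (\<lambda>f. map_pmf (\<lambda>y. f(x := y)) p)"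
    unfolding map_pmf_def by (rule bind_commute_pmf)
  finally show ?thesis by (simp add: measure_bind_pmf vimage_def)
qed

lemma finite_set_Pi_pmf:
  assumes "finite I" "finite (set_pmf p)"
  shows "finite (set_pmf (Pi_pmf I d (\<lambda>_. p)))"
  using assms by (induction I rule: finite_induct) (auto simp: Pi_pmf_insert)

text \<open>The matrix whose row \<open>i\<close> has its ones at the positions in \<open>f i\<close> has both a right and a left eigenvector for \<open>\<mu>\<close>. The
  left one is expressed by the linear dependence of the rows of \<open>M - \<mu>\<close>.\<close>
definition eigen :: "nat \<Rightarrow> complex \<Rightarrow> (nat \<Rightarrow> nat set) \<Rightarrow> bool" where
  "eigen n \<mu> f \<longleftrightarrow> (\<exists>v\<in>vecs n. v \<noteq> (\<lambda>_. 0) \<and> (\<forall>i<n. row_form \<mu> i (f i) v = 0)) \<and>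
     (\<exists>w. (\<exists>i<n. w i \<noteq> 0) \<and> (\<forall>v\<in>vecs n. (\<Sum>i<n. w i * row_form \<mu> i (f i) v) = 0))"

text \<open>The size constraints under which the two sides of the argument fit together: \<open>L\<close> is the size of a cell, \<open>k\<close> the length of the relations, \<open>a\<close>
  governs the number of groups of cells, \<open>m\<close> is the dimension at which the elimination of coordinates stops, and
  \<open>N\<close> is the number of dyadic levels of structure. Beyond level \<open>N\<close> the atoms are so small that no structure has to be excluded.\<close>
locale scales =
  fixes n s L k a m N :: nat and \<tau>0 \<gamma> \<rho> :: real and \<mu> :: complex
  assumes sizes: "s \<le> n" "0 < s" "m < n" "0 < m" "0 < L" "0 < k" "0 < a" "0 < N"
    and nontrivial: "\<mu> \<noteq> of_nat s"
    and room: "64 * (a * k * L) \<le> m" "96 * a \<le> m"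
    and tail: "\<And>j. m \<le> j \<Longrightarrow> j \<le> n \<Longrightarrow> tail_bound n s j (32 * (a * k * L)) \<le> \<tau>0"
      "\<And>j. m \<le> j \<Longrightarrow> j \<le> n \<Longrightarrow> tail_bound n s j (32 * a) \<le> \<tau>0"
    and gamma: "\<gamma> = 1 / sqrt (2 * real a + 1)" "3 * \<gamma> \<le> 1"
    and err: "(1 / 2) ^ a + \<tau>0 \<le> \<gamma> / 2 ^ N"
    and cellsize: "8 * 2 ^ N * 16 ^ k \<le> real L ^ k"
    and rho: "\<rho> = 1 - real s * real (n - s) / real n ^ 2" "0 < \<rho>"
begin

abbreviation "row_law \<equiv> subset_pmf {..<n} s"

text \<open>Level \<open>b\<close>: the atoms are at most of order \<open>\<gamma>/2\<^sup>b\<close>, while relations have density at least of order \<open>1/2\<^sup>b\<close> in every large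
  set of coordinates.\<close>
definition structured :: "nat \<Rightarrow> (nat \<Rightarrow> complex) set" where
  "structured b = {v \<in> vecs n. v \<noteq> (\<lambda>_. 0) \<and>
     (\<forall>r. measure_pmf.prob row_law {X. sum v X = r} \<le> 3 * \<gamma> / 2 ^ b) \<and>
     (\<forall>S\<subseteq>{..<n}. m \<le> card S \<longrightarrow> 3 / (16 * 2 ^ b * 16 ^ k) < rel_density k L (card S) S v 0)}"

lemma gamma_pos: "\<gamma> > 0"
  using gamma(1) by simp

lemma finite_row: "finite (set_pmf row_law)"
  using sizes by (simp add: set_subset_pmf)

lemma err_le: "b \<le> N \<Longrightarrow> (1 / 2) ^ a + \<tau>0 \<le> \<gamma> / 2 ^ b"
proof -
  assume "b \<le> N"
  then have "(2 :: real) ^ b \<le> 2 ^ N" by simp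
  then have "\<gamma> / 2 ^ N \<le> \<gamma> / 2 ^ b" using gamma_pos by (intro divide_left_mono) auto
  then show ?thesis using err by linarith
qed

text \<open>Call level \<open>b\<close> reached if some large set of coordinates has relation density at most of order \<open>1/2\<^sup>b\<close>. If level \<open>N\<close> is
  reached, all atoms are tiny by \<open>row_bound_relations\<close>. Otherwise there is a level \<open>b\<close> that is reached while \<open>b + 1\<close> is not: the first fact
  bounds the atoms and the second says that every large set has many relations. If not even level \<open>0\<close> is reached,
  \<open>row_bound_pairs\<close> bounds the atoms, provided that the vector is not almost constant.\<close>
lemma trichotomy:
  assumes v: "v \<in> vecs n" "v \<noteq> (\<lambda>_. 0)"
  shows "v \<in> almost_constant n m \<or> (\<exists>b<N. v \<in> structured b) \<or>
    (\<forall>r. measure_pmf.prob row_law {X. sum v X = r} \<le> 3 * \<gamma> / 2 ^ N)"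
proof (cases "v \<in> almost_constant n m")
  case False
  define good where "good b \<longleftrightarrow> (\<exists>S\<subseteq>{..<n}. m \<le> card S \<and>
    real (2 * 2 ^ b) * 16 ^ k * rel_density k L (card S) S v 0 \<le> 3 / 4)" for b :: nat
  have good: "measure_pmf.prob row_law {X. sum v X = r} \<le> 3 * \<gamma> / 2 ^ b" if "good b" "b \<le> N" for b r
  proof -
    obtain S where S: "S \<subseteq> {..<n}" "m \<le> card S" "real (2 * 2 ^ b) * 16 ^ k * rel_density k L (card S) S v 0 \<le> 3 / 4"
      using \<open>good b\<close> unfolding good_def by blast
    have Sn: "card S \<le> n" using S(1) card_mono[of "{..<n}" S] by simp
    have "measure_pmf.prob row_law {X. sum v X = r} \<le> 2 / (real (2 ^ b) * sqrt (2 * real a + 1)) + (1 / 2) ^ a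
        + tail_bound (card {..<n}) s (card S) (32 * (a * k * L))"
      by (rule row_bound_relations[OF _ S(1) _ _ _ _ _ S(3)]) (use sizes room S(2) in auto)
    also have "\<dots> \<le> 2 * \<gamma> / 2 ^ b + (1 / 2) ^ a + \<tau>0"
      using tail(1)[OF S(2) Sn] by (simp add: gamma(1) mult.commute)
    also have "\<dots> \<le> 3 * \<gamma> / 2 ^ b" 
    proof -
      have "3 * \<gamma> / 2 ^ b = 2 * \<gamma> / 2 ^ b + \<gamma> / 2 ^ b" by (simp flip: add_divide_distrib)
      then show ?thesis using err_le[OF \<open>b \<le> N\<close>] by linarith
    qed
    finally show ?thesis .
  qed
  have bad: "3 / (8 * 2 ^ b * 16 ^ k) < rel_density k L (card S) S v 0" if "\<not> good b" "S \<subseteq> {..<n}" "m \<le> card S" for b S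
  proof -
    have "3 / 4 < real (2 * 2 ^ b) * 16 ^ k * rel_density k L (card S) S v 0"
    proof -
      have "\<not> real (2 * 2 ^ b) * 16 ^ k * rel_density k L (card S) S v 0 \<le> 3 / 4"
        using that unfolding good_def by blast
      then show ?thesis by linarith
    qed
    then show ?thesis by (simp add: field_simps)
  qed
  show ?thesis
  proof (cases "good N")
    case True
    have "\<forall>r. measure_pmf.prob row_law {X. sum v X = r} \<le> 3 * \<gamma> / 2 ^ N"
      using good[OF True order_refl] by blast
    then show ?thesis by (intro disjI2)
  next
    case notN: False
    show ?thesis
    proof (cases "good 0")
      case True
      have "\<exists>b<N. good b \<and> \<not> good (Suc b)"
      proof (rule ccontr)
        assume "\<not> ?thesis"
        then have "b \<le> N \<Longrightarrow> good b" for b using True by (induction b) auto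
        then show False using notN by blast
      qed
      then obtain b where b: "b < N" "good b" "\<not> good (Suc b)" by blast
      have "v \<in> structured b"
        unfolding structured_def using v good[OF b(2)] bad[OF b(3)] b(1) by (simp add: mult.assoc)
      then show ?thesis using b(1) by blast
    next
      case not0: False
      obtain S where S: "S \<subseteq> {..<n}" "m \<le> card S" "\<And>x. 2 * card {i\<in>S. v i = x} \<le> card S"
        using balanced_subset[OF v False] sizes by auto
      have Sn: "card S \<le> n" using S(1) card_mono[of "{..<n}" S] by simp
      have "measure_pmf.prob row_law {X. sum v X = r} \<le> 3 * \<gamma> / 2 ^ 0" for r
      proof -
        have "measure_pmf.prob row_law {X. sum v X = r} \<le> 2 / sqrt (2 * real a + 1) + (1 / 2) ^ a
            + tail_bound (card {..<n}) s (card S) (32 * a)"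
          by (rule row_bound_pairs[OF _ S(1) _ _ S(3)]) (use sizes room S(2) in auto)
        also have "\<dots> \<le> 2 * \<gamma> + (1 / 2) ^ a + \<tau>0"
          using tail(2)[OF S(2) Sn] by (simp add: gamma(1))
        also have "\<dots> \<le> 3 * \<gamma> / 2 ^ 0" using err_le[of 0] by simp
        finally show ?thesis .
      qed
      moreover have "3 / (16 * 2 ^ 0 * 16 ^ k) < rel_density k L (card S) S v 0" if "S \<subseteq> {..<n}" "m \<le> card S" for S
      proof -
        have "3 / (16 * 2 ^ 0 * 16 ^ k) \<le> (3 :: real) / (8 * 2 ^ 0 * 16 ^ k)"
          by (intro divide_left_mono) auto
        then show ?thesis using bad[OF not0 that] by linarith
      qed
      ultimately have "v \<in> structured 0" unfolding structured_def using v by blast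
      then show ?thesis using sizes by blast
    qed
  qed
qed simp

text \<open>The factors are: the gain \<open>\<gamma>\<close> per row, after cancellation of the powers of \<open>2\<^sup>b\<close>; the one relation that is not compensated by a
  row; and the choice of the rows that cut the dimension.\<close>
definition "structured_bound = (48 * 32 ^ k * \<gamma>) ^ (n - 1 - m) * (16 * 2 ^ N * 32 ^ k) * real n ^ m"

text \<open>The price \<open>2\<^sup>k/\<tau>\<close> per relation times the atom bound \<open>3\<gamma>/2\<^sup>b\<close> per row equals \<open>48 \<cdot> 32\<^sup>k \<gamma>\<close>, independently of the level \<open>b\<close>.\<close>
lemma structured_prob:
  assumes b: "b < N" and I: "finite I" "I \<subseteq> {..<n}" "card I = n - 1"
  shows "measure_pmf.prob (Pi_pmf I d (\<lambda>_. row_law)) {f. \<exists>v\<in>structured b. \<forall>i\<in>I. row_form \<mu> i (f i) v = 0}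
    \<le> structured_bound"
proof -
  let ?P = "Pi_pmf I d (\<lambda>_. row_law)"
  \<comment> \<open>A third of the available density of relations; the other two thirds cover the trivial relations.\<close>
  define \<tau> :: real where "\<tau> = 1 / (16 * 2 ^ b * 16 ^ k)"
  define \<rho>b where "\<rho>b = 3 * \<gamma> / 2 ^ b"
  have \<tau>: "\<tau> > 0" by (simp add: \<tau>_def)
  have \<rho>b: "0 < \<rho>b" "\<rho>b \<le> 1"
  proof -
    show "0 < \<rho>b" using gamma_pos by (simp add: \<rho>b_def)
    have "3 * \<gamma> / 2 ^ b \<le> 3 * \<gamma> / 1" using gamma_pos by (intro divide_left_mono) auto
    then have "3 * \<gamma> / 2 ^ b \<le> 1" using gamma(2) by linarith
    then show "\<rho>b \<le> 1" by (simp only: \<rho>b_def)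
  qed
  have small: "\<tau> + (1 / real L) ^ k \<le> 3 / (16 * 2 ^ b * 16 ^ k)"
  proof -
    have "(2 :: real) ^ b \<le> 2 ^ N" using b by (intro power_increasing) auto
    then have "8 * 2 ^ b * 16 ^ k \<le> (8 :: real) * 2 ^ N * 16 ^ k" by (intro mult_right_mono mult_left_mono) auto
    then have "8 * 2 ^ b * 16 ^ k \<le> real L ^ k" using cellsize by linarith
    then have "1 / real L ^ k \<le> 1 / (8 * 2 ^ b * 16 ^ k)" by (intro divide_left_mono) (use sizes in auto)
    also have "\<dots> = 2 * \<tau>" by (simp add: \<tau>_def)
    finally show ?thesis by (simp add: \<tau>_def power_one_over)
  qed
  have "\<exists>W' D. linear_set W' \<and> determined D W' \<and> D \<subseteq> {..<n} \<and> card D = m \<and> W' \<subseteq> vecs n \<and>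
    measure_pmf.prob ?P {f. \<exists>v\<in>vecs n \<inter> structured b. \<forall>i\<in>I. row_form \<mu> i (f i) v = 0}
    \<le> (2 ^ k / \<tau>) ^ (card {..<n} - m) * measure_pmf.prob ?P {f. \<exists>v\<in>W' \<inter> structured b. \<forall>i\<in>I. row_form \<mu> i (f i) v = 0}"
  proof (rule encode_structured)
    show "finite (set_pmf ?P)" by (rule finite_set_Pi_pmf[OF I(1) finite_row])
    show "\<tau> + (1 / real L) ^ k < rel_density k L (card S') S' v 0"
      if "v \<in> structured b" "S' \<subseteq> {..<n}" "m \<le> card S'" for v S'
    proof -
      have "3 / (16 * 2 ^ b * 16 ^ k) < rel_density k L (card S') S' v 0"
        using that unfolding structured_def by blast
      then show ?thesis using small by linarith
    qed
  qed (use sizes \<tau> linear_set_vecs determined_vecs in auto)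
  then obtain W' D where W': "linear_set W'" "determined D W'" "D \<subseteq> {..<n}" "card D = m"
    and le: "measure_pmf.prob ?P {f. \<exists>v\<in>vecs n \<inter> structured b. \<forall>i\<in>I. row_form \<mu> i (f i) v = 0}
    \<le> (2 ^ k / \<tau>) ^ (n - m) * measure_pmf.prob ?P {f. \<exists>v\<in>W' \<inter> structured b. \<forall>i\<in>I. row_form \<mu> i (f i) v = 0}"
    by auto
  have fD: "finite D" using W'(3) finite_subset by blast
  have ker: "measure_pmf.prob ?P {f. \<exists>v\<in>W' \<inter> structured b. \<forall>i\<in>I. row_form \<mu> i (f i) v = 0}
      \<le> real (card I + 1) ^ card D * \<rho>b ^ card I / \<rho>b ^ card D"
  proof (rule kernel_prob[OF I(1) fD W'(1,2) finite_row lin_fun_row_form])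
    show "(\<lambda>_. 0) \<notin> structured b" by (simp add: structured_def)
    show "measure_pmf.prob row_law {X. row_form \<mu> i X v = 0} \<le> \<rho>b" if "v \<in> structured b" for v i
      using that unfolding prob_row_form structured_def \<rho>b_def by blast
  qed (use \<rho>b in auto)
  have nm: "n - m = Suc (n - 1 - m)" "n - 1 = (n - 1 - m) + m" using sizes by auto
  define q where "q = n - 1 - m"
  have "structured b \<subseteq> vecs n" unfolding structured_def by blast
  then have sub: "vecs n \<inter> structured b = structured b" by (rule Int_absorb1)
  have "measure_pmf.prob ?P {f. \<exists>v\<in>structured b. \<forall>i\<in>I. row_form \<mu> i (f i) v = 0}
      \<le> (2 ^ k / \<tau>) ^ (n - m) * (real (card I + 1) ^ card D * \<rho>b ^ card I / \<rho>b ^ card D)"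
  proof -
    have "(2 ^ k / \<tau>) ^ (n - m) * measure_pmf.prob ?P {f. \<exists>v\<in>W' \<inter> structured b. \<forall>i\<in>I. row_form \<mu> i (f i) v = 0}
        \<le> (2 ^ k / \<tau>) ^ (n - m) * (real (card I + 1) ^ card D * \<rho>b ^ card I / \<rho>b ^ card D)"
      using ker \<tau> by (intro mult_left_mono) auto
    then show ?thesis using le unfolding sub by linarith
  qed
  also have "\<dots> = (2 ^ k / \<tau>) ^ Suc q * (real n ^ m * \<rho>b ^ q)"
  proof -
    have "\<rho>b ^ card I / \<rho>b ^ card D = \<rho>b ^ q"
      unfolding I(3) W'(4) by (subst nm(2)) (use \<rho>b in \<open>simp add: power_add q_def\<close>)
    moreover have "real (card I + 1) = real n" using I(3) sizes by simp
    ultimately show ?thesis unfolding nm(1) W'(4) q_def[symmetric] by (simp add: mult.assoc flip: times_divide_eq_right)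
  qed
  also have "\<dots> = (2 ^ k / \<tau> * \<rho>b) ^ q * (2 ^ k / \<tau>) * real n ^ m"
    by (simp only: power_mult_distrib power_Suc mult_ac)
  also have "2 ^ k / \<tau> = 16 * 2 ^ b * 32 ^ k"
  proof -
    have "(2 :: real) ^ k * 16 ^ k = 32 ^ k" by (simp flip: power_mult_distrib)
    then show ?thesis by (simp add: \<tau>_def) 
  qed
  also have "16 * 2 ^ b * 32 ^ k * \<rho>b = 48 * 32 ^ k * \<gamma>" by (simp add: \<rho>b_def)
  also have "(48 * 32 ^ k * \<gamma>) ^ q * (16 * 2 ^ b * 32 ^ k) * real n ^ m \<le> structured_bound"
    unfolding structured_bound_def q_def
  proof (intro mult_right_mono mult_left_mono)
    show "(2 :: real) ^ b \<le> 2 ^ N" using b by (intro power_increasing) auto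
  qed (use gamma_pos in auto)
  finally show ?thesis .
qed

definition "constant_bound = real n ^ m * (real n ^ (m + 1) * \<rho> ^ (n - 1) / \<rho> ^ (m + 1))"

text \<open>Union over the index \<open>i\<close> of a nonzero entry of the left eigenvector. Either the other rows annihilate an almost constant or a structured vector, or they
  annihilate a vector all of whose atoms are at most \<open>3\<gamma>/2\<^sup>N\<close>. In the last case a vector of this kind can be chosen as a function
  of the other rows, and row \<open>i\<close>, which is independent of it, must annihilate it too.\<close>
lemma eigen_prob:
  "measure_pmf.prob (Pi_pmf {..<n} d (\<lambda>_. row_law)) {f. eigen n \<mu> f}
    \<le> real n * (constant_bound + real N * structured_bound + 3 * \<gamma> / 2 ^ N)"
proof -
  let ?P = "Pi_pmf {..<n} d (\<lambda>_. row_law)"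
  define killed where "killed I f v \<longleftrightarrow> (\<forall>i\<in>I. row_form \<mu> i (f i) v = 0)" for I f v
  define spreadout where "spreadout = {v\<in>vecs n. \<forall>r. measure_pmf.prob row_law {X. sum v X = r} \<le> 3 * \<gamma> / 2 ^ N}"
  define J where "J i = {..<n} - {i}" for i
  \<comment> \<open>The event that row \<open>i\<close> annihilates all that the other rows annihilate, including a vector with small atoms.\<close>
  define G where "G i = {f. (\<exists>v\<in>spreadout. killed (J i) f v) \<and> (\<forall>v\<in>vecs n. killed (J i) f v \<longrightarrow> row_form \<mu> i (f i) v = 0)}" for i
  \<comment> \<open>Every singular outcome lies in one of these events, where \<open>i\<close> is the index of a nonzero left kernel entry.\<close>
  define F where "F i = {f. \<exists>v\<in>almost_constant n m. killed (J i) f v} \<union>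
    (\<Union>b<N. {f. \<exists>v\<in>structured b. killed (J i) f v}) \<union> G i" for i
  have cover: "{f. eigen n \<mu> f} \<subseteq> (\<Union>i<n. F i)"
  proof
    fix f assume "f \<in> {f. eigen n \<mu> f}"
    then obtain v w i where v: "v \<in> vecs n" "v \<noteq> (\<lambda>_. 0)" "\<forall>i<n. row_form \<mu> i (f i) v = 0"
      and w: "i < n" "w i \<noteq> 0" "\<forall>v\<in>vecs n. (\<Sum>i<n. w i * row_form \<mu> i (f i) v) = 0"
      unfolding eigen_def by blast
    have kv: "killed (J i) f v" using v(3) by (simp add: killed_def J_def)
    have all: "row_form \<mu> i (f i) u = 0" if u: "u \<in> vecs n" "killed (J i) f u" for u
    proof -
      have "(\<Sum>j<n. w j * row_form \<mu> j (f j) u) = w i * row_form \<mu> i (f i) u + (\<Sum>j\<in>J i. w j * row_form \<mu> j (f j) u)"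
        unfolding J_def using w(1) by (subst sum.remove[of _ i]) auto
      also have "(\<Sum>j\<in>J i. w j * row_form \<mu> j (f j) u) = 0" using u(2) by (intro sum.neutral) (simp add: killed_def)
      finally show ?thesis using w(2,3) u(1) by simp
    qed
    have "f \<in> F i"
    proof -
      consider "v \<in> almost_constant n m" | b where "b < N" "v \<in> structured b" | "v \<in> spreadout"
        using trichotomy[OF v(1,2)] v(1) unfolding spreadout_def by blast
      then show ?thesis
      proof cases
        case 1
        then show ?thesis using kv unfolding F_def by blast
      next
        case 2
        then show ?thesis using kv unfolding F_def by blast
      next
        case 3
        then have "f \<in> G i" using kv all unfolding G_def by blast
        then show ?thesis unfolding F_def by blast
      qed
    qed
    then show "f \<in> (\<Union>i<n. F i)" using w(1) by blast
  qed
  have each: "measure_pmf.prob ?P (F i) \<le> constant_bound + real N * structured_bound + 3 * \<gamma> / 2 ^ N" if i: "i < n" for i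
  proof -
    have ins: "insert i (J i) = {..<n}" "i \<notin> J i" "finite (J i)" "J i \<subseteq> {..<n}" "card (J i) = n - 1"
      using i by (auto simp: J_def)
    let ?Q = "Pi_pmf (J i) d (\<lambda>_. row_law)"
    have drop: "measure_pmf.prob ?P {f. \<exists>v\<in>U. killed (J i) f v} = measure_pmf.prob ?Q {f. \<exists>v\<in>U. killed (J i) f v}" for U
    proof -
      have "killed (J i) (f(i := y)) v \<longleftrightarrow> killed (J i) f v" for f y v
        using ins(2) by (auto simp: killed_def)
      then show ?thesis
        using prob_Pi_pmf_insert[OF ins(3,2), of d row_law "{f. \<exists>v\<in>U. killed (J i) f v}"] unfolding ins(1) by simp
    qed
    have 1: "measure_pmf.prob ?P {f. \<exists>v\<in>almost_constant n m. killed (J i) f v} \<le> constant_bound"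
    proof -
      have "card (J i) + 1 = n" using ins(5) i by simp
      then have "measure_pmf.prob ?Q {f. \<exists>v\<in>almost_constant n m. killed (J i) f v} \<le> constant_bound"
        using almost_constant_prob[OF sizes(1-3) nontrivial ins(4) rho, of d] ins(5)
        unfolding killed_def constant_bound_def by simp
      then show ?thesis unfolding drop .
    qed
    have 2: "measure_pmf.prob ?P (\<Union>b<N. {f. \<exists>v\<in>structured b. killed (J i) f v}) \<le> real N * structured_bound"
    proof -
      have "measure_pmf.prob ?P (\<Union>b<N. {f. \<exists>v\<in>structured b. killed (J i) f v})
          \<le> (\<Sum>b<N. measure_pmf.prob ?P {f. \<exists>v\<in>structured b. killed (J i) f v})"
        by (intro measure_pmf.finite_measure_subadditive_finite) auto
      also have "\<dots> \<le> (\<Sum>b<N. structured_bound)"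
        unfolding drop using structured_prob[OF _ ins(3,4,5), of _ d] by (intro sum_mono) (simp add: killed_def)
      finally show ?thesis by simp
    qed
    have 3: "measure_pmf.prob ?P (G i) \<le> 3 * \<gamma> / 2 ^ N"
    proof -
      have "measure_pmf.prob ?P (G i) = measure_pmf.expectation ?Q (\<lambda>f. measure_pmf.prob row_law {y. f(i := y) \<in> G i})"
        using prob_Pi_pmf_insert'[OF ins(3,2), of d row_law "G i"] unfolding ins(1) .
      also have "\<dots> \<le> measure_pmf.expectation ?Q (\<lambda>f. 3 * \<gamma> / 2 ^ N)"
      proof (rule integral_mono)
        fix f
        have kf: "killed (J i) (f(i := y)) v \<longleftrightarrow> killed (J i) f v" for y v
          using ins(2) by (auto simp: killed_def)
        show "measure_pmf.prob row_law {y. f(i := y) \<in> G i} \<le> 3 * \<gamma> / 2 ^ N"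
        proof (cases "\<exists>v\<in>spreadout. killed (J i) f v")
          case True
          then obtain v where v: "v \<in> spreadout" "killed (J i) f v" by blast
          have "{y. f(i := y) \<in> G i} \<subseteq> {y. row_form \<mu> i y v = 0}"
            using v by (auto simp: G_def kf spreadout_def)
          then have "measure_pmf.prob row_law {y. f(i := y) \<in> G i} \<le> measure_pmf.prob row_law {y. row_form \<mu> i y v = 0}"
            by (intro measure_pmf.finite_measure_mono) auto
          also have "\<dots> \<le> 3 * \<gamma> / 2 ^ N" using v(1) unfolding prob_row_form spreadout_def by blast
          finally show ?thesis .
        next
          case False
          then have "{y. f(i := y) \<in> G i} = {}" by (auto simp: G_def kf)
          then show ?thesis using gamma_pos by simp
        qed
      qed (intro integrable_measure_pmf_finite finite_set_Pi_pmf[OF ins(3) finite_row])+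
      finally show ?thesis by simp
    qed
    have "measure_pmf.prob ?P (F i) \<le> measure_pmf.prob ?P {f. \<exists>v\<in>almost_constant n m. killed (J i) f v}
        + measure_pmf.prob ?P (\<Union>b<N. {f. \<exists>v\<in>structured b. killed (J i) f v}) + measure_pmf.prob ?P (G i)"
      unfolding F_def
      by (intro order_trans[OF measure_Un_le] add_right_mono measure_Un_le) auto
    then show ?thesis using 1 2 3 by linarith
  qed
  have "measure_pmf.prob ?P {f. eigen n \<mu> f} \<le> measure_pmf.prob ?P (\<Union>i<n. F i)"
    using cover by (intro measure_pmf.finite_measure_mono) auto
  also have "\<dots> \<le> (\<Sum>i<n. measure_pmf.prob ?P (F i))"
    by (intro measure_pmf.finite_measure_subadditive_finite) auto
  also have "\<dots> \<le> (\<Sum>i<n. constant_bound + real N * structured_bound + 3 * \<gamma> / 2 ^ N)"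
    using each by (intro sum_mono) auto
  finally show ?thesis by simp
qed

end

section \<open>Eigenvalues of low degree\<close>

definition root_of :: "int poly \<Rightarrow> complex \<Rightarrow> bool" where
  "root_of q z \<longleftrightarrow> poly (map_poly of_int q) z = 0"

lemma eval_mult: "poly (map_poly complex_of_int (p * q)) z = poly (map_poly of_int p) z * poly (map_poly of_int q) z"
  by (simp add: of_int_poly_hom.hom_mult)

lemma eval_add: "poly (map_poly complex_of_int (p + q)) z = poly (map_poly of_int p) z + poly (map_poly of_int q) z"
  by (simp add: of_int_poly_hom.hom_add)

lemma eval_smult: "poly (map_poly complex_of_int (Polynomial.smult a p)) z = of_int a * poly (map_poly of_int p) z"
  by (simp add: of_int_hom.map_poly_hom_smult)

lemma clear_denominators:
  fixes p :: "rat poly"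
  shows "\<exists>D p'. D \<noteq> 0 \<and> map_poly rat_of_int p' = Polynomial.smult (of_int D) p"
proof (induction p)
  case 0
  then show ?case by (intro exI[of _ 1] exI[of _ 0]) simp
next
  case (pCons c p)
  then obtain D p' where D: "D \<noteq> 0" "map_poly rat_of_int p' = Polynomial.smult (of_int D) p" by blast
  obtain a b where ab: "quotient_of c = (a, b)" by fastforce
  have b: "b > 0" "c = of_int a / of_int b"
    using quotient_of_denom_pos[OF ab] quotient_of_div[OF ab] by auto
  have "map_poly rat_of_int (pCons (a * D) (Polynomial.smult b p')) = Polynomial.smult (of_int (b * D)) (pCons c p)"
  proof (rule poly_eqI)
    fix i
    have "rat_of_int (coeff p' j) = of_int D * coeff p j" for j
      using arg_cong[OF D(2), of "\<lambda>q. coeff q j"] by (simp add: coeff_map_poly)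
    then show "coeff (map_poly rat_of_int (pCons (a * D) (Polynomial.smult b p'))) i = coeff (Polynomial.smult (of_int (b * D)) (pCons c p)) i"
      using b by (cases i) (simp_all add: coeff_map_poly)
  qed
  moreover have "b * D \<noteq> 0" using b D by simp
  ultimately show ?case by blast
qed

lemma minimal_integer_poly:
  assumes "algebraic z"
  shows "\<exists>q. q \<noteq> 0 \<and> root_of q z \<and> degree q \<le> algebraic_degree z"
proof -
  have mp: "is_min_poly (min_poly z) z"
    unfolding min_poly_def by (rule theI'[OF ex1_min_poly[OF assms]])
  obtain D p' where D: "D \<noteq> 0" "map_poly rat_of_int p' = Polynomial.smult (of_int D) (min_poly z)"
    using clear_denominators by blast
  have c: "rat_of_int (coeff p' i) = of_int D * coeff (min_poly z) i" for i
    using arg_cong[OF D(2), of "\<lambda>q. coeff q i"] by (simp add: coeff_map_poly)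
  have "map_poly complex_of_int p' = Polynomial.smult (of_int D) (map_poly of_rat (min_poly z))"
  proof (rule poly_eqI)
    fix i
    have "complex_of_int (coeff p' i) = of_rat (rat_of_int (coeff p' i))" by simp
    also have "\<dots> = of_int D * of_rat (coeff (min_poly z) i)" by (simp only: c of_rat_mult of_rat_of_int_eq)
    finally show "coeff (map_poly complex_of_int p') i = coeff (Polynomial.smult (of_int D) (map_poly of_rat (min_poly z))) i"
      by (simp add: coeff_map_poly)
  qed
  then have "root_of p' z" using mp by (simp add: root_of_def is_min_poly_def)
  moreover have "p' \<noteq> 0"
  proof
    assume "p' = 0"
    then have "of_int D * coeff (min_poly z) (degree (min_poly z)) = 0" using c[of "degree (min_poly z)"] by simp
    then show False using D(1) mp by (simp add: is_min_poly_def)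
  qed
  moreover have "degree p' \<le> degree (min_poly z)"
  proof (rule degree_le, intro allI impI)
    fix i assume "degree (min_poly z) < i"
    then show "coeff p' i = 0" using c[of i] by (simp add: coeff_eq_0)
  qed
  ultimately show ?thesis by (auto simp: algebraic_degree_def)
qed

text \<open>Gauss's lemma: a primitive integer polynomial of least degree with root \<open>z\<close> divides a nonzero integer multiple of the monic polynomial \<open>c\<close>, and comparing contents
  and leading coefficients shows that its own leading coefficient is a unit.\<close>
lemma unit_leading_coefficient:
  assumes c: "lead_coeff c = 1" "root_of c z"
    and q: "q \<noteq> 0" "root_of q z" "\<And>r. r \<noteq> 0 \<Longrightarrow> root_of r z \<Longrightarrow> degree q \<le> degree r"
  shows "\<exists>q. q \<noteq> 0 \<and> root_of q z \<and> \<bar>lead_coeff q\<bar> = 1 \<and> (\<forall>r. r \<noteq> 0 \<longrightarrow> root_of r z \<longrightarrow> degree q \<le> degree r) \<and>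
    (\<forall>x. root_of q x \<longrightarrow> root_of c x)"
proof -
  define p where "p = primitive_part q"
  have qp: "q = Polynomial.smult (content q) p" by (simp add: p_def)
  have p0: "p \<noteq> 0" "content q \<noteq> 0" using q(1) qp by (metis smult_0_right, simp)
  have cp: "content p = 1" using q(1) by (simp add: p_def)
  have dp: "degree p = degree q" unfolding p_def by simp
  have rp: "root_of p z"
    using q(2) p0(2) unfolding root_of_def by (subst (asm) qp) (simp add: eval_smult)
  define r where "r = pseudo_mod c p"
  obtain a h where ah: "a \<noteq> 0" "Polynomial.smult a c = p * h + r" and rd: "r = 0 \<or> degree r < degree p"
    using pseudo_mod[OF p0(1), of c] unfolding r_def by blast
  have "root_of r z"
  proof -
    have "poly (map_poly complex_of_int (Polynomial.smult a c)) z = poly (map_poly complex_of_int (p * h + r)) z"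
      by (simp only: ah(2))
    then show ?thesis using c(2) rp unfolding root_of_def eval_smult eval_add eval_mult by simp
  qed
  then have "r = 0" using rd q(3)[of r] dp by fastforce
  then have eq: "Polynomial.smult a c = p * h" using ah by simp
  have "content c = 1"
  proof -
    have "content c dvd 1" using content_dvd_coeff[of c "degree c"] c(1) by simp
    then show ?thesis by (metis is_unit_normalize normalize_content)
  qed
  then have ch: "content h = \<bar>a\<bar>"
    using arg_cong[OF eq, of content] cp by (simp add: content_mult)
  have "lead_coeff h = content h * lead_coeff (primitive_part h)"
    by (metis content_times_primitive_part lead_coeff_smult)
  moreover have "a * lead_coeff c = lead_coeff p * lead_coeff h"
    using arg_cong[OF eq, of lead_coeff] ah(1) by (simp add: lead_coeff_mult)
  ultimately have "a = \<bar>a\<bar> * (lead_coeff p * lead_coeff (primitive_part h))" using c(1) ch by (simp add: mult_ac)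
  then have "\<bar>a\<bar> * 1 = \<bar>a\<bar> * \<bar>lead_coeff p * lead_coeff (primitive_part h)\<bar>"
    by (metis abs_abs abs_mult mult.right_neutral)
  then have "\<bar>lead_coeff p\<bar> * \<bar>lead_coeff (primitive_part h)\<bar> = 1" using ah(1) by (simp add: abs_mult)
  then have "\<bar>lead_coeff p\<bar> = 1" by (metis abs_dvd_iff abs_ge_zero dvd_triv_left zdvd1_eq abs_abs)
  moreover have "root_of c x" if "root_of p x" for x
  proof -
    have "poly (map_poly complex_of_int (Polynomial.smult a c)) x = poly (map_poly complex_of_int (p * h)) x"
      by (simp only: eq)
    then show ?thesis using that ah(1) unfolding root_of_def eval_smult eval_mult by simp
  qed
  ultimately show ?thesis using p0 rp q(3) dp by (intro exI[of _ p]) auto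
qed

lemma coeff_prod_linear_le:
  fixes A :: "complex multiset"
  assumes "\<forall>x\<in>#A. norm x \<le> R" "R \<ge> 0"
  shows "norm (coeff (\<Prod>x\<in>#A. [:-x, 1:]) i) \<le> (1 + R) ^ size A"
  using assms(1)
proof (induction A arbitrary: i)
  case empty
  then show ?case by (cases i) auto
next
  case (add x A)
  let ?p = "\<Prod>x\<in>#A. [:-x, 1:]"
  have IH: "norm (coeff ?p i) \<le> (1 + R) ^ size A" for i using add by auto
  have x: "norm x \<le> R" using add by auto
  have "(\<Prod>x\<in>#add_mset x A. [:-x, 1:]) = [:-x, 1:] * ?p" by simp
  also have "coeff \<dots> i = - x * coeff ?p i + (if i = 0 then 0 else coeff ?p (i - 1))"
    by (cases i) (auto simp: mult_pCons_left)
  finally have "norm (coeff (\<Prod>x\<in>#add_mset x A. [:-x, 1:]) i)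
      \<le> norm (x * coeff ?p i) + norm (if i = 0 then 0 else coeff ?p (i - 1))"
    using norm_triangle_ineq[of "- x * coeff ?p i"] by simp
  also have "norm (x * coeff ?p i) \<le> R * (1 + R) ^ size A"
    unfolding norm_mult using x IH assms(2) by (intro mult_mono) auto
  also have "norm (if i = 0 then 0 else coeff ?p (i - 1)) \<le> (1 + R) ^ size A" using IH assms(2) by auto
  finally show ?case by (simp add: algebra_simps)
qed

definition bounded_polys :: "nat \<Rightarrow> nat \<Rightarrow> int poly set" where
  "bounded_polys d H = {q. degree q \<le> d \<and> (\<forall>i. \<bar>coeff q i\<bar> \<le> int H)}"

lemma bounded_polys:
  "finite (bounded_polys d H)" "card (bounded_polys d H) \<le> (2 * H + 1) ^ (d + 1)"
proof -
  let ?L = "{xs. set xs \<subseteq> {- int H..int H} \<and> length xs = d + 1}"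
  have fin: "finite ?L" by (rule finite_lists_length_eq) simp
  have sub: "bounded_polys d H \<subseteq> Poly ` ?L"
  proof
    fix q assume q: "q \<in> bounded_polys d H"
    let ?xs = "map (coeff q) [0..<d + 1]"
    have xs: "Poly ?xs = q"
    proof (rule poly_eqI)
      fix i
      show "coeff (Poly ?xs) i = coeff q i"
        using q by (cases "i < d + 1") (auto simp: bounded_polys_def nth_default_def coeff_eq_0 simp del: upt_Suc)
    qed
    have "?xs \<in> ?L"
    proof -
      have "coeff q i \<in> {- int H..int H}" for i
      proof -
        have "\<bar>coeff q i\<bar> \<le> int H" using q by (simp add: bounded_polys_def)
        then show ?thesis by (simp add: abs_le_iff)
      qed
      then show ?thesis by auto
    qed
    then have "Poly ?xs \<in> Poly ` ?L" by (rule imageI)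
    then show "q \<in> Poly ` ?L" unfolding xs .
  qed
  show "finite (bounded_polys d H)" using sub fin finite_surj by blast
  have "card (bounded_polys d H) \<le> card (Poly ` ?L)" using sub fin by (intro card_mono) auto
  also have "\<dots> \<le> card ?L" using fin by (rule card_image_le)
  also have "\<dots> = card {- int H..int H} ^ (d + 1)" by (rule card_lists_length_eq) simp
  also have "card {- int H..int H} = 2 * H + 1" by simp
  finally show "card (bounded_polys d H) \<le> (2 * H + 1) ^ (d + 1)" .
qed

text \<open>The number \<open>(n + 1)\<^sup>d\<close> bounds the coefficients of a polynomial of degree at most \<open>d\<close> with leading coefficient \<open>\<plusminus>1\<close> whose roots all have modulus at most \<open>n\<close>.\<close>
definition candidates :: "nat \<Rightarrow> nat \<Rightarrow> complex set" where
  "candidates d n = (\<Union>q\<in>bounded_polys d ((n + 1) ^ d) - {0}. {z. root_of q z})"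

lemma candidates:
  "finite (candidates d n)" "card (candidates d n) \<le> d * (2 * (n + 1) ^ d + 1) ^ (d + 1)"
proof -
  have roots: "finite {z. root_of q z}" "card {z. root_of q z} \<le> d" if "q \<in> bounded_polys d H - {0}" for q H
  proof -
    let ?q = "map_poly complex_of_int q"
    have "coeff ?q (degree q) \<noteq> 0" using that by (simp add: coeff_map_poly)
    then have q0: "?q \<noteq> 0" by auto
    show "finite {z. root_of q z}" unfolding root_of_def by (rule poly_roots_finite[OF q0])
    have "card {z. root_of q z} \<le> degree ?q" unfolding root_of_def by (rule card_poly_roots_bound[OF q0])
    also have "\<dots> \<le> degree q" by (rule degree_map_poly_le)
    finally show "card {z. root_of q z} \<le> d" using that by (simp add: bounded_polys_def)
  qed
  have fin: "finite (bounded_polys d ((n + 1) ^ d) - {0})" using bounded_polys by auto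
  show "finite (candidates d n)" unfolding candidates_def using fin roots by blast
  have "card (candidates d n) \<le> (\<Sum>q\<in>bounded_polys d ((n + 1) ^ d) - {0}. card {z. root_of q z})"
    unfolding candidates_def by (rule card_UN_le[OF fin])
  also have "\<dots> \<le> (\<Sum>q\<in>bounded_polys d ((n + 1) ^ d) - {0}. d)" using roots by (intro sum_mono) blast
  also have "\<dots> = card (bounded_polys d ((n + 1) ^ d) - {0}) * d" by simp
  also have "\<dots> \<le> (2 * (n + 1) ^ d + 1) ^ (d + 1) * d"
  proof (rule mult_right_mono)
    have "card (bounded_polys d ((n + 1) ^ d) - {0}) \<le> card (bounded_polys d ((n + 1) ^ d))"
      using bounded_polys(1) by (intro card_mono) auto
    then show "card (bounded_polys d ((n + 1) ^ d) - {0}) \<le> (2 * (n + 1) ^ d + 1) ^ (d + 1)"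
      using bounded_polys(2)[of d "(n + 1) ^ d"] by linarith
  qed simp
  finally show "card (candidates d n) \<le> d * (2 * (n + 1) ^ d + 1) ^ (d + 1)" by (simp add: mult.commute)
qed

lemma eigenvector_entries:
  fixes A :: "complex mat"
  assumes A: "A \<in> carrier_mat n n" and ev: "eigenvalue A z"
  shows "\<exists>v\<in>carrier_vec n. (\<exists>i<n. v $ i \<noteq> 0) \<and> (\<forall>i<n. (\<Sum>j<n. A $$ (i, j) * v $ j) = z * v $ i)"
proof -
  obtain v where v: "v \<in> carrier_vec n" "v \<noteq> 0\<^sub>v n" "A *\<^sub>v v = z \<cdot>\<^sub>v v"
    using ev A unfolding eigenvalue_def eigenvector_def by auto
  have "\<exists>i<n. v $ i \<noteq> 0"
  proof (rule ccontr)
    assume "\<not> ?thesis"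
    then have "v = 0\<^sub>v n" using v(1) by (intro eq_vecI) auto
    then show False using v(2) by simp
  qed
  moreover have "(\<Sum>j<n. A $$ (i, j) * v $ j) = z * v $ i" if "i < n" for i
  proof -
    have "(A *\<^sub>v v) $ i = (\<Sum>j<n. A $$ (i, j) * v $ j)"
      using A v(1) that by (simp add: scalar_prod_def lessThan_atLeast0)
    then show ?thesis using v that by simp
  qed
  ultimately show ?thesis using v(1) by blast
qed

lemma eigenvalue_norm_le:
  fixes A :: "complex mat"
  assumes A: "A \<in> carrier_mat n n" and ev: "eigenvalue A z"
    and ent: "\<And>i j. i < n \<Longrightarrow> j < n \<Longrightarrow> norm (A $$ (i, j)) \<le> 1"
  shows "norm z \<le> real n"
proof -
  obtain v :: "complex Matrix.vec" and i0 where v: "\<forall>i<n. (\<Sum>j<n. A $$ (i, j) * v $ j) = z * v $ i"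
    and i0: "i0 < n" "v $ i0 \<noteq> 0"
    using eigenvector_entries[OF A ev] by blast
  obtain i where i: "i < n" "\<And>j. j < n \<Longrightarrow> norm (v $ j) \<le> norm (v $ i)"
    using finite_argmax[of "{..<n}" "\<lambda>i. norm (v $ i)"] i0 by auto
  have pos: "norm (v $ i) > 0" using i(2)[OF i0(1)] i0(2) by (meson less_le_trans zero_less_norm_iff)
  have "norm z * norm (v $ i) = norm (\<Sum>j<n. A $$ (i, j) * v $ j)" using v i(1) by (simp add: norm_mult)
  also have "\<dots> \<le> (\<Sum>j<n. norm (v $ i))"
  proof (intro sum_norm_le)
    fix j assume "j \<in> {..<n}"
    then have "norm (A $$ (i, j)) * norm (v $ j) \<le> 1 * norm (v $ i)"
      using ent i by (intro mult_mono) auto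
    then show "norm (A $$ (i, j) * v $ j) \<le> norm (v $ i)" by (simp add: norm_mult)
  qed
  also have "\<dots> = real n * norm (v $ i)" by simp
  finally show ?thesis using pos by simp
qed

text \<open>All roots of a primitive integer polynomial of least degree with root \<open>z\<close> are eigenvalues, hence of modulus at most \<open>n\<close>; since its leading coefficient is \<open>\<plusminus>1\<close>, this bounds its coefficients.\<close>
lemma eigenvalue_in_candidates:
  fixes M :: "int mat"
  assumes M: "M \<in> carrier_mat n n" and ent: "\<And>i j. i < n \<Longrightarrow> j < n \<Longrightarrow> M $$ (i, j) \<in> {0, 1}"
    and z: "eigenvalue (map_mat complex_of_int M) z" "algebraic z" "algebraic_degree z \<le> d"
  shows "z \<in> candidates d n"
proof -
  let ?A = "map_mat complex_of_int M"
  have A: "?A \<in> carrier_mat n n" using M by simp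
  have cp: "eigenvalue ?A x \<longleftrightarrow> root_of (char_poly M) x" for x
    unfolding eigenvalue_root_char_poly[OF A] root_of_def of_int_hom.char_poly_hom[OF M] ..
  have lc: "lead_coeff (char_poly M) = 1" using degree_monic_char_poly[OF M] by simp
  let ?P = "\<lambda>q. q \<noteq> 0 \<and> root_of q z"
  obtain q1 where q1: "?P q1" "degree q1 \<le> algebraic_degree z" using minimal_integer_poly[OF z(2)] by blast
  obtain q0 where q0: "?P q0" "\<And>r. ?P r \<Longrightarrow> degree q0 \<le> degree r"
    using ex_has_least_nat[of ?P q1 degree] q1(1) by blast
  obtain q where q: "q \<noteq> 0" "root_of q z" "\<bar>lead_coeff q\<bar> = 1"
    and qmin: "\<forall>r. r \<noteq> 0 \<longrightarrow> root_of r z \<longrightarrow> degree q \<le> degree r"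
    and qc: "\<forall>x. root_of q x \<longrightarrow> root_of (char_poly M) x"
    using unit_leading_coefficient[OF lc, of z q0] z(1) q0 unfolding cp by blast
  have "degree q \<le> degree q1" using qmin q1(1) by blast
  then have dq: "degree q \<le> d" using q1(2) z(3) by linarith
  let ?q = "map_poly complex_of_int q"
  have lq: "lead_coeff ?q = of_int (lead_coeff q)" "degree ?q = degree q"
    by (simp_all add: of_int_hom.degree_map_poly_hom)
  have q0: "?q \<noteq> 0" using q(1) by simp
  obtain R where R: "size R = degree ?q" "?q = Polynomial.smult (lead_coeff ?q) (\<Prod>x\<in>#R. [:-x, 1:])"
    using alg_closed_imp_factorization[OF q0] by blast
  have "norm x \<le> real n" if x: "x \<in># R" for x
  proof -
    have "poly (\<Prod>x\<in>#R. [:-x, 1:]) x = 0"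
      using x by (auto simp: poly_prod_mset prod_mset_zero_iff)
    then have "root_of q x" unfolding root_of_def by (subst R(2)) simp
    then have "eigenvalue ?A x" using qc cp by blast
    then show ?thesis by (rule eigenvalue_norm_le[OF A]) (use M ent in \<open>force\<close>)
  qed
  then have cb: "norm (coeff (\<Prod>x\<in>#R. [:-x, 1:]) i) \<le> (1 + real n) ^ size R" for i
    by (intro coeff_prod_linear_le) auto
  have "\<bar>coeff q i\<bar> \<le> int ((n + 1) ^ d)" for i
  proof -
    have "real_of_int \<bar>coeff q i\<bar> = norm (coeff ?q i)" by (simp add: coeff_map_poly)
    also have "\<dots> = norm (lead_coeff ?q) * norm (coeff (\<Prod>x\<in>#R. [:-x, 1:]) i)"
      by (subst R(2)) (simp add: norm_mult)
    also have "norm (lead_coeff ?q) = 1" unfolding lq(1) using q(3) by (metis norm_of_int of_int_1 of_int_abs)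
    also have "1 * norm (coeff (\<Prod>x\<in>#R. [:-x, 1:]) i) \<le> (1 + real n) ^ size R" using cb by simp
    also have "\<dots> \<le> (1 + real n) ^ d" using R(1) lq(2) dq by (intro power_increasing) auto
    also have "\<dots> = real_of_int (int ((n + 1) ^ d))" by (simp add: add.commute)
    finally show ?thesis by (simp only: of_int_le_iff)
  qed
  then have "q \<in> bounded_polys d ((n + 1) ^ d) - {0}" using dq q(1) by (simp add: bounded_polys_def)
  then show ?thesis using q(2) unfolding candidates_def by blast
qed

text \<open>The left eigenvector comes from the transposed matrix, which has the same characteristic polynomial.\<close>
lemma eigenvalue_imp_eigen:
  fixes f :: "nat \<Rightarrow> nat set" and A :: "complex mat"
  assumes A: "A \<in> carrier_mat n n" and ent: "\<And>i j. i < n \<Longrightarrow> j < n \<Longrightarrow> A $$ (i, j) = (if j \<in> f i then 1 else 0)"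
    and f: "\<And>i. i < n \<Longrightarrow> f i \<subseteq> {..<n}" and z: "eigenvalue A z"
  shows "eigen n z f"
proof -
  have row_sum: "row_form z i (f i) v = (\<Sum>j<n. A $$ (i, j) * v j) - z * v i" if "i < n" for i v
  proof -
    have "(\<Sum>j<n. A $$ (i, j) * v j) = (\<Sum>j<n. if j \<in> f i then v j else 0)"
      using that by (intro sum.cong) (auto simp: ent)
    also have "\<dots> = sum v ({..<n} \<inter> f i)" by (simp add: sum.inter_restrict)
    also have "{..<n} \<inter> f i = f i" using f[OF that] by auto
    finally show ?thesis by (simp add: row_form_def)
  qed
  have At: "transpose_mat A \<in> carrier_mat n n" using A by simp
  have "eigenvalue (transpose_mat A) z"
    using z unfolding eigenvalue_root_char_poly[OF A] eigenvalue_root_char_poly[OF At] char_poly_transpose_mat[OF A] .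
  then obtain w where w: "w \<in> carrier_vec n" "\<exists>i<n. w $ i \<noteq> 0" "\<forall>i<n. (\<Sum>j<n. transpose_mat A $$ (i, j) * w $ j) = z * w $ i"
    using eigenvector_entries[OF At] by blast
  obtain u where u: "u \<in> carrier_vec n" "\<exists>i<n. u $ i \<noteq> 0" "\<forall>i<n. (\<Sum>j<n. A $$ (i, j) * u $ j) = z * u $ i"
    using eigenvector_entries[OF A z] by blast
  define v where "v j = (if j < n then u $ j else 0)" for j
  have "v \<in> vecs n" by (simp add: v_def vecs_def)
  moreover have "v \<noteq> (\<lambda>_. 0)"
  proof
    assume "v = (\<lambda>_. 0)"
    then have "v i = 0" for i by simp
    then show False using u(2) by (metis v_def)
  qed
  moreover have "row_form z i (f i) v = 0" if "i < n" for i
  proof -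
    have "(\<Sum>j<n. A $$ (i, j) * v j) = (\<Sum>j<n. A $$ (i, j) * u $ j)" by (intro sum.cong) (auto simp: v_def)
    then show ?thesis unfolding row_sum[OF that] using u(3) that by (simp add: v_def)
  qed
  moreover have "(\<Sum>i<n. w $ i * row_form z i (f i) x) = 0" if "x \<in> vecs n" for x
  proof -
    have "(\<Sum>i<n. w $ i * row_form z i (f i) x) = (\<Sum>i<n. \<Sum>j<n. w $ i * (A $$ (i, j) * x j)) - (\<Sum>i<n. w $ i * (z * x i))"
      by (simp add: row_sum right_diff_distrib sum_subtractf sum_distrib_left)
    also have "(\<Sum>i<n. \<Sum>j<n. w $ i * (A $$ (i, j) * x j)) = (\<Sum>j<n. \<Sum>i<n. w $ i * (A $$ (i, j) * x j))"
      by (rule sum.swap)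
    also have "\<dots> = (\<Sum>j<n. (\<Sum>i<n. transpose_mat A $$ (j, i) * w $ i) * x j)"
      unfolding sum_distrib_right using A by (intro sum.cong refl) (simp add: mult_ac)
    also have "\<dots> = (\<Sum>j<n. z * w $ j * x j)" using w(3) by (intro sum.cong) auto
    finally show ?thesis by (simp add: mult_ac)
  qed
  ultimately show ?thesis unfolding eigen_def using w(2) by blast
qed

section \<open>Choice of the parameters\<close>

text \<open>The inequalities that the parameters must satisfy, with \<open>x = r\<close> for \<open>r\<close> the integer part of the 16th root of \<open>n\<close>. They are stated for logarithms; \<open>ln (4 * x)\<close> stands
  for \<open>ln n\<close> up to the factor \<open>16\<close>. The first two make the error term of the small ball bounds negligible, the third
  treats almost constant vectors, the fourth structured ones.\<close>
definition scale_ok :: "real \<Rightarrow> nat \<Rightarrow> nat \<Rightarrow> real \<Rightarrow> bool" where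
  "scale_ok \<epsilon> F k x \<longleftrightarrow>
     ln 4 + (6 + real F) * ln (4 * x) \<le> ln 2 * x ^ 12 \<and>
     ln 8 + (512 * real k * x ^ 13 + 6 + real F) * ln (4 * x) \<le> \<epsilon> / 2 * (x ^ 15 - 32 * real k * x ^ 13) \<and>
     (16 * (2 * x ^ 15 + 1) + real F) * ln (4 * x) \<le> \<epsilon> / 4 * (x ^ 16 - 2 - x ^ 15) \<and>
     ln (16 * 32 ^ k) + (3 * real F + 16 * x ^ 15) * ln (4 * x) \<le> 5 * (x ^ 16 - 1 - x ^ 15) * ln x \<and>
     96 + 64 * real k + 48 * 32 ^ k + 8 * 16 ^ k * 4 ^ F \<le> x"

lemma scale_ok_eventually:
  assumes "\<epsilon> > 0"
  shows "\<forall>\<^sub>F x in at_top. scale_ok \<epsilon> F k x"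
  unfolding scale_ok_def
proof (intro eventually_conj)
  show "\<forall>\<^sub>F x in at_top. ln 4 + (6 + real F) * ln (4 * x) \<le> ln 2 * x ^ 12" by real_asymp
  show "\<forall>\<^sub>F x in at_top. ln 8 + (512 * real k * x ^ 13 + 6 + real F) * ln (4 * x) \<le> \<epsilon> / 2 * (x ^ 15 - 32 * real k * x ^ 13)"
    using assms by real_asymp
  show "\<forall>\<^sub>F x in at_top. (16 * (2 * x ^ 15 + 1) + real F) * ln (4 * x) \<le> \<epsilon> / 4 * (x ^ 16 - 2 - x ^ 15)"
    using assms by real_asymp
  have "\<forall>\<^sub>F x in at_top. G + (3 * real F + 16 * x ^ 15) * ln (4 * x) \<le> 5 * (x ^ 16 - 1 - x ^ 15) * ln x" for G :: real
    by real_asymp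
  then show "\<forall>\<^sub>F x in at_top. ln (16 * 32 ^ k) + (3 * real F + 16 * x ^ 15) * ln (4 * x) \<le> 5 * (x ^ 16 - 1 - x ^ 15) * ln x" .
  show "\<forall>\<^sub>F x in at_top. 96 + 64 * real k + 48 * 32 ^ k + 8 * 16 ^ k * 4 ^ F \<le> x"
    by (rule eventually_ge_at_top)
qed

lemma power_eq_exp: "x > 0 \<Longrightarrow> x ^ n = exp (real n * ln x)" for x :: real
  by (simp add: exp_of_nat_mult)

text \<open>The parameters are powers of \<open>r\<close>, which is roughly \<open>n\<^bsup>1/16\<^esup>\<close>: cells of size \<open>r\<close>, \<open>a = r\<^bsup>12\<^esup>\<close>, and \<open>m = r\<^bsup>15\<^esup>\<close>. Thus \<open>m log n\<close> is small
  compared with \<open>n\<close>, the cells of all groups occupy \<open>O(k r\<^bsup>13\<^esup>)\<close> points and fit into \<open>m\<close> points, and \<open>\<gamma>\<close> is about \<open>r\<^bsup>-6\<^esup>\<close>, which beats every constant factor per row.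
  The number of levels is chosen so that \<open>2\<^sup>N\<close> exceeds \<open>n\<^bsup>E + 1\<^esup>\<close>, and \<open>k\<close> so that \<open>r\<^sup>k\<close> exceeds \<open>2\<^sup>N\<close>.\<close>
lemma eigen_prob_scale:
  fixes n s r E :: nat and \<mu> :: complex
  assumes eps: "0 < \<epsilon>" "\<epsilon> \<le> 1"
    and ok: "scale_ok \<epsilon> (16 * (E + 1)) (16 * (E + 1) + 1) (real r)"
    and n: "r ^ 16 \<le> n" "n < (r + 1) ^ 16"
    and s: "\<epsilon> * real n / 2 \<le> real s" "real s \<le> real n - \<epsilon> * real n / 2"
    and \<mu>: "\<mu> \<noteq> of_nat s"
  shows "measure_pmf.prob (Pi_pmf {..<n} d (\<lambda>_. subset_pmf {..<n} s)) {f. eigen n \<mu> f} \<le> 3 / real n ^ E"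
proof -
  define F where "F = 16 * (E + 1)"
  define k where "k = F + 1"
  define x where "x = real r"
  define l where "l = ln (4 * x)"
  define a where "a = r ^ 12"
  define m where "m = r ^ 15"
  define D where "D = 32 * (a * k * r)"
  note ok' = ok[folded F_def, folded k_def, folded x_def, unfolded scale_ok_def, folded l_def]
  have x: "96 + 64 * real k + 48 * 32 ^ k + 8 * 16 ^ k * 4 ^ F \<le> x" using ok' by blast
  have pos: "(0 :: real) \<le> 64 * real k" "(0 :: real) \<le> 48 * 32 ^ k" "(0 :: real) \<le> 8 * 16 ^ k * 4 ^ F" by auto
  have x96: "96 \<le> x" and xk: "64 * real k \<le> x" and x48: "48 * 32 ^ k \<le> x" and x8: "8 * 16 ^ k * 4 ^ F \<le> x"
    using x pos by linarith+
  have r96: "96 \<le> r" and rk: "64 * k \<le> r"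
    using x96 xk unfolding x_def by linarith+
  have r0: "0 < r" and x0: "0 < x" "1 \<le> x" using r96 x96 by linarith+
  have el: "exp l = 4 * x" unfolding l_def using x0 by simp
  have l0: "0 \<le> l" unfolding l_def using x0 by simp
  have n0: "0 < n" using n(1) r0 by (meson less_le_trans zero_less_power)
  have n2r: "real n \<le> (2 * x) ^ 16"
  proof -
    have "(r + 1) ^ 16 \<le> (2 * r) ^ 16" using r0 by (intro power_mono) auto
    then have "n \<le> (2 * r) ^ 16" using n(2) by linarith
    then have "real n \<le> real ((2 * r) ^ 16)" by (simp only: of_nat_le_iff)
    then show ?thesis by (simp add: x_def)
  qed
  have npow: "real n ^ i \<le> exp (16 * real i * l)" for i
  proof -
    have "real n ^ i \<le> ((2 * x) ^ 16) ^ i" using n2r by (intro power_mono) auto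
    also have "\<dots> = (2 * x) ^ (16 * i)" by (simp add: power_mult)
    also have "\<dots> \<le> (4 * x) ^ (16 * i)" using x0 by (intro power_mono) auto
    also have "\<dots> = exp (16 * real i * l)" unfolding el[symmetric] by (simp add: exp_of_nat_mult[symmetric])
    finally show ?thesis .
  qed
  \<comment> \<open>A power of two between \<open>2r\<close> and \<open>4r\<close>, so that the number of levels is an integer.\<close>
  obtain t where t: "2 * r \<le> 2 ^ t" "2 ^ t \<le> 4 * r"
  proof -
    define t where "t = (LEAST t. 2 * r \<le> 2 ^ t)"
    have ex: "\<exists>t. 2 * r \<le> 2 ^ t" by (meson less_exp less_imp_le)
    then have 1: "2 * r \<le> 2 ^ t" unfolding t_def by (rule LeastI_ex)
    have "t \<noteq> 0" using 1 r96 by (intro notI) simp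
    then obtain t' where t': "t = Suc t'" by (meson not0_implies_Suc)
    have "\<not> 2 * r \<le> 2 ^ t'" using not_less_Least[of t' "\<lambda>t. 2 * r \<le> 2 ^ t"] t' t_def by simp
    then have "2 ^ t \<le> 4 * r" by (simp add: t')
    then show ?thesis using 1 that by blast
  qed
  define N where "N = t * F"
  have twoN: "(2 * x) ^ F \<le> 2 ^ N" "2 ^ N \<le> (4 * x) ^ F"
  proof -
    have "2 * x \<le> 2 ^ t" "2 ^ t \<le> 4 * x"
    proof -
      have "real (2 * r) \<le> real (2 ^ t)" "real (2 ^ t) \<le> real (4 * r)" using t by (simp_all only: of_nat_le_iff)
      then show "2 * x \<le> 2 ^ t" "2 ^ t \<le> 4 * x" by (simp_all add: x_def)
    qed
    then show "(2 * x) ^ F \<le> 2 ^ N" "2 ^ N \<le> (4 * x) ^ F"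
      unfolding N_def power_mult using x0 power_mono[of "2 * x" "2 ^ t" F] power_mono[of "2 ^ t" "4 * x" F] by auto
  qed
  have twoN': "(2 :: real) ^ N \<le> exp (real F * l)"
    using twoN(2) unfolding el[symmetric] by (simp add: exp_of_nat_mult)
  have nE: "real n ^ (E + 1) \<le> (2 * x) ^ F"
  proof -
    have "real n ^ (E + 1) \<le> ((2 * x) ^ 16) ^ (E + 1)" using n2r by (intro power_mono) auto
    then show ?thesis by (simp only: power_mult F_def)
  qed
  have small: "exp (- (real F * l)) \<le> 1 / real n ^ (E + 1)"
  proof -
    have "(2 * x) ^ F \<le> (4 * x) ^ F" using x0 by (intro power_mono) auto
    then have "real n ^ (E + 1) \<le> exp (real F * l)"
      using nE unfolding el[symmetric] exp_of_nat_mult[symmetric] by linarith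
    then have "1 / exp (real F * l) \<le> 1 / real n ^ (E + 1)" using n0 by (intro divide_left_mono) auto
    then show ?thesis by (simp add: exp_minus inverse_eq_divide)
  qed
  have Dk: "D = 32 * k * r ^ 13"
    using power_Suc2[of r 12] by (simp add: D_def a_def)
  have rm: "real m = x ^ 15" "real a = x ^ 12" "real D = 32 * real k * x ^ 13"
    by (simp_all add: m_def a_def Dk x_def)
  have D2: "2 * D \<le> m"
  proof -
    have "2 * D = (64 * k) * r ^ 13" by (simp add: Dk)
    also have "\<dots> \<le> r * r ^ 13" using rk by (intro mult_right_mono) auto
    also have "\<dots> = r ^ 14" using power_Suc[of r 13] by simp
    also have "\<dots> \<le> m" unfolding m_def using r0 by (intro power_increasing) auto
    finally show ?thesis .
  qed
  have a96: "96 * a \<le> m"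
  proof -
    have "96 * a \<le> r * r ^ 12" unfolding a_def using r96 by (intro mult_right_mono) auto
    also have "\<dots> = r ^ 13" using power_Suc[of r 12] by simp
    also have "\<dots> \<le> m" unfolding m_def using r0 by (intro power_increasing) auto
    finally show ?thesis .
  qed
  have mn: "96 * m \<le> n"
  proof -
    have "96 * m \<le> r * r ^ 15" unfolding m_def using r96 by (intro mult_right_mono) auto
    also have "\<dots> = r ^ 16" using power_Suc[of r 15] by simp
    finally show ?thesis using n(1) by linarith
  qed
  have m0: "0 < m" using r0 by (simp add: m_def)
  have a0: "0 < a" using r0 by (simp add: a_def)
  define p1 where "p1 = real (n - s) / real n"
  define p2 where "p2 = real s / real n"
  have sn: "s \<le> n" "0 < s"
  proof -
    have e0: "0 < \<epsilon> * real n" using eps n0 by simp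
    show "s \<le> n" using s(2) e0 by linarith
    show "0 < s" using s(1) e0 by linarith
  qed
  have p12: "p1 + p2 = 1" using sn n0 by (simp add: p1_def p2_def of_nat_diff add_divide_distrib[symmetric])
  have p2b: "\<epsilon> / 2 \<le> p2" "p2 \<le> 1 - \<epsilon> / 2"
    using s n0 by (simp_all add: p2_def field_simps)
  have p1b: "\<epsilon> / 2 \<le> p1" "p1 \<le> 1 - \<epsilon> / 2" using p12 p2b by linarith+
  have pe: "p1 \<le> exp (- (\<epsilon> / 2))" "p2 \<le> exp (- (\<epsilon> / 2))"
    using p1b(2) p2b(2) exp_ge_add_one_self[of "- (\<epsilon> / 2)"] by linarith+
  have p0: "0 \<le> p1" "0 \<le> p2" using p1b p2b eps by linarith+
  define \<tau>0 where "\<tau>0 = 2 * exp (512 * real k * x ^ 13 * l - \<epsilon> / 2 * (x ^ 15 - 32 * real k * x ^ 13))"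
  have tail: "tail_bound n s j d \<le> \<tau>0" if j: "m \<le> j" "j \<le> n" and d: "d \<le> D" for j d
  proof -
    have pj: "p ^ (j - d) \<le> exp (- (\<epsilon> / 2 * (x ^ 15 - 32 * real k * x ^ 13)))"
      if "0 \<le> p" "p \<le> exp (- (\<epsilon> / 2))" for p
    proof -
      have "p ^ (j - d) \<le> exp (- (\<epsilon> / 2)) ^ (j - d)" using that by (intro power_mono)
      also have "\<dots> \<le> exp (- (\<epsilon> / 2)) ^ (m - D)" using j d eps by (intro power_decreasing) auto
      also have "\<dots> = exp (real (m - D) * (- (\<epsilon> / 2)))" by (rule exp_of_nat_mult[symmetric])
      also have "real (m - D) = x ^ 15 - 32 * real k * x ^ 13" using D2 by (simp add: of_nat_diff rm)
      finally show ?thesis by (simp add: mult.commute)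
    qed
    have "real j ^ d \<le> real n ^ D"
    proof -
      have "real j ^ d \<le> real n ^ d" using j by (intro power_mono) auto
      also have "\<dots> \<le> real n ^ D" using n0 d by (intro power_increasing) auto
      finally show ?thesis .
    qed
    also have "\<dots> \<le> exp (512 * real k * x ^ 13 * l)" using npow[of D] by (simp add: rm mult.assoc)
    finally have jd: "real j ^ d \<le> exp (512 * real k * x ^ 13 * l)" .
    have "tail_bound n s j d = real j ^ d * (p1 ^ (j - d) + p2 ^ (j - d))"
      by (simp add: tail_bound_def p1_def p2_def)
    also have "\<dots> \<le> exp (512 * real k * x ^ 13 * l) *
        (exp (- (\<epsilon> / 2 * (x ^ 15 - 32 * real k * x ^ 13))) + exp (- (\<epsilon> / 2 * (x ^ 15 - 32 * real k * x ^ 13))))"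
      using jd pj[OF p0(1) pe(1)] pj[OF p0(2) pe(2)] p0 by (intro mult_mono add_mono) auto
    also have "\<dots> = \<tau>0" by (simp add: \<tau>0_def exp_diff exp_minus inverse_eq_divide)
    finally show ?thesis .
  qed
  define \<gamma> where "\<gamma> = 1 / sqrt (2 * real a + 1)"
  have gam: "\<gamma> \<le> 1 / x ^ 6" "1 / (2 * x ^ 6) \<le> \<gamma>"
  proof -
    have x12: "(x ^ 6) ^ 2 = x ^ 12" "(2 * x ^ 6) ^ 2 = 4 * x ^ 12" by (simp_all add: power_mult_distrib flip: power_mult)
    have "(x ^ 6) ^ 2 \<le> 2 * real a + 1" unfolding x12 rm using x0 by simp
    then have u: "x ^ 6 \<le> sqrt (2 * real a + 1)" by (rule real_le_rsqrt)
    then show "\<gamma> \<le> 1 / x ^ 6" unfolding \<gamma>_def using x0 by (intro divide_left_mono) auto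
    have "1 \<le> x ^ 12" using x0 by simp
    then have "2 * real a + 1 \<le> (2 * x ^ 6) ^ 2" unfolding x12 rm by linarith
    then have "sqrt (2 * real a + 1) \<le> 2 * x ^ 6" using x0 by (intro real_le_lsqrt) auto
    then show "1 / (2 * x ^ 6) \<le> \<gamma>" unfolding \<gamma>_def using u x0 by (intro divide_left_mono) auto
  qed
  have gam0: "0 < \<gamma>" by (simp add: \<gamma>_def)
  have gam3: "3 * \<gamma> \<le> 1"
  proof -
    have "x \<le> x ^ 6" using x0 power_increasing[of 1 6 x] by simp
    then have "3 \<le> x ^ 6" using x96 by linarith
    then have "1 / x ^ 6 \<le> 1 / 3" by (intro divide_left_mono) auto
    then show ?thesis using gam(1) by linarith
  qed
  have err: "(1 / 2) ^ a + \<tau>0 \<le> \<gamma> / 2 ^ N"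
  proof -
    define e where "e = exp (- ((6 + real F) * l))"
    have "(1 / 2 :: real) ^ a = exp (real a * ln (1 / 2))" by (rule power_eq_exp) simp
    also have "\<dots> = exp (- (ln 2 * x ^ 12))" by (simp add: rm ln_div mult.commute)
    also have "\<dots> \<le> exp (- ln 4 + - ((6 + real F) * l))" using ok' by simp
    also have "\<dots> = e / 4" by (simp only: exp_add) (simp add: e_def exp_minus inverse_eq_divide)
    finally have 1: "(1 / 2) ^ a \<le> e / 4" .
    have "512 * real k * x ^ 13 * l - \<epsilon> / 2 * (x ^ 15 - 32 * real k * x ^ 13) \<le> - ln 8 + - ((6 + real F) * l)"
    proof -
      have "(512 * real k * x ^ 13 + 6 + real F) * l = 512 * real k * x ^ 13 * l + (6 + real F) * l" by (simp add: algebra_simps)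
      then show ?thesis using ok' by linarith
    qed
    then have "\<tau>0 \<le> 2 * exp (- ln 8 + - ((6 + real F) * l))" by (simp add: \<tau>0_def)
    also have "\<dots> = e / 4" by (simp only: exp_add) (simp add: e_def exp_minus inverse_eq_divide)
    finally have 2: "\<tau>0 \<le> e / 4" .
    have "e / 2 = exp (- (6 * l)) / 2 * exp (- (real F * l))" by (simp add: e_def algebra_simps flip: exp_add)
    also have "\<dots> \<le> 1 / (2 * x ^ 6) * (1 / 2 ^ N)"
    proof (intro mult_mono)
      have "x ^ 6 \<le> (4 * x) ^ 6" using x0 by (intro power_mono) auto
      also have "\<dots> = exp (6 * l)" unfolding el[symmetric] exp_of_nat_mult[symmetric] by simp
      finally have "1 / exp (6 * l) \<le> 1 / x ^ 6" using x0 by (intro divide_left_mono) auto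
      then show "exp (- (6 * l)) / 2 \<le> 1 / (2 * x ^ 6)" by (simp add: exp_minus inverse_eq_divide)
      have "1 / exp (real F * l) \<le> 1 / 2 ^ N" using twoN' by (intro divide_left_mono) auto
      then show "exp (- (real F * l)) \<le> 1 / 2 ^ N" by (simp add: exp_minus inverse_eq_divide)
    qed (use x0 in auto)
    also have "\<dots> \<le> \<gamma> * (1 / 2 ^ N)" using gam(2) by (intro mult_right_mono) auto
    finally have "e / 2 \<le> \<gamma> / 2 ^ N" by simp
    then show ?thesis using 1 2 by linarith
  qed
  have cellsize: "8 * 2 ^ N * 16 ^ k \<le> real r ^ k"
  proof -
    have "8 * 2 ^ N * 16 ^ k \<le> 8 * (4 * x) ^ F * 16 ^ k" using twoN(2) by simp
    also have "\<dots> = (8 * 16 ^ k * 4 ^ F) * x ^ F" by (simp add: power_mult_distrib)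
    also have "\<dots> \<le> x * x ^ F" using x8 x0 by (intro mult_right_mono) auto
    also have "\<dots> = real r ^ k" by (simp add: x_def k_def)
    finally show ?thesis .
  qed
  define \<rho> where "\<rho> = 1 - real s * real (n - s) / real n ^ 2"
  have rho_eq: "\<rho> = 1 - p2 * p1" by (simp add: \<rho>_def p1_def p2_def power2_eq_square)
  have rho0: "0 < \<rho>"
  proof -
    have "p2 * p1 \<le> 1 * p1" using p0 p12 by (intro mult_right_mono) linarith+
    then show ?thesis using rho_eq p1b(2) eps by linarith
  qed
  have rho1: "\<rho> \<le> exp (- (\<epsilon> / 4))"
  proof -
    have "\<epsilon> / 4 \<le> p2 * p1"
    proof (cases "p1 \<le> 1 / 2")
      case True
      then have "1 / 2 \<le> p2" using p12 by linarith
      then have "1 / 2 * (\<epsilon> / 2) \<le> p2 * p1" using p1b eps p0 by (intro mult_mono) auto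
      then show ?thesis by simp
    next
      case False
      then have "\<epsilon> / 2 * (1 / 2) \<le> p2 * p1" using p2b eps p0 by (intro mult_mono) auto
      then show ?thesis by simp
    qed
    then show ?thesis using rho_eq exp_ge_add_one_self[of "- (\<epsilon> / 4)"] by linarith
  qed
  have F0: "0 < F" by (simp add: F_def)
  have t0: "0 < t" using t(1) r96 by (cases t) auto
  interpret P: scales n s r k a m N \<tau>0 \<gamma> \<rho> \<mu>
  proof unfold_locales
    show "s \<le> n" "0 < s" by fact+
    show "m < n" using mn m0 by linarith
    show "0 < m" "0 < r" "0 < a" by fact+
    show "0 < k" by (simp add: k_def)
    show "0 < N" using t0 F0 by (simp add: N_def)
    show "\<mu> \<noteq> of_nat s" by fact
    show "64 * (a * k * r) \<le> m" using D2 by (simp add: D_def)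
    show "96 * a \<le> m" by fact
    show "tail_bound n s j (32 * (a * k * r)) \<le> \<tau>0" if "m \<le> j" "j \<le> n" for j
      using tail[OF that, of D] by (simp add: D_def)
    show "tail_bound n s j (32 * a) \<le> \<tau>0" if "m \<le> j" "j \<le> n" for j
    proof (rule tail[OF that])
      have "a * 1 \<le> a * (k * r)" using r0 by (intro mult_left_mono) (auto simp: k_def)
      then show "32 * a \<le> D" by (simp add: D_def mult.assoc)
    qed
    show "\<gamma> = 1 / sqrt (2 * real a + 1)" by (rule \<gamma>_def)
    show "\<rho> = 1 - real s * real (n - s) / real n ^ 2" by (rule \<rho>_def)
  qed (use gam3 err cellsize rho0 in \<open>auto\<close>)
  have cb: "P.constant_bound \<le> exp (- (real F * l))"
  proof -
    define q where "q = n - 2 - m"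
    have nq: "n - 1 = q + (m + 1)" using mn m0 by (simp add: q_def)
    have "P.constant_bound = real n ^ (2 * m + 1) * (\<rho> ^ (n - 1) / \<rho> ^ (m + 1))"
      by (simp add: P.constant_bound_def power_add mult_2)
    also have "\<rho> ^ (n - 1) / \<rho> ^ (m + 1) = \<rho> ^ q" unfolding nq power_add using rho0 by simp
    also have "real n ^ (2 * m + 1) * \<rho> ^ q \<le> exp (16 * real (2 * m + 1) * l) * exp (- (\<epsilon> / 4)) ^ q"
      using rho0 rho1 by (intro mult_mono power_mono npow) auto
    also have "\<dots> = exp (16 * (2 * x ^ 15 + 1) * l - real q * (\<epsilon> / 4))"
      unfolding exp_of_nat_mult[symmetric] exp_add[symmetric] by (simp add: rm)
    also have "\<dots> \<le> exp (- (real F * l))"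
    proof -
      have "real (r ^ 16) \<le> real n" using n(1) by (simp only: of_nat_le_iff)
      then have "x ^ 16 \<le> real n" by (simp add: x_def)
      moreover have "q + 2 + m = n" using mn m0 unfolding q_def by linarith
      then have "real q + 2 + real m = real n" by linarith
      ultimately have "x ^ 16 - 2 - x ^ 15 \<le> real q" unfolding rm by linarith
      then have "\<epsilon> / 4 * (x ^ 16 - 2 - x ^ 15) \<le> \<epsilon> / 4 * real q" using eps by (intro mult_left_mono) auto
      moreover have "(16 * (2 * x ^ 15 + 1) + real F) * l = 16 * (2 * x ^ 15 + 1) * l + real F * l" by (simp add: algebra_simps)
      ultimately have "16 * (2 * x ^ 15 + 1) * l - real q * (\<epsilon> / 4) \<le> - (real F * l)"
        using ok' by (simp add: mult.commute[of "real q"])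
      then show ?thesis by simp
    qed
    finally show ?thesis .
  qed
  have sb: "real N * P.structured_bound \<le> exp (- (real F * l))"
  proof -
    define q where "q = n - 1 - m"
    define b where "b = 48 * 32 ^ k * \<gamma>"
    have b: "0 \<le> b" "b \<le> 1 / x ^ 5"
    proof -
      show "0 \<le> b" using gam0 by (simp add: b_def)
      have "b \<le> x * (1 / x ^ 6)" unfolding b_def using x48 gam(1) gam0 x0 by (intro mult_mono) auto
      also have "\<dots> = 1 / x ^ 5" using x0 by (simp add: eval_nat_numeral)
      finally show "b \<le> 1 / x ^ 5" .
    qed
    have x5: "1 / x ^ 5 = exp (- (5 * ln x))"
    proof -
      have "x ^ 5 = exp (5 * ln x)" using power_eq_exp[OF x0(1), of 5] by simp
      then show ?thesis by (simp add: exp_minus inverse_eq_divide)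
    qed
    have bq: "b ^ q \<le> exp (- (5 * (x ^ 16 - 1 - x ^ 15) * ln x))"
    proof -
      have "b ^ q \<le> exp (- (5 * ln x)) ^ q" using b unfolding x5 by (intro power_mono) auto
      also have "\<dots> = exp (real q * (- (5 * ln x)))" by (rule exp_of_nat_mult[symmetric])
      also have "\<dots> \<le> exp (- (5 * (x ^ 16 - 1 - x ^ 15) * ln x))"
      proof -
        have "real (r ^ 16) \<le> real n" using n(1) by (simp only: of_nat_le_iff)
        then have "x ^ 16 \<le> real n" by (simp add: x_def)
      moreover have "q + 1 + m = n" using mn m0 unfolding q_def by linarith
      then have "real q + 1 + real m = real n" by linarith
      ultimately have "x ^ 16 - 1 - x ^ 15 \<le> real q" unfolding rm by linarith
        then have "(x ^ 16 - 1 - x ^ 15) * (5 * ln x) \<le> real q * (5 * ln x)" using x0 by (intro mult_right_mono) auto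
        then show ?thesis by (simp add: mult_ac)
      qed
      finally show ?thesis .
    qed
    have N2: "real N \<le> 2 ^ N"
    proof -
      have "N \<le> 2 ^ N" by (simp add: less_imp_le)
      then have "real N \<le> real (2 ^ N)" by (simp only: of_nat_le_iff)
      then show ?thesis by simp
    qed
    have "real N * P.structured_bound = real N * (b ^ q * (16 * 2 ^ N * 32 ^ k) * real n ^ m)"
      by (simp add: P.structured_bound_def b_def q_def)
    also have "\<dots> = (real N * 2 ^ N) * (16 * 32 ^ k) * real n ^ m * b ^ q" by simp
    also have "\<dots> \<le> (exp (real F * l) * exp (real F * l)) * exp (ln (16 * 32 ^ k)) * exp (16 * real m * l)
        * exp (- (5 * (x ^ 16 - 1 - x ^ 15) * ln x))"
      using b(1) by (intro mult_mono order_trans[OF N2 twoN'] twoN' npow bq) auto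
    also have "\<dots> = exp (real F * l + real F * l + ln (16 * 32 ^ k) + 16 * x ^ 15 * l - 5 * (x ^ 16 - 1 - x ^ 15) * ln x)"
      by (simp only: exp_add[symmetric] rm) simp
    also have "\<dots> \<le> exp (- (real F * l))"
    proof -
      have "(3 * real F + 16 * x ^ 15) * l = real F * l + real F * l + real F * l + 16 * x ^ 15 * l" by (simp add: algebra_simps)
      then have "real F * l + real F * l + ln (16 * 32 ^ k) + 16 * x ^ 15 * l - 5 * (x ^ 16 - 1 - x ^ 15) * ln x \<le> - (real F * l)"
        using ok' by linarith
      then show ?thesis by simp
    qed
    finally show ?thesis .
  qed
  have g: "3 * \<gamma> / 2 ^ N \<le> 1 / real n ^ (E + 1)"
  proof -
    have "3 * \<gamma> / 2 ^ N \<le> 1 / 2 ^ N" using gam3 by (intro divide_right_mono) auto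
    also have "\<dots> \<le> 1 / real n ^ (E + 1)"
      using nE twoN(1) n0 by (intro divide_left_mono) auto
    finally show ?thesis .
  qed
  have "measure_pmf.prob (Pi_pmf {..<n} d (\<lambda>_. subset_pmf {..<n} s)) {f. eigen n \<mu> f}
      \<le> real n * (P.constant_bound + real N * P.structured_bound + 3 * \<gamma> / 2 ^ N)"
    by (rule P.eigen_prob)
  also have "\<dots> \<le> real n * (1 / real n ^ (E + 1) + 1 / real n ^ (E + 1) + 1 / real n ^ (E + 1))"
    using cb sb g small by (intro mult_left_mono add_mono) auto
  also have "\<dots> = 3 / real n ^ E" using n0 by simp
  finally show ?thesis .
qed

section \<open>The random matrix\<close>

definition indicator_vec :: "nat \<Rightarrow> nat set \<Rightarrow> int Matrix.vec" where
  "indicator_vec n X = Matrix.vec n (\<lambda>j. if j \<in> X then 1 else 0)"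

lemma random_row_eq:
  assumes "t \<le> n"
  shows "random_row n (int t) = map_pmf (indicator_vec n) (subset_pmf {..<n} t)"
proof -
  let ?A = "{X. X \<subseteq> {..<n} \<and> card X = t}"
  have ne: "finite ?A" "?A \<noteq> {}" using subsets_finite_nonempty[of "{..<n}" t] assms by auto
  have supp: "{i. i < n \<and> indicator_vec n X $ i = 1} = X" if "X \<subseteq> {..<n}" for X
    using that by (auto simp: indicator_vec_def split: if_splits)
  have "inj_on (indicator_vec n) ?A"
  proof (rule inj_onI)
    fix X Y assume "X \<in> ?A" "Y \<in> ?A" and eq: "indicator_vec n X = indicator_vec n Y"
    then have "X \<subseteq> {..<n}" "Y \<subseteq> {..<n}" by simp_all
    then show "X = Y" using supp[of X] supp[of Y] unfolding eq by simp
  qed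
  then have "map_pmf (indicator_vec n) (subset_pmf {..<n} t) = pmf_of_set (indicator_vec n ` ?A)"
    unfolding subset_pmf_def using ne by (intro map_pmf_of_set_inj)
  also have "indicator_vec n ` ?A = binary_vecs n (int t)"
  proof (intro equalityI subsetI)
    fix v assume "v \<in> indicator_vec n ` ?A"
    then obtain X where X: "X \<in> ?A" "v = indicator_vec n X" by blast
    have "card {i. i < n \<and> indicator_vec n X $ i = 1} = t" using X(1) supp[of X] by simp
    moreover have "indicator_vec n X \<in> carrier_vec n" "\<forall>i<n. indicator_vec n X $ i \<in> {0, 1}"
      by (simp_all add: indicator_vec_def)
    ultimately show "v \<in> binary_vecs n (int t)" unfolding X(2) binary_vecs_def by simp
  next
    fix v assume v: "v \<in> binary_vecs n (int t)"
    let ?X = "{i. i < n \<and> v $ i = 1}"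
    have "?X \<in> ?A" using v by (auto simp: binary_vecs_def)
    moreover have "v = indicator_vec n ?X"
      using v by (intro eq_vecI) (auto simp: binary_vecs_def indicator_vec_def)
    ultimately show "v \<in> indicator_vec n ` ?A" by blast
  qed
  finally show ?thesis by (simp add: random_row_def)
qed

lemma random_matrix_eq:
  assumes "t \<le> n"
  shows "random_matrix n (int t)
    = map_pmf (\<lambda>f. mat\<^sub>r n n (\<lambda>i. indicator_vec n (f i))) (Pi_pmf {..<n} {} (\<lambda>_. subset_pmf {..<n} t))"
proof -
  have "indicator_vec n {} = 0\<^sub>v n" by (intro eq_vecI) (auto simp: indicator_vec_def)
  then have "Pi_pmf {..<n} (0\<^sub>v n) (\<lambda>_. map_pmf (indicator_vec n) (subset_pmf {..<n} t))
      = map_pmf (\<lambda>f. indicator_vec n \<circ> f) (Pi_pmf {..<n} {} (\<lambda>_. subset_pmf {..<n} t))"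
    by (intro Pi_pmf_map) auto
  then show ?thesis
    unfolding random_matrix_def random_row_eq[OF assms] by (simp add: pmf.map_comp o_def)
qed

text \<open>A union bound over the polynomially many possible eigenvalues.\<close>
lemma low_degree_prob_le:
  assumes t: "t \<le> n"
    and bound: "\<And>\<mu>. \<mu> \<noteq> of_nat t \<Longrightarrow>
      measure_pmf.prob (Pi_pmf {..<n} {} (\<lambda>_. subset_pmf {..<n} t)) {f. eigen n \<mu> f} \<le> \<beta>"
  shows "measure_pmf.prob (random_matrix n (int t))
      {M. \<exists>z. nontrivial_eigenvalue (int t) M z \<and> algebraic z \<and> algebraic_degree z \<le> d}
    \<le> real (card (candidates d n)) * \<beta>"
proof -
  let ?P = "Pi_pmf {..<n} {} (\<lambda>_. subset_pmf {..<n} t)"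
  let ?M = "\<lambda>f. mat\<^sub>r n n (\<lambda>i. indicator_vec n (f i))"
  let ?E = "{M. \<exists>z. nontrivial_eigenvalue (int t) M z \<and> algebraic z \<and> algebraic_degree z \<le> d}"
  let ?C = "candidates d n - {of_nat t}"
  have fC: "finite ?C" using candidates(1) by auto
  have "measure_pmf.prob (random_matrix n (int t)) ?E = measure_pmf.prob ?P (?M -` ?E)"
    by (simp add: random_matrix_eq[OF t])
  also have "\<dots> = measure_pmf.prob ?P (?M -` ?E \<inter> set_pmf ?P)" by (simp add: measure_Int_set_pmf)
  also have "\<dots> \<le> measure_pmf.prob ?P (\<Union>z\<in>?C. {f. eigen n z f})"
  proof (intro measure_pmf.finite_measure_mono subsetI)
    fix f assume f: "f \<in> ?M -` ?E \<inter> set_pmf ?P"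
    then obtain z where z: "nontrivial_eigenvalue (int t) (?M f) z" "algebraic z" "algebraic_degree z \<le> d" by auto
    have ev: "eigenvalue (map_mat complex_of_int (?M f)) z" and zt: "z \<noteq> of_nat t"
      using z(1) by (auto simp: nontrivial_eigenvalue_def)
    have fX: "f i \<subseteq> {..<n}" if "i < n" for i
    proof -
      have "f i \<in> set_pmf (subset_pmf {..<n} t)" using f that by (auto simp: set_Pi_pmf PiE_dflt_def)
      then show ?thesis using t by (simp add: set_subset_pmf)
    qed
    have Mc: "?M f \<in> carrier_mat n n" by simp
    have ent: "?M f $$ (i, j) = (if j \<in> f i then 1 else 0)" if "i < n" "j < n" for i j
      using that by (simp add: indicator_vec_def)
    have "z \<in> candidates d n"
    proof (rule eigenvalue_in_candidates[OF Mc _ ev z(2,3)])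
      show "?M f $$ (i, j) \<in> {0, 1}" if "i < n" "j < n" for i j unfolding ent[OF that] by simp
    qed
    moreover have "eigen n z f"
    proof (rule eigenvalue_imp_eigen[OF _ _ fX ev])
      show "map_mat complex_of_int (?M f) \<in> carrier_mat n n" using Mc by simp
      show "map_mat complex_of_int (?M f) $$ (i, j) = (if j \<in> f i then 1 else 0)" if "i < n" "j < n" for i j
        using that Mc ent[OF that] by simp
    qed
    ultimately show "f \<in> (\<Union>z\<in>?C. {f. eigen n z f})" using zt by blast
  qed simp
  also have "\<dots> \<le> (\<Sum>z\<in>?C. measure_pmf.prob ?P {f. eigen n z f})"
    using fC by (intro measure_pmf.finite_measure_subadditive_finite) auto
  also have "\<dots> \<le> (\<Sum>z\<in>?C. \<beta>)" using bound by (intro sum_mono) auto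
  also have "\<dots> = real (card ?C) * \<beta>" by simp
  also have "\<dots> \<le> real (card (candidates d n)) * \<beta>"
  proof (rule mult_right_mono)
    show "real (card ?C) \<le> real (card (candidates d n))" using candidates(1) by (simp add: card_mono)
    have "0 \<le> measure_pmf.prob ?P {f. eigen n (of_nat (Suc t)) f}" by simp
    also have "\<dots> \<le> \<beta>" by (rule bound) (simp only: of_nat_eq_iff)
    finally show "0 \<le> \<beta>" .
  qed
  finally show ?thesis .
qed

lemma card_candidates_le:
  assumes "4 \<le> n" "d \<le> n"
  shows "card (candidates d n) \<le> n ^ ((2 * d + 1) * (d + 1) + 1)"
proof -
  have "n + 1 \<le> n ^ 2"
  proof -
    have "n + 1 \<le> 2 * n" using assms by simp
    also have "\<dots> \<le> n * n" using assms by (intro mult_right_mono) auto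
    finally show ?thesis by (simp add: power2_eq_square)
  qed
  then have "(n + 1) ^ d \<le> (n ^ 2) ^ d" by (intro power_mono) auto
  then have 1: "(n + 1) ^ d \<le> n ^ (2 * d)" by (simp add: power_mult)
  have "1 \<le> n ^ (2 * d)" using assms by simp
  then have "2 * (n + 1) ^ d + 1 \<le> 3 * n ^ (2 * d)" using 1 by linarith
  also have "\<dots> \<le> n * n ^ (2 * d)" using assms by (intro mult_right_mono) auto
  finally have "2 * (n + 1) ^ d + 1 \<le> n ^ (2 * d + 1)" by simp
  then have "(2 * (n + 1) ^ d + 1) ^ (d + 1) \<le> (n ^ (2 * d + 1)) ^ (d + 1)" by (intro power_mono) auto
  then have "d * (2 * (n + 1) ^ d + 1) ^ (d + 1) \<le> n * (n ^ (2 * d + 1)) ^ (d + 1)"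
    using assms by (intro mult_mono) auto
  also have "\<dots> = n ^ ((2 * d + 1) * (d + 1) + 1)" unfolding power_add power_mult by simp
  finally show ?thesis using candidates(2)[of d n] by linarith
qed

theorem theorem2p12:
  fixes \<epsilon> K B :: real
  assumes "0 < \<epsilon>" and "\<epsilon> \<le> 1" and "K \<ge> 1" and "B > 0"
  shows "\<forall>\<^sub>F n :: nat in sequentially. \<forall>s :: int.
           \<bar>real_of_int s - real n / 2\<bar> \<le> (1 - \<epsilon>) * real n / 2 \<longrightarrow>
           measure_pmf.prob (random_matrix n s)
             {M. \<exists>z. nontrivial_eigenvalue s M z \<and> algebraic z \<and> real (algebraic_degree z) \<le> K}
           \<le> real n powr (- B)"
proof -
  define d where "d = nat \<lfloor>K\<rfloor>"
  define C where "C = (2 * d + 1) * (d + 1) + 1"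
  define E where "E = C + 1 + nat \<lceil>B\<rceil>"
  obtain X where X: "\<And>x. X \<le> x \<Longrightarrow> scale_ok \<epsilon> (16 * (E + 1)) (16 * (E + 1) + 1) x"
    using scale_ok_eventually[OF assms(1)] unfolding eventually_at_top_linorder by blast
  define R where "R = nat \<lceil>X\<rceil>"
  have "\<forall>\<^sub>F n :: nat in sequentially. R ^ 16 \<le> n \<and> 4 \<le> n \<and> d \<le> n"
    by (intro eventually_conj eventually_ge_at_top)
  then show ?thesis
  proof (rule eventually_mono, intro allI impI)
    fix n :: nat and s :: int
    assume n: "R ^ 16 \<le> n \<and> 4 \<le> n \<and> d \<le> n" and s: "\<bar>real_of_int s - real n / 2\<bar> \<le> (1 - \<epsilon>) * real n / 2"
    have sb: "\<epsilon> * real n / 2 \<le> real_of_int s" "real_of_int s \<le> real n - \<epsilon> * real n / 2"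
      using s by (simp_all add: abs_le_iff field_simps)
    have e0: "0 \<le> \<epsilon> * real n / 2" using assms(1) by simp
    then have "0 \<le> s" using sb(1) by linarith
    then obtain t where t: "s = int t" using nonneg_int_cases by blast
    have tn: "t \<le> n" using sb(2) e0 t by simp
    obtain r where r: "r ^ 16 \<le> n" "n < (r + 1) ^ 16"
    proof -
      define r where "r = (LEAST r. n < (r + 1) ^ 16)"
      have "n < (n + 1) ^ 16" using power_increasing[of 1 16 "n + 1"] by simp
      then have 1: "n < (r + 1) ^ 16" unfolding r_def by (rule LeastI)
      have 2: "r ^ 16 \<le> n"
      proof (cases r)
        case (Suc r')
        then have "\<not> n < (r' + 1) ^ 16" using not_less_Least[of r' "\<lambda>r. n < (r + 1) ^ 16"] r_def by simp
        then show ?thesis using Suc by simp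
      qed simp
      show ?thesis using that[OF 2 1] .
    qed
    have "R \<le> r"
    proof (rule ccontr)
      assume "\<not> R \<le> r"
      then have "(r + 1) ^ 16 \<le> R ^ 16" by (intro power_mono) auto
      then show False using r(2) n by linarith
    qed
    then have "X \<le> real r" unfolding R_def by linarith
    then have ok: "scale_ok \<epsilon> (16 * (E + 1)) (16 * (E + 1) + 1) (real r)" by (rule X)
    have degree: "real i \<le> K \<longleftrightarrow> i \<le> d" for i :: nat
      unfolding d_def using assms(3) by (simp add: le_nat_iff le_floor_iff)
    have "measure_pmf.prob (random_matrix n s)
        {M. \<exists>z. nontrivial_eigenvalue s M z \<and> algebraic z \<and> real (algebraic_degree z) \<le> K}
      \<le> real (card (candidates d n)) * (3 / real n ^ E)"
      unfolding t degree
      by (rule low_degree_prob_le[OF tn], rule eigen_prob_scale[OF assms(1,2) ok r])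
        (use sb t in auto)
    also have "\<dots> \<le> real n ^ C * (real n / real n ^ E)"
    proof (intro mult_mono divide_right_mono)
      have "card (candidates d n) \<le> n ^ C" unfolding C_def using n by (intro card_candidates_le) auto
      then have "real (card (candidates d n)) \<le> real (n ^ C)" by (simp only: of_nat_le_iff)
      then show "real (card (candidates d n)) \<le> real n ^ C" by simp
    qed (use n in auto)
    also have "\<dots> = 1 / real n ^ nat \<lceil>B\<rceil>" using n by (simp add: E_def power_add)
    also have "\<dots> = real n powr (- real (nat \<lceil>B\<rceil>))"
      using n by (simp add: powr_minus powr_realpow inverse_eq_divide)
    also have "\<dots> \<le> real n powr (- B)"
    proof (rule powr_mono)
      show "- real (nat \<lceil>B\<rceil>) \<le> - B" using assms(4) by linarith
    qed (use n in simp)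
    finally show "measure_pmf.prob (random_matrix n s)
        {M. \<exists>z. nontrivial_eigenvalue s M z \<and> algebraic z \<and> real (algebraic_degree z) \<le> K}
      \<le> real n powr (- B)" .
  qed
qed

end
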